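(* Let $n\in\mathbb{N}$ be a fixed positive integer. Then there is an algorithm which, given an identity $v=w$ over a finite alphabet $\Sigma$, decides in time polynomial in $|v|+|w|$ and $|\Sigma|$ whether the identity holds in $UT_n(\mathbb{T})$.
   Context: The tropical semiring $\mathbb{T}$ is the set $\mathbb{R}\cup\{-\infty\}$ with operations $a\oplus b=\max(a,b)$ and $a\otimes b=a+b$, where $-\infty\oplus a=a$ and $-\infty\otimes a=-\infty$. $UT_n(\mathbb{T})$ is the monoid of all $n\times n$ matrices over $\mathbb{T}$ with all entries below the main diagonal equal to $-\infty$, under the matrix multiplication induced by $\oplus$ and $\otimes$. An identity $v=w$ over $\Sigma$ is a pair of words $v,w$ in the free semigroup $\Sigma^+$ of non-empty words over $\Sigma$; $|v|$ denotes the length of the word $v$. The identity holds in a semigroup $S$ if every semigroup morphism $\Sigma^+\to S$ maps $v$ and $w$ to the same element of $S$. *)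

theory Defs
  imports
    "Jordan_Normal_Form.Matrix"
    "HOL-Library.Log_Nat"
    "HOL-Computational_Algebra.Polynomial"
begin

section \<open>The tropical semiring and upper triangular tropical matrices\<close>

datatype trop = NegInf | Fin real

text \<open>In the semiring structure \<open>+\<close> is the maximum, \<open>*\<close> is the addition of reals,
  \<open>0\<close> is minus infinity and \<open>1\<close> is the real number zero.\<close>

instantiation trop :: comm_semiring_1
begin

definition zero_trop :: trop where "zero_trop = NegInf"

definition one_trop :: trop where "one_trop = Fin 0"

fun plus_trop :: "trop \<Rightarrow> trop \<Rightarrow> trop" where
  "plus_trop NegInf y = y"
| "plus_trop x NegInf = x"
| "plus_trop (Fin a) (Fin b) = Fin (max a b)"

fun times_trop :: "trop \<Rightarrow> trop \<Rightarrow> trop" where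
  "times_trop (Fin a) (Fin b) = Fin (a + b)"
| "times_trop _ _ = NegInf"

instance
proof
  fix a b c :: trop
  show "a * b * c = a * (b * c)" by (cases a; cases b; cases c; simp)
  show "a * b = b * a" by (cases a; cases b) simp_all
  show "1 * a = a" by (cases a) (simp_all add: one_trop_def)
  show "a + b + c = a + (b + c)" by (cases a; cases b; cases c) simp_all
  show "a + b = b + a" by (cases a; cases b) simp_all
  show "0 + a = a" by (simp add: zero_trop_def)
  show "0 * a = 0" by (simp add: zero_trop_def)
  show "a * 0 = 0" by (cases a) (simp_all add: zero_trop_def)
  show "(a + b) * c = a * c + b * c" by (cases a; cases b; cases c) (simp_all add: max_def)
  show "(0::trop) \<noteq> 1" by (simp add: zero_trop_def one_trop_def)
qed

end

definition UT_trop :: "nat \<Rightarrow> trop mat set" where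
  "UT_trop n = {A \<in> carrier_mat n n. upper_triangular A}"

section \<open>Semigroup identities\<close>

definition free_semigroup :: "'a set \<Rightarrow> 'a list set" where
  "free_semigroup \<Sigma> = lists \<Sigma> - {[]}"

definition semigroup_morphism ::
  "'a set \<Rightarrow> 's set \<Rightarrow> ('s \<Rightarrow> 's \<Rightarrow> 's) \<Rightarrow> ('a list \<Rightarrow> 's) \<Rightarrow> bool" where
  "semigroup_morphism \<Sigma> S opr \<phi> \<longleftrightarrow>
     \<phi> \<in> free_semigroup \<Sigma> \<rightarrow> S \<and>
     (\<forall>x \<in> free_semigroup \<Sigma>. \<forall>y \<in> free_semigroup \<Sigma>. \<phi> (x @ y) = opr (\<phi> x) (\<phi> y))"

definition identity_holds ::
  "'a set \<Rightarrow> 's set \<Rightarrow> ('s \<Rightarrow> 's \<Rightarrow> 's) \<Rightarrow> 'a list \<Rightarrow> 'a list \<Rightarrow> bool" where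
  "identity_holds \<Sigma> S opr v w \<longleftrightarrow>
     (\<forall>\<phi>. semigroup_morphism \<Sigma> S opr \<phi> \<longrightarrow> \<phi> v = \<phi> w)"

section \<open>Random access machines with logarithmic cost\<close>

text \<open>
  Algorithms are programs for the random access machine of Aho, Hopcroft and Ullman, with
  structured control flow in place of jumps.  The memory cells hold integers of unbounded size,
  addresses are integers too, and there is indirect addressing.  The time is measured by the
  logarithmic cost criterion: an operation is charged the bit lengths of its operands (including
  the addresses that are used) and of its result.  Under this criterion, time on the machine and
  time on a Turing machine are polynomially related.
\<close>

type_synonym memory = "int \<Rightarrow> int"

datatype expr =
    Const int
  | Mem expr  \<comment> \<open>the content of the cell whose address is the value of the expression\<close>
  | Add expr expr
  | Sub expr expr
  | Mult expr expr
  | Div expr expr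

datatype prog =
    Skip
  | Assign expr expr  \<comment> \<open>the first expression gives the address of the cell that is overwritten\<close>
  | Seq prog prog
  | IfPos expr prog prog
  | WhilePos expr prog

fun val :: "expr \<Rightarrow> memory \<Rightarrow> int" where
  "val (Const c) m = c"
| "val (Mem e) m = m (val e m)"
| "val (Add e f) m = val e m + val f m"
| "val (Sub e f) m = val e m - val f m"
| "val (Mult e f) m = val e m * val f m"
| "val (Div e f) m = val e m div val f m"

text \<open>The number of binary digits of the absolute value, plus one for the sign.\<close>

definition bit_length :: "int \<Rightarrow> nat" where
  "bit_length i = 1 + floorlog 2 (nat \<bar>i\<bar>)"

text \<open>Each subexpression is charged the length of its value; as the operands of an operation
  are subexpressions, their lengths are thereby accounted for.\<close>

fun cost :: "expr \<Rightarrow> memory \<Rightarrow> nat" where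
  "cost (Const c) m = bit_length c"
| "cost (Mem e) m = cost e m + bit_length (val (Mem e) m)"
| "cost (Add e f) m = cost e m + cost f m + bit_length (val (Add e f) m)"
| "cost (Sub e f) m = cost e m + cost f m + bit_length (val (Sub e f) m)"
| "cost (Mult e f) m = cost e m + cost f m + bit_length (val (Mult e f) m)"
| "cost (Div e f) m = cost e m + cost f m + bit_length (val (Div e f) m)"

text \<open>\<open>exec p m t m'\<close>: started in memory \<open>m\<close>, the program \<open>p\<close> terminates in memory \<open>m'\<close> after
  time \<open>t\<close>.\<close>

inductive exec :: "prog \<Rightarrow> memory \<Rightarrow> nat \<Rightarrow> memory \<Rightarrow> bool" where
  Skip: "exec Skip m 1 m"
| Assign: "exec (Assign a e) m (1 + cost a m + cost e m) (m(val a m := val e m))"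
| Seq: "exec p m t m' \<Longrightarrow> exec q m' u m'' \<Longrightarrow> exec (Seq p q) m (t + u) m''"
| IfTrue: "val e m > 0 \<Longrightarrow> exec p m t m' \<Longrightarrow> exec (IfPos e p q) m (1 + cost e m + t) m'"
| IfFalse: "\<not> val e m > 0 \<Longrightarrow> exec q m t m' \<Longrightarrow> exec (IfPos e p q) m (1 + cost e m + t) m'"
| WhileFalse: "\<not> val e m > 0 \<Longrightarrow> exec (WhilePos e p) m (1 + cost e m) m"
| WhileTrue: "val e m > 0 \<Longrightarrow> exec p m t m' \<Longrightarrow> exec (WhilePos e p) m' u m'' \<Longrightarrow>
    exec (WhilePos e p) m (1 + cost e m + t + u) m''"

inductive_cases exec_SkipE: "exec Skip m t m'"
inductive_cases exec_AssignE: "exec (Assign a e) m t m'"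
inductive_cases exec_SeqE: "exec (Seq p q) m t m'"
inductive_cases exec_IfPosE: "exec (IfPos e p q) m t m'"
inductive_cases exec_WhilePosE: "exec (WhilePos e p) m t m'"

lemma exec_deterministic:
  "exec p m t m' \<Longrightarrow> exec p m u m'' \<Longrightarrow> u = t \<and> m'' = m'"
proof (induction arbitrary: u m'' rule: exec.induct)
  case Skip
  then show ?case by (auto elim: exec_SkipE)
next
  case Assign
  then show ?case by (auto elim: exec_AssignE)
next
  case (Seq p m t m' q u' n)
  from Seq.prems obtain t1 m1 u1 where "exec p m t1 m1" "exec q m1 u1 m''" "u = t1 + u1"
    by (rule exec_SeqE)
  with Seq.IH show ?case by metis
next
  case (IfTrue e m p t m' q)
  from IfTrue.prems IfTrue.hyps(1) obtain t1 where "exec p m t1 m''" "u = 1 + cost e m + t1"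
    by (auto elim: exec_IfPosE)
  with IfTrue.IH show ?case by metis
next
  case (IfFalse e m q t m' p)
  from IfFalse.prems IfFalse.hyps(1) obtain t1 where "exec q m t1 m''" "u = 1 + cost e m + t1"
    by (auto elim: exec_IfPosE)
  with IfFalse.IH show ?case by metis
next
  case (WhileFalse e m p)
  from WhileFalse.prems WhileFalse.hyps show ?case by (auto elim: exec_WhilePosE)
next
  case (WhileTrue e m p t m' u' n)
  from WhileTrue.prems WhileTrue.hyps(1) obtain t1 m1 u1 where
    "exec p m t1 m1" "exec (WhilePos e p) m1 u1 m''" "u = 1 + cost e m + t1 + u1"
    by (auto elim: exec_WhilePosE)
  with WhileTrue.IH show ?case by metis
qed

text \<open>The program halts on every input from the given set within the given time, with 1 in cell 0
  if the input has the property, and 0 in cell 0 otherwise.\<close>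

definition decides_in_time ::
  "prog \<Rightarrow> ('i \<Rightarrow> memory) \<Rightarrow> 'i set \<Rightarrow> ('i \<Rightarrow> bool) \<Rightarrow> ('i \<Rightarrow> nat) \<Rightarrow> bool" where
  "decides_in_time p input I P T \<longleftrightarrow>
     (\<forall>x \<in> I. \<exists>t m. exec p (input x) t m \<and> t \<le> T x \<and> m 0 = (if P x then 1 else 0))"

section \<open>Identities as inputs\<close>

text \<open>A finite alphabet of size \<open>k\<close> is presented as \<open>{..<k}\<close>.  An input is a triple
  \<open>(k, v, w)\<close> of the alphabet size and the two words of the identity.\<close>

definition identities :: "(nat \<times> nat list \<times> nat list) set" where
  "identities = {(k, v, w). v \<in> free_semigroup {..<k} \<and> w \<in> free_semigroup {..<k}}"

text \<open>The cells from 0 on hold \<open>k\<close>, the lengths of \<open>v\<close> and \<open>w\<close>, the letters of \<open>v\<close>, and the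
  letters of \<open>w\<close>; all other cells hold 0.\<close>

fun input_memory :: "nat \<times> nat list \<times> nat list \<Rightarrow> memory" where
  "input_memory (k, v, w) =
     (let xs = map int ([k, length v, length w] @ v @ w)
      in (\<lambda>a. if 0 \<le> a \<and> a < int (length xs) then xs ! nat a else 0))"

end

theory Submission
  imports Defs "Jordan_Normal_Form.Determinant" "HOL-Analysis.Convex"
begin

text \<open>An entry of the product of upper triangular matrices along a word is the maximum, over the
  monotone paths through the states, of linear forms in the entries of the matrices, and there are
  only polynomially many paths, as a path changes its state fewer than \<open>n\<close> times.  So the identity fails if and only
  if, for one of the two words, some linear form exceeds at some real point all the linear forms of
  the other word; entries minus infinity are approximated by very negative numbers, and so are the
  weights of paths with the wrong end points.  This is the strict feasibility \<open>a\<^sub>q \<bullet> y > 0\<close> (\<open>q < N\<close>)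
  of a system of linear inequalities with small integer coefficients.

  The system is solved by a perceptron with rescaling, in the style of Chubanov.  With
  \<open>G = I + \<Sum>\<^sub>q (4 ^ m\<^sub>q - 1) a\<^sub>q a\<^sub>q\<^sup>T\<close>, the direction \<open>G\<^sup>-\<^sup>1 g\<close> is tried for \<open>g = \<Sum>\<^sub>q c\<^sub>q 2 ^ m\<^sub>q a\<^sub>q\<close>; when it
  violates inequality \<open>q\<close>, the counter \<open>c\<^sub>q\<close> is increased.  After polynomially many violations the
  inequality of Cauchy and Schwarz shows that \<open>2 ^ (m\<^sub>j + 1) (a\<^sub>j \<bullet> y) \<le> 1\<close> for every normalised
  solution \<open>y\<close> and the \<open>j\<close> with the largest counter; then \<open>m\<^sub>j\<close> is increased.  As a solvable system
  has a normalised solution with all \<open>a\<^sub>q \<bullet> y\<close> at least \<open>2 ^ - l\<close> for a polynomial \<open>l\<close>, only polynomially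
  many rounds are needed.  The determinant and the adjugate of \<open>G\<close> are integral and of polynomial
  bit length, and each round changes them by an exact rank-one update.\<close>

section \<open>Loop programs on arrays\<close>

text \<open>The time bound concerns a concrete machine program under logarithmic cost, and this
  shapes the proof. Every loop counts up to a bound stored in a cell, so time needs no bookkeeping
  of its own: it follows from one bound on loop lengths and one on the stored numbers. Hence the
  numbers of perceptron steps and of rounds are fixed in advance by closed formulas, and a solution
  that is found early only sets a flag. The numbers stay small for two reasons. As \<open>G\<close>
  dominates the identity, no entry of the adjugate exceeds the determinant in absolute value; and
  one round multiplies the determinant by at most \<open>4 * (1 + d * L * L)\<close>, where
  \<open>L\<close> bounds the coefficients of the \<open>d\<close>-dimensional system. As
  \<open>n\<close> is fixed, \<open>n - 1\<close> digits in base \<open>l + 2\<close> encode the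
  paths along a word of length \<open>l\<close>. One system is solved for each code of each word,
  with one inequality for every code of the other. Extra coordinates for the first and the last
  state let that system range over all paths of the other word, whatever their end points.\<close>

datatype ex = Num int | Rd nat ex | Plus ex ex | Minus ex ex | Times ex ex | Quo ex ex

type_synonym store = "nat \<Rightarrow> int \<Rightarrow> int"

primrec ev :: "ex \<Rightarrow> store \<Rightarrow> int" where
  "ev (Num c) \<sigma> = c"
| "ev (Rd j e) \<sigma> = \<sigma> j (ev e \<sigma>)"
| "ev (Plus e f) \<sigma> = ev e \<sigma> + ev f \<sigma>"
| "ev (Minus e f) \<sigma> = ev e \<sigma> - ev f \<sigma>"
| "ev (Times e f) \<sigma> = ev e \<sigma> * ev f \<sigma>"
| "ev (Quo e f) \<sigma> = ev e \<sigma> div ev f \<sigma>"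

text \<open>\<open>For j b s\<close> uses the cell 0 of array \<open>j\<close> as the loop counter and runs while it is less than
  the cell 0 of array \<open>b\<close>.\<close>

datatype stm =
    Asg nat ex ex
  | Sq stm stm
  | Cond ex stm stm
  | For nat nat stm

definition upd :: "store \<Rightarrow> nat \<Rightarrow> int \<Rightarrow> int \<Rightarrow> store" where
  "upd \<sigma> j i v = \<sigma>(j := (\<sigma> j)(i := v))"

text \<open>The loop bound is read once, and the counter is advanced from its value before the body.
  This agrees with a machine loop that tests again each time only if the body writes neither of the
  two arrays, as \<open>wf_stm\<close> demands.\<close>

primrec run :: "stm \<Rightarrow> store \<Rightarrow> store" where
  "run (Asg j a e) \<sigma> = upd \<sigma> j (ev a \<sigma>) (ev e \<sigma>)"
| "run (Sq s t) \<sigma> = run t (run s \<sigma>)"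
| "run (Cond e s t) \<sigma> = (if ev e \<sigma> > 0 then run s \<sigma> else run t \<sigma>)"
| "run (For j b s) \<sigma> =
    ((\<lambda>\<tau>. upd (run s \<tau>) j 0 (\<tau> j 0 + 1)) ^^ nat (\<sigma> b 0)) (upd \<sigma> j 0 0)"

primrec wr :: "stm \<Rightarrow> nat set" where
  "wr (Asg j a e) = {j}"
| "wr (Sq s t) = wr s \<union> wr t"
| "wr (Cond e s t) = wr s \<union> wr t"
| "wr (For j b s) = insert j (wr s)"

lemma run_frame: "j \<notin> wr s \<Longrightarrow> run s \<sigma> j = \<sigma> j"
proof (induction s arbitrary: \<sigma>)
  case (For i b s)
  have "((\<lambda>\<tau>. upd (run s \<tau>) i 0 (\<tau> i 0 + 1)) ^^ k) \<tau> j = \<tau> j" for k \<tau>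
    by (induction k) (use For in \<open>auto simp: upd_def\<close>)
  with For.prems show ?case by (auto simp: upd_def)
qed (auto simp: upd_def)

primrec ids_ok :: "ex \<Rightarrow> bool" where
  "ids_ok (Num c) = True"
| "ids_ok (Rd j e) = (j < 64 \<and> ids_ok e)"
| "ids_ok (Plus e f) = (ids_ok e \<and> ids_ok f)"
| "ids_ok (Minus e f) = (ids_ok e \<and> ids_ok f)"
| "ids_ok (Times e f) = (ids_ok e \<and> ids_ok f)"
| "ids_ok (Quo e f) = (ids_ok e \<and> ids_ok f)"

primrec wf_stm :: "stm \<Rightarrow> bool" where
  "wf_stm (Asg j a e) = (j < 64 \<and> ids_ok a \<and> ids_ok e)"
| "wf_stm (Sq s t) = (wf_stm s \<and> wf_stm t)"
| "wf_stm (Cond e s t) = (ids_ok e \<and> wf_stm s \<and> wf_stm t)"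
| "wf_stm (For j b s) = (j < 64 \<and> b < 64 \<and> 0 < j \<and> 0 < b \<and> j \<noteq> b \<and> j \<notin> wr s \<and> b \<notin> wr s \<and> wf_stm s)"

text \<open>Only literals and addresses are restricted. Values of inner subexpressions may exceed
  \<open>M\<close>; they are not stored, and \<open>abs_ev_le\<close> bounds them by a fixed power
  of \<open>M\<close>.\<close>

primrec eok :: "int \<Rightarrow> ex \<Rightarrow> store \<Rightarrow> bool" where
  "eok M (Num c) \<sigma> = (\<bar>c\<bar> \<le> M)"
| "eok M (Rd j e) \<sigma> = (eok M e \<sigma> \<and> 0 \<le> ev e \<sigma>)"
| "eok M (Plus e f) \<sigma> = (eok M e \<sigma> \<and> eok M f \<sigma>)"
| "eok M (Minus e f) \<sigma> = (eok M e \<sigma> \<and> eok M f \<sigma>)"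
| "eok M (Times e f) \<sigma> = (eok M e \<sigma> \<and> eok M f \<sigma>)"
| "eok M (Quo e f) \<sigma> = (eok M e \<sigma> \<and> eok M f \<sigma>)"

text \<open>\<open>M\<close> bounds all numbers that are stored, and \<open>Z\<close> the number of iterations of each loop.\<close>

primrec safe :: "int \<Rightarrow> int \<Rightarrow> stm \<Rightarrow> store \<Rightarrow> bool" where
  "safe M Z (Asg j a e) \<sigma> = (eok M a \<sigma> \<and> 0 \<le> ev a \<sigma> \<and> eok M e \<sigma> \<and> \<bar>ev e \<sigma>\<bar> \<le> M)"
| "safe M Z (Sq s t) \<sigma> = (safe M Z s \<sigma> \<and> safe M Z t (run s \<sigma>))"
| "safe M Z (Cond e s t) \<sigma> = (eok M e \<sigma> \<and> (if ev e \<sigma> > 0 then safe M Z s \<sigma> else safe M Z t \<sigma>))"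
| "safe M Z (For j b s) \<sigma> = (\<sigma> b 0 \<le> Z \<and>
    (\<forall>i < nat (\<sigma> b 0). safe M Z s (((\<lambda>\<tau>. upd (run s \<tau>) j 0 (\<tau> j 0 + 1)) ^^ i) (upd \<sigma> j 0 0))))"

subsection \<open>Compilation to the random access machine\<close>

text \<open>Array 0 is the input of the machine; the arrays 1 to 63 are interleaved at the negative
  addresses.\<close>

definition loc :: "nat \<Rightarrow> int \<Rightarrow> int" where
  "loc j i = (if j = 0 then i else - int j - 64 * i)"

text \<open>Array 0 occupies the nonnegative addresses; each other array has its own residue modulo
  64 among the negative ones.\<close>

lemma loc_eq_iff:
  assumes "j < 64" "j' < 64" "0 \<le> i" "0 \<le> i'"
  shows "loc j i = loc j' i' \<longleftrightarrow> j = j' \<and> i = i'"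
  using assms unfolding loc_def
  by (cases "j = 0"; cases "j' = 0"; cases i i' rule: linorder_cases) auto

definition caddr :: "nat \<Rightarrow> expr \<Rightarrow> expr" where
  "caddr j a = (if j = 0 then a else Sub (Const (- int j)) (Mult (Const 64) a))"

primrec cex :: "ex \<Rightarrow> expr" where
  "cex (Num c) = Const c"
| "cex (Rd j e) = Mem (caddr j (cex e))"
| "cex (Plus e f) = Add (cex e) (cex f)"
| "cex (Minus e f) = Sub (cex e) (cex f)"
| "cex (Times e f) = Mult (cex e) (cex f)"
| "cex (Quo e f) = Div (cex e) (cex f)"

abbreviation "Sc j \<equiv> Rd j (Num 0)"

definition casg :: "nat \<Rightarrow> ex \<Rightarrow> ex \<Rightarrow> prog" where
  "casg j a e = Assign (caddr j (cex a)) (cex e)"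

primrec compile :: "stm \<Rightarrow> prog" where
  "compile (Asg j a e) = casg j a e"
| "compile (Sq s t) = Seq (compile s) (compile t)"
| "compile (Cond e s t) = IfPos (cex e) (compile s) (compile t)"
| "compile (For j b s) = Seq (casg j (Num 0) (Num 0))
    (WhilePos (cex (Minus (Sc b) (Sc j))) (Seq (compile s) (casg j (Num 0) (Plus (Sc j) (Num 1)))))"

definition models :: "memory \<Rightarrow> store \<Rightarrow> bool" where
  "models m \<sigma> \<longleftrightarrow> (\<forall>j<64. \<forall>i\<ge>0. m (loc j i) = \<sigma> j i)"

definition bounded_store :: "int \<Rightarrow> store \<Rightarrow> bool" where
  "bounded_store M \<sigma> \<longleftrightarrow> (\<forall>j<64. \<forall>i\<ge>0. \<bar>\<sigma> j i\<bar> \<le> M)"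

lemma val_caddr: "val (caddr j a) m = loc j (val a m)"
  by (simp add: caddr_def loc_def)

lemma val_cex:
  "models m \<sigma> \<Longrightarrow> ids_ok e \<Longrightarrow> eok M e \<sigma> \<Longrightarrow> val (cex e) m = ev e \<sigma>"
  by (induction e) (auto simp: val_caddr models_def)

section \<open>Bounds on values and costs of expressions\<close>

primrec deg :: "ex \<Rightarrow> nat" where
  "deg (Num c) = 1"
| "deg (Rd j e) = deg e"
| "deg (Plus e f) = deg e + deg f"
| "deg (Minus e f) = deg e + deg f"
| "deg (Times e f) = deg e + deg f"
| "deg (Quo e f) = deg e + deg f"

lemma deg_pos: "deg e > 0"
  by (induction e) auto

lemma abs_div_le: "\<bar>a div b\<bar> \<le> \<bar>a\<bar>" for a b :: int
proof (cases "b = 0")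
  case False
  have *: "\<bar>a div b\<bar> \<le> \<bar>a\<bar>" if "b > 0" for a b :: int
  proof -
    have eq: "a = (a div b) * b + a mod b" by simp
    have m: "0 \<le> a mod b" "a mod b < b" using that by auto
    have b: "\<bar>a\<bar> * 1 \<le> \<bar>a\<bar> * b" using that by (intro mult_left_mono) auto
    have "\<not> a div b \<ge> \<bar>a\<bar> + 1"
    proof
      assume "a div b \<ge> \<bar>a\<bar> + 1"
      then have "(\<bar>a\<bar> + 1) * b \<le> (a div b) * b" using that by (intro mult_right_mono) auto
      then show False using eq m b that by (auto simp only: distrib_right; linarith)
    qed
    moreover have "\<not> a div b \<le> - \<bar>a\<bar> - 1"
    proof
      assume "a div b \<le> - \<bar>a\<bar> - 1"
      then have "(a div b) * b \<le> (- \<bar>a\<bar> - 1) * b" using that by (intro mult_right_mono) auto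
      then show False using eq m b that by (auto simp only: left_diff_distrib mult_minus_left; linarith)
    qed
    ultimately show ?thesis by linarith
  qed
  show ?thesis
  proof (cases "b > 0")
    case True
    then show ?thesis by (rule *)
  next
    case neg: False
    then show ?thesis using *[of "-b" "-a"] False by auto
  qed
qed auto

text \<open>With \<open>x\<close> and \<open>y\<close> for the two powers, both at least 2, twice
  \<open>x y - x - y\<close> is \<open>(x - 2) (y - 2) + (x y - 4)\<close>. So sums obey the same
  degree count as products.\<close>

lemma add_le_power: 
  assumes "(2::int) \<le> M" "0 < a" "0 < b"
  shows "M ^ a + M ^ b \<le> M ^ (a + b)"
proof -
  have "M ^ 1 \<le> M ^ a" "M ^ 1 \<le> M ^ b" using assms by (intro power_increasing; simp)+
  then have "0 \<le> (M ^ a - 2) * (M ^ b - 2)" using assms by auto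
  moreover have "M^a * M^b - M^a - M^b = ((M ^ a - 2) * (M ^ b - 2) + (M^a * M^b - 4)) div 2"
    by (simp add: algebra_simps)
  moreover have "2 * 2 \<le> M^a * M^b" using \<open>M ^ 1 \<le> M ^ a\<close> \<open>M ^ 1 \<le> M ^ b\<close> assms
    by (intro mult_mono) auto
  ultimately have "0 \<le> M^a * M^b - M^a - M^b" by auto
  then show ?thesis by (simp add: power_add)
qed

text \<open>A read is at most \<open>M\<close>, yet \<open>deg\<close> gives it the degree of its
  address: then \<open>deg\<close> does not decrease from a subexpression to the whole, and a single
  degree bounds all numbers that an evaluation meets.\<close>

lemma abs_ev_le:
  assumes "bounded_store M \<sigma>" "2 \<le> M"
  shows "ids_ok e \<Longrightarrow> eok M e \<sigma> \<Longrightarrow> \<bar>ev e \<sigma>\<bar> \<le> M ^ deg e"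
proof (induction e)
  case (Rd j e)
  have "\<bar>ev (Rd j e) \<sigma>\<bar> \<le> M ^ 1" using assms Rd by (auto simp: bounded_store_def)
  also have "\<dots> \<le> M ^ deg e" using assms deg_pos[of e] by (intro power_increasing) auto
  finally show ?case by simp
next
  case (Plus e f)
  then show ?case using add_le_power[OF assms(2) deg_pos[of e] deg_pos[of f]] by auto
next
  case (Minus e f)
  then show ?case using add_le_power[OF assms(2) deg_pos[of e] deg_pos[of f]] by auto
next
  case (Times e f)
  then show ?case by (auto simp: abs_mult power_add intro!: mult_mono)
next
  case (Quo e f)
  have "\<bar>ev (Quo e f) \<sigma>\<bar> \<le> M ^ deg e" using Quo abs_div_le[of "ev e \<sigma>" "ev f \<sigma>"] by auto
  also have "\<dots> \<le> M ^ (deg e + deg f)" using assms by (intro power_increasing) auto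
  finally show ?case by simp
qed auto

lemma bit_length_le:
  assumes "\<bar>i\<bar> < 2 ^ b"
  shows "bit_length i \<le> b + 1"
proof -
  have "nat \<bar>i\<bar> < 2 ^ b" using assms by (simp add: nat_less_iff)
  then show ?thesis unfolding bit_length_def by (simp add: floorlog_leI)
qed

text \<open>The slack 9 leaves room for eight more bits and the sign, so that the same bound serves
  in \<open>bit_length_loc\<close> for addresses, which may be up to 128 times larger.\<close>

lemma bit_length_le_deg:
  assumes "\<bar>i\<bar> \<le> (2 ^ X) ^ d" "d \<le> d'"
  shows "bit_length i \<le> X * d' + 9"
proof (rule order_trans[OF bit_length_le])
  have "(2 ^ X) ^ d \<le> (2::int) ^ (X * d')"
    unfolding power_mult[symmetric] using assms(2) by (intro power_increasing) auto
  also have "\<dots> < 2 ^ (X * d' + 1)" by simp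
  finally show "\<bar>i\<bar> < 2 ^ (X * d' + 1)" using assms by simp
qed simp

lemma bit_length_loc:
  assumes "\<bar>i\<bar> \<le> (2 ^ X) ^ d" "d \<le> d'" "j < 64"
  shows "bit_length (loc j i) \<le> X * d' + 9" "bit_length (64 * i) \<le> X * d' + 9"
    "bit_length (- int j) \<le> X * d' + 9"
proof -
  have *: "(2 ^ X) ^ d \<le> (2::int) ^ (X * d')"
    unfolding power_mult[symmetric] using assms(2) by (intro power_increasing) auto
  have "\<bar>loc j i\<bar> \<le> 64 + 64 * \<bar>i\<bar>" using assms(3) by (auto simp: loc_def)
  also have "\<dots> \<le> 64 * 2 ^ (X * d') + 64 * 2 ^ (X * d')"
    using assms(1) * by (intro add_mono) auto
  also have "\<dots> < 2 ^ (X * d' + 8)" by (simp add: power_add)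
  finally show "bit_length (loc j i) \<le> X * d' + 9" by (rule order_trans[OF bit_length_le]) simp
  have "\<bar>64 * i\<bar> \<le> 64 * 2 ^ (X * d')" using assms(1) * by (simp add: abs_mult)
  also have "\<dots> < 2 ^ (X * d' + 8)" by (simp add: power_add)
  finally show "bit_length (64 * i) \<le> X * d' + 9" by (rule order_trans[OF bit_length_le]) simp
  have "\<bar>- int j\<bar> < 2 ^ 6" using assms(3) by simp
  then show "bit_length (- int j) \<le> X * d' + 9" by (rule order_trans[OF bit_length_le]) simp
qed

lemma cost_caddr:
  assumes "\<bar>val a m\<bar> \<le> (2 ^ X) ^ d" "d \<le> d'" "j < 64"
  shows "cost (caddr j a) m \<le> cost a m + 4 * (X * d' + 9)"
proof -
  have "bit_length 64 \<le> X * d' + 9" using bit_length_le[of 64 7] by simp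
  then show ?thesis
    using bit_length_loc[OF assms] by (auto simp: caddr_def loc_def)
qed

text \<open>Counts the nodes of the compiled expression. A read adds five: four for the address
  arithmetic of an array other than 0, and one for the access itself.\<close>

primrec esize :: "ex \<Rightarrow> nat" where
  "esize (Num c) = 1"
| "esize (Rd j e) = esize e + 5"
| "esize (Plus e f) = esize e + esize f + 1"
| "esize (Minus e f) = esize e + esize f + 1"
| "esize (Times e f) = esize e + esize f + 1"
| "esize (Quo e f) = esize e + esize f + 1"

lemma cost_cex:
  assumes "models m \<sigma>" "bounded_store (2 ^ X) \<sigma>" "1 \<le> X"
  shows "ids_ok e \<Longrightarrow> eok (2 ^ X) e \<sigma> \<Longrightarrow> deg e \<le> d \<Longrightarrow> cost (cex e) m \<le> esize e * (X * d + 9)"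
proof (induction e)
  have M: "(2::int) ^ 1 \<le> 2 ^ X" using assms by (intro power_increasing) auto
  have len: "bit_length (val (cex e) m) \<le> X * d + 9"
    if "ids_ok e" "eok (2 ^ X) e \<sigma>" "deg e \<le> d" for e
    using abs_ev_le[of "2 ^ X" \<sigma> e] M assms that val_cex[OF assms(1) that(1,2)]
    by (intro bit_length_le_deg[of _ X "deg e"]) auto
  {
    case (Num c)
    then show ?case using bit_length_le_deg[of c X 1 d] by auto
  next
    case (Rd j e)
    have e: "val (cex e) m = ev e \<sigma>" using Rd.prems assms by (auto intro: val_cex)
    have "\<bar>ev e \<sigma>\<bar> \<le> (2 ^ X) ^ deg e" using abs_ev_le[of "2 ^ X" \<sigma> e] M assms Rd.prems by auto
    then have "cost (caddr j (cex e)) m \<le> cost (cex e) m + 4 * (X * d + 9)"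
      using Rd.prems by (intro cost_caddr[of _ _ _ "deg e"]) (auto simp: e)
    then show ?case using Rd len[OF Rd.prems] by (auto simp: algebra_simps)
  next
    case (Plus e f)
    then show ?case using len[OF Plus.prems] by (auto simp: algebra_simps)
  next
    case (Minus e f)
    then show ?case using len[OF Minus.prems] by (auto simp: algebra_simps)
  next
    case (Times e f)
    then show ?case using len[OF Times.prems] by (auto simp: algebra_simps)
  next
    case (Quo e f)
    then show ?case using len[OF Quo.prems] by (auto simp: algebra_simps)
  }
qed

lemma cost_cex_le:
  assumes "models m \<sigma>" "bounded_store (2 ^ X) \<sigma>" "1 \<le> X" "ids_ok e" "eok (2 ^ X) e \<sigma>"
  shows "cost (cex e) m \<le> esize e * (deg e + 9) * (X + 1)"
proof -
  have "cost (cex e) m \<le> esize e * (X * deg e + 9)"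
    using assms by (intro cost_cex) auto
  also have "\<dots> \<le> esize e * ((deg e + 9) * (X + 1))" by (intro mult_left_mono) (auto simp: algebra_simps)
  finally show ?thesis by (simp only: mult.assoc)
qed

section \<open>Simulation of statements on the machine, with a time bound\<close>

lemma models_upd:
  "models m \<sigma> \<Longrightarrow> j < 64 \<Longrightarrow> 0 \<le> i \<Longrightarrow> models (m(loc j i := v)) (upd \<sigma> j i v)"
  by (auto simp: models_def upd_def loc_eq_iff)

lemma bounded_upd:
  "bounded_store M \<sigma> \<Longrightarrow> \<bar>v\<bar> \<le> M \<Longrightarrow> bounded_store M (upd \<sigma> j i v)"
  by (auto simp: bounded_store_def upd_def)

lemma exec_asg:
  assumes "models m \<sigma>" "bounded_store (2 ^ X) \<sigma>" "1 \<le> X" "wf_stm (Asg j a e)" "safe (2 ^ X) Z (Asg j a e) \<sigma>"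
  shows "\<exists>t m'. exec (compile (Asg j a e)) m t m' \<and> models m' (run (Asg j a e) \<sigma>) \<and>
    bounded_store (2 ^ X) (run (Asg j a e) \<sigma>) \<and> t \<le> (1 + (esize a + 4) * (deg a + 9) + esize e * (deg e + 9)) * (X + 1)"
proof (intro exI conjI)
  have M: "(2::int) ^ 1 \<le> 2 ^ X" using assms by (intro power_increasing) auto
  have va: "val (cex a) m = ev a \<sigma>" and ve: "val (cex e) m = ev e \<sigma>"
    using assms by (auto intro: val_cex)
  show "exec (compile (Asg j a e)) m (1 + cost (caddr j (cex a)) m + cost (cex e) m)
      (m(loc j (ev a \<sigma>) := ev e \<sigma>))"
    using exec.Assign[of "caddr j (cex a)" "cex e" m] by (simp add: val_caddr va ve casg_def)
  show "models (m(loc j (ev a \<sigma>) := ev e \<sigma>)) (run (Asg j a e) \<sigma>)"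
    using assms by (auto intro: models_upd)
  show "bounded_store (2 ^ X) (run (Asg j a e) \<sigma>)"
    using assms by (auto intro: bounded_upd)
  have "\<bar>ev a \<sigma>\<bar> \<le> (2 ^ X) ^ deg a" using abs_ev_le[of "2 ^ X" \<sigma> a] M assms by auto
  then have "cost (caddr j (cex a)) m \<le> cost (cex a) m + 4 * (X * deg a + 9)"
    using assms by (intro cost_caddr[of _ _ _ "deg a"]) (auto simp: va)
  moreover have "cost (cex a) m \<le> esize a * (deg a + 9) * (X + 1)"
    using assms by (intro cost_cex_le) auto
  moreover have e: "cost (cex e) m \<le> esize e * (deg e + 9) * (X + 1)"
    using assms by (intro cost_cex_le) auto
  moreover have "4 * (X * deg a + 9) \<le> 4 * ((deg a + 9) * (X + 1))" by (simp add: algebra_simps)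
  ultimately have "cost (caddr j (cex a)) m \<le> esize a * (deg a + 9) * (X + 1) + 4 * ((deg a + 9) * (X + 1))"
    by (meson add_mono order_trans)
  then have "1 + cost (caddr j (cex a)) m + cost (cex e) m \<le>
     1 + (esize a * (deg a + 9) * (X + 1) + 4 * ((deg a + 9) * (X + 1))) + esize e * (deg e + 9) * (X + 1)"
    using e by (intro add_mono order_refl)
  also have "\<dots> \<le> (1 + (esize a + 4) * (deg a + 9) + esize e * (deg e + 9)) * (X + 1)"
    by (simp add: algebra_simps)
  finally show "1 + cost (caddr j (cex a)) m + cost (cex e) m \<le>
    (1 + (esize a + 4) * (deg a + 9) + esize e * (deg e + 9)) * (X + 1)" .
qed

text \<open>\<open>C\<close> and \<open>k\<close> belong to the statement alone, while
  \<open>X\<close> and \<open>Z\<close> vary with the input. The time is linear in the bit length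
  \<open>X\<close> because all expressions have fixed degree, and polynomial in the loop bound
  \<open>Z\<close>.\<close>

definition runs_in :: "stm \<Rightarrow> nat \<Rightarrow> nat \<Rightarrow> bool" where
  "runs_in s C k \<longleftrightarrow> (\<forall>X Z \<sigma> m. 1 \<le> X \<longrightarrow> Z \<le> 2 ^ X \<longrightarrow> models m \<sigma> \<longrightarrow> bounded_store (2 ^ X) \<sigma> \<longrightarrow>
     safe (2 ^ X) (int Z) s \<sigma> \<longrightarrow>
     (\<exists>t m'. exec (compile s) m t m' \<and> models m' (run s \<sigma>) \<and> bounded_store (2 ^ X) (run s \<sigma>) \<and>
        t \<le> C * (Z + 1) ^ k * (X + 1)))"

lemma runs_inD:
  "runs_in s C k \<Longrightarrow> 1 \<le> X \<Longrightarrow> Z \<le> 2 ^ X \<Longrightarrow> models m \<sigma> \<Longrightarrow> bounded_store (2 ^ X) \<sigma> \<Longrightarrow>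
     safe (2 ^ X) (int Z) s \<sigma> \<Longrightarrow>
     (\<exists>t m'. exec (compile s) m t m' \<and> models m' (run s \<sigma>) \<and> bounded_store (2 ^ X) (run s \<sigma>) \<and>
        t \<le> C * (Z + 1) ^ k * (X + 1))"
  unfolding runs_in_def by blast

text \<open>The last, failing test is charged to the additional iteration in
  \<open>Z + 1\<close>.\<close>

lemma loop_time_bound:
  fixes t0 t1 n Z P y :: nat
  assumes "t0 \<le> c0 * y" "t1 \<le> ct * y + n * ((ct + C * P + ci) * y)" "n \<le> Z" "1 \<le> P"
  shows "t0 + t1 \<le> (c0 + (ct + C + ci)) * ((Z + 1) * P) * y"
proof -
  define E where "E = (ct + C + ci) * P"
  have "ct * 1 \<le> ct * P" "ci * 1 \<le> ci * P" using assms(4) by (intro mult_left_mono; simp)+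
  then have E: "ct + C * P + ci \<le> E" unfolding E_def distrib_right by linarith
  have "n * ((ct + C * P + ci) * y) \<le> Z * (E * y)"
    using E assms(3) by (intro mult_mono) auto
  moreover have "ct * y \<le> E * y" using E by (intro mult_right_mono) auto
  moreover have "c0 * y \<le> c0 * (((Z + 1) * P) * y)"
  proof (intro mult_left_mono)
    have "1 * 1 \<le> (Z + 1) * P" using assms(4) by (intro mult_le_mono) auto
    then have "1 * y \<le> ((Z + 1) * P) * y" by (intro mult_right_mono) auto
    then show "y \<le> ((Z + 1) * P) * y" by simp
  qed simp
  ultimately have "t0 + t1 \<le> c0 * (((Z + 1) * P) * y) + (E * y + Z * (E * y))"
    using assms(1,2) by linarith
  also have "\<dots> = (c0 + (ct + C + ci)) * ((Z + 1) * P) * y" by (simp add: E_def algebra_simps)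
  finally show ?thesis .
qed

text \<open>Structural induction: the exponents of \<open>Z + 1\<close> add up along sequences and
  branches, and a loop contributes one more. Safety yields at each point what the cost bounds for
  expressions require, and boundedness of the store is carried along.\<close>

lemma exec_compile:
  "wf_stm s \<Longrightarrow> \<exists>C k. runs_in s C k"
proof (induction s)
  case (Asg j a e)
  show ?case
  unfolding runs_in_def
  proof (rule exI[of _ "1 + (esize a + 4) * (deg a + 9) + esize e * (deg e + 9)"], rule exI[of _ 0], intro allI impI)
    fix X Z \<sigma> m
    assume "1 \<le> X" "models m \<sigma>" "bounded_store (2 ^ X) \<sigma>" "safe (2 ^ X) (int Z) (Asg j a e) \<sigma>"
    from exec_asg[OF this(2,3,1) Asg this(4)]
    show "\<exists>t m'. exec (compile (Asg j a e)) m t m' \<and> models m' (run (Asg j a e) \<sigma>) \<and>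
      bounded_store (2 ^ X) (run (Asg j a e) \<sigma>) \<and>
      t \<le> (1 + (esize a + 4) * (deg a + 9) + esize e * (deg e + 9)) * (Z + 1) ^ 0 * (X + 1)"
      by simp
  qed
next
  case (Sq s1 s2)
  then have "wf_stm s1" "wf_stm s2" by auto
  from Sq.IH(1)[OF this(1)] obtain C k where 1: "runs_in s1 C k" by blast
  from Sq.IH(2)[OF \<open>wf_stm s2\<close>] obtain C' k' where 2: "runs_in s2 C' k'" by blast
  show ?case
  unfolding runs_in_def
  proof (rule exI[of _ "C + C'"], rule exI[of _ "k + k'"], intro allI impI)
    fix X Z \<sigma> m
    assume X: "1 \<le> X" "Z \<le> 2 ^ X" and *: "models m \<sigma>" "bounded_store (2 ^ X) \<sigma>" "safe (2 ^ X) (int Z) (Sq s1 s2) \<sigma>"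
    then obtain t m' where t: "exec (compile s1) m t m'" "models m' (run s1 \<sigma>)" "bounded_store (2 ^ X) (run s1 \<sigma>)"
        "t \<le> C * (Z + 1) ^ k * (X + 1)" using runs_inD[OF 1 X *(1,2)] by auto
    then obtain t' m'' where t': "exec (compile s2) m' t' m''" "models m'' (run s2 (run s1 \<sigma>))" "bounded_store (2 ^ X) (run s2 (run s1 \<sigma>))"
        "t' \<le> C' * (Z + 1) ^ k' * (X + 1)" using runs_inD[OF 2 X t(2,3)] * by auto
    have "C * (Z + 1) ^ k \<le> C * (Z + 1) ^ (k + k')" "C' * (Z + 1) ^ k' \<le> C' * (Z + 1) ^ (k + k')"
      by (intro mult_left_mono power_increasing; simp)+
    then have "t + t' \<le> C * (Z + 1) ^ (k + k') * (X + 1) + C' * (Z + 1) ^ (k + k') * (X + 1)"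
      using t(4) t'(4) by (intro add_mono) (meson mult_le_mono1 order_trans)+
    also have "\<dots> = (C + C') * (Z + 1) ^ (k + k') * (X + 1)" by (simp add: algebra_simps)
    finally show "\<exists>t m'. exec (compile (Sq s1 s2)) m t m' \<and> models m' (run (Sq s1 s2) \<sigma>) \<and>
      bounded_store (2 ^ X) (run (Sq s1 s2) \<sigma>) \<and> t \<le> (C + C') * (Z + 1) ^ (k + k') * (X + 1)"
      using t t' by (auto intro: exec.Seq)
  qed
next
  case (Cond e s1 s2)
  then have "wf_stm s1" "wf_stm s2" "ids_ok e" by auto
  from Cond.IH(1)[OF this(1)] obtain C k where 1: "runs_in s1 C k" by blast
  from Cond.IH(2)[OF \<open>wf_stm s2\<close>] obtain C' k' where 2: "runs_in s2 C' k'" by blast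
  define c where "c = 1 + esize e * (deg e + 9)"
  show ?case
  unfolding runs_in_def
  proof (rule exI[of _ "c + C + C'"], rule exI[of _ "k + k'"], intro allI impI)
    fix X Z \<sigma> m
    assume X: "1 \<le> X" "Z \<le> 2 ^ X" and *: "models m \<sigma>" "bounded_store (2 ^ X) \<sigma>" "safe (2 ^ X) (int Z) (Cond e s1 s2) \<sigma>"
    have e: "val (cex e) m = ev e \<sigma>" using * \<open>ids_ok e\<close> by (auto intro: val_cex)
    have "cost (cex e) m \<le> esize e * (deg e + 9) * (X + 1)"
      using * X \<open>ids_ok e\<close> by (intro cost_cex_le) auto
    then have c: "1 + cost (cex e) m \<le> c * (X + 1)" by (simp add: c_def)
    have c': "c * (X + 1) + D * (Z + 1) ^ l * (X + 1) \<le> (c + C + C') * (Z + 1) ^ (k + k') * (X + 1)"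
      if "D \<le> C + C'" "l \<le> k + k'" for D l
    proof -
      have "c * 1 \<le> c * (Z + 1) ^ (k + k')" by (intro mult_left_mono) auto
      moreover have "D * (Z + 1) ^ l \<le> (C + C') * (Z + 1) ^ (k + k')"
        using that by (intro mult_mono power_increasing) auto
      ultimately have "c + D * (Z + 1) ^ l \<le> c * (Z + 1) ^ (k + k') + (C + C') * (Z + 1) ^ (k + k')"
        by linarith
      then have "(c + D * (Z + 1) ^ l) * (X + 1) \<le> (c * (Z + 1) ^ (k + k') + (C + C') * (Z + 1) ^ (k + k')) * (X + 1)"
        by (rule mult_le_mono1)
      then show ?thesis by (simp only: distrib_right add.assoc)
    qed
    show "\<exists>t m'. exec (compile (Cond e s1 s2)) m t m' \<and> models m' (run (Cond e s1 s2) \<sigma>) \<and>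
      bounded_store (2 ^ X) (run (Cond e s1 s2) \<sigma>) \<and> t \<le> (c + C + C') * (Z + 1) ^ (k + k') * (X + 1)"
    proof (cases "ev e \<sigma> > 0")
      case True
      then obtain t m' where t: "exec (compile s1) m t m'" "models m' (run s1 \<sigma>)" "bounded_store (2 ^ X) (run s1 \<sigma>)"
        "t \<le> C * (Z + 1) ^ k * (X + 1)" using runs_inD[OF 1 X *(1,2)] * by auto
      have "exec (compile (Cond e s1 s2)) m (1 + cost (cex e) m + t) m'"
        using exec.IfTrue[of "cex e" m, OF _ t(1)] True by (simp add: e)
      moreover have "1 + cost (cex e) m + t \<le> (c + C + C') * (Z + 1) ^ (k + k') * (X + 1)"
        using c'[of C k] c t(4) by linarith
      moreover have "run (Cond e s1 s2) \<sigma> = run s1 \<sigma>" using True by simp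
      ultimately show ?thesis using t(2,3) by (intro exI conjI) simp_all
    next
      case False
      then obtain t m' where t: "exec (compile s2) m t m'" "models m' (run s2 \<sigma>)" "bounded_store (2 ^ X) (run s2 \<sigma>)"
        "t \<le> C' * (Z + 1) ^ k' * (X + 1)" using runs_inD[OF 2 X *(1,2)] * by auto
      have "exec (compile (Cond e s1 s2)) m (1 + cost (cex e) m + t) m'"
        using exec.IfFalse[of "cex e" m, OF _ t(1)] False by (simp add: e)
      moreover have "1 + cost (cex e) m + t \<le> (c + C + C') * (Z + 1) ^ (k + k') * (X + 1)"
        using c'[of C' k'] c t(4) by linarith
      moreover have "run (Cond e s1 s2) \<sigma> = run s2 \<sigma>" using False by simp
      ultimately show ?thesis using t(2,3) by (intro exI conjI) simp_all
    qed
  qed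
next
  case (For j b s)
  then have wf: "wf_stm s" "j < 64" "b < 64" "0 < j" "0 < b" "j \<noteq> b" "j \<notin> wr s" "b \<notin> wr s" by auto
  from For.IH[OF this(1)] obtain C k where 1: "runs_in s C k" by blast
  define inc where "inc = Asg j (Num 0) (Plus (Sc j) (Num 1))"
  define test where "test = Minus (Sc b) (Sc j)"
  define ci where "ci = 1 + (esize (Num 0) + 4) * (deg (Num 0) + 9) +
    esize (Plus (Sc j) (Num 1)) * (deg (Plus (Sc j) (Num 1)) + 9)"
  define ct where "ct = 1 + esize test * (deg test + 9)"
  define c0 where "c0 = 1 + (esize (Num 0) + 4) * (deg (Num 0) + 9) + esize (Num 0) * (deg (Num 0) + 9)"
  have comp: "compile (For j b s) = Seq (compile (Asg j (Num 0) (Num 0))) (WhilePos (cex test) (Seq (compile s) (compile inc)))"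
    by (simp add: inc_def test_def)
  show ?case
  unfolding runs_in_def
  proof (rule exI[of _ "c0 + (ct + C + ci)"], rule exI[of _ "Suc k"], intro allI impI)
    fix X Z \<sigma> m
    assume X: "1 \<le> X" "Z \<le> 2 ^ X" and *: "models m \<sigma>" "bounded_store (2 ^ X) \<sigma>" "safe (2 ^ X) (int Z) (For j b s) \<sigma>"
    define F where "F = (\<lambda>\<tau>. upd (run s \<tau>) j 0 (\<tau> j 0 + 1))"
    define \<sigma>0 where "\<sigma>0 = upd \<sigma> j 0 0"
    define nb where "nb = nat (\<sigma> b 0)"
    have run: "run (For j b s) \<sigma> = (F ^^ nb) \<sigma>0" by (simp add: F_def \<sigma>0_def nb_def)
    have safe: "safe (2 ^ X) (int Z) s ((F ^^ i) \<sigma>0)" if "i < nb" for i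
      using *(3) that by (simp add: F_def \<sigma>0_def nb_def)
    have Z: "\<sigma> b 0 \<le> int Z" "nb \<le> Z" using *(3) by (auto simp: nb_def)
    have Z': "int Z \<le> 2 ^ X" using X(2) by (metis of_nat_le_iff of_nat_numeral of_nat_power)
    \<comment> \<open>By the frame property the body touches neither the bound nor the counter, so
      the repeated test of the machine sees the original bound and the exact number of finished
      iterations.\<close>
    have Fb: "(F ^^ i) \<sigma>0 b = \<sigma> b" for i
      by (induction i) (use wf in \<open>auto simp: F_def \<sigma>0_def upd_def run_frame\<close>)
    have Fj: "(F ^^ i) \<sigma>0 j 0 = int i" for i
      by (induction i) (use wf in \<open>auto simp: F_def \<sigma>0_def upd_def\<close>)
    have M2: "(2::int) ^ 1 \<le> 2 ^ X" using X(1) by (intro power_increasing) auto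
    \<comment> \<open>Induction on the number of iterations that remain. The first summand pays for
      the failing test at the end; each iteration pays for one test, one body and one
      increment.\<close>
    have loop: "\<exists>t m'. exec (WhilePos (cex test) (Seq (compile s) (compile inc))) m t m' \<and>
        models m' ((F ^^ nb) \<sigma>0) \<and> bounded_store (2 ^ X) ((F ^^ nb) \<sigma>0) \<and>
        t \<le> (ct * (X + 1) + (nb - i) * ((ct + C * (Z + 1) ^ k + ci) * (X + 1)))"
      if "models m ((F ^^ i) \<sigma>0)" "bounded_store (2 ^ X) ((F ^^ i) \<sigma>0)" "i \<le> nb" for i m
      using that
    proof (induction "nb - i" arbitrary: i m)
      case 0
      have i: "i = nb" using 0 by simp
      have ids: "ids_ok test" and eok: "eok (2 ^ X) test ((F ^^ i) \<sigma>0)" using wf by (auto simp: test_def)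
      have v: "val (cex test) m = ev test ((F ^^ i) \<sigma>0)" using 0 ids eok by (intro val_cex)
      have "ev test ((F ^^ i) \<sigma>0) \<le> 0" using i by (auto simp: test_def Fb Fj nb_def)
      then have "exec (WhilePos (cex test) (Seq (compile s) (compile inc))) m (1 + cost (cex test) m) m"
        by (intro exec.WhileFalse) (simp add: v)
      moreover have "cost (cex test) m \<le> esize test * (deg test + 9) * (X + 1)"
        using 0 ids eok X by (intro cost_cex_le) auto
      then have "1 + cost (cex test) m \<le> ct * (X + 1)" by (simp add: ct_def)
      ultimately show ?case
        using "0.prems"(1,2) unfolding i
        by (intro exI[of _ "1 + cost (cex test) m"] exI[of _ m] conjI) (simp_all only: trans_le_add1)
    next
      case (Suc r)
      then have i: "i < nb" by simp
      have ids: "ids_ok test" and eok: "eok (2 ^ X) test ((F ^^ i) \<sigma>0)" using wf by (auto simp: test_def)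
      have v: "val (cex test) m = ev test ((F ^^ i) \<sigma>0)" using Suc ids eok by (intro val_cex)
      have pos: "ev test ((F ^^ i) \<sigma>0) > 0" using i by (auto simp: test_def Fb Fj nb_def)
      have "cost (cex test) m \<le> esize test * (deg test + 9) * (X + 1)"
        using Suc ids eok X by (intro cost_cex_le) auto
      then have cc: "1 + cost (cex test) m \<le> ct * (X + 1)" by (simp add: ct_def)
      obtain t1 m1 where t1: "exec (compile s) m t1 m1" "models m1 (run s ((F ^^ i) \<sigma>0))"
        "bounded_store (2 ^ X) (run s ((F ^^ i) \<sigma>0))" "t1 \<le> C * (Z + 1) ^ k * (X + 1)"
        using runs_inD[OF 1 X Suc.prems(1,2) safe[OF i]] by auto
      have rj: "run s ((F ^^ i) \<sigma>0) j 0 = int i" using Fj wf by (simp add: run_frame)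
      \<comment> \<open>The counter is a stored number as well: it stays at most \<open>Z\<close>,
        which is at most \<open>2 ^ X\<close>.\<close>
      have "\<bar>int i + 1\<bar> \<le> 2 ^ X" using i Z Z' by linarith
      then have "\<exists>t m'. exec (compile inc) m1 t m' \<and> models m' (run inc (run s ((F ^^ i) \<sigma>0))) \<and>
          bounded_store (2 ^ X) (run inc (run s ((F ^^ i) \<sigma>0))) \<and> t \<le> ci * (X + 1)"
        unfolding inc_def ci_def using t1 X wf M2 rj
        by (intro exec_asg[of _ _ _ _ _ _ "int Z"]) auto
      moreover have "run inc (run s ((F ^^ i) \<sigma>0)) = (F ^^ Suc i) \<sigma>0"
        using wf by (simp add: inc_def F_def run_frame)
      ultimately obtain t2 m2 where t2: "exec (compile inc) m1 t2 m2" "models m2 ((F ^^ Suc i) \<sigma>0)"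
          "bounded_store (2 ^ X) ((F ^^ Suc i) \<sigma>0)" "t2 \<le> ci * (X + 1)"
        by metis
      have "r = nb - Suc i" "Suc i \<le> nb" using Suc by auto
      from Suc.hyps(1)[OF this(1) t2(2,3) this(2)] obtain t3 m3 where
        t3: "exec (WhilePos (cex test) (Seq (compile s) (compile inc))) m2 t3 m3"
          "models m3 ((F ^^ nb) \<sigma>0)" "bounded_store (2 ^ X) ((F ^^ nb) \<sigma>0)"
          "t3 \<le> (ct * (X + 1) + (nb - Suc i) * ((ct + C * (Z + 1) ^ k + ci) * (X + 1)))" by blast
      have "exec (WhilePos (cex test) (Seq (compile s) (compile inc))) m (1 + cost (cex test) m + (t1 + t2) + t3) m3"
        by (intro exec.WhileTrue exec.Seq) (use t1 t2 t3 pos v in auto)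
      moreover have "1 + cost (cex test) m + (t1 + t2) + t3 \<le>
        ct * (X + 1) + (nb - i) * ((ct + C * (Z + 1) ^ k + ci) * (X + 1))"
      proof -
        have "Suc r * ((a + b + c) * y) = r * ((a + b + c) * y) + (a * y + b * y + c * y)" for r a b c y :: nat
          by (simp add: distrib_right)
        from this[of "nb - Suc i" ct "C * (Z + 1) ^ k" ci "X + 1"]
        have "(nb - i) * ((ct + C * (Z + 1) ^ k + ci) * (X + 1)) =
          (nb - Suc i) * ((ct + C * (Z + 1) ^ k + ci) * (X + 1)) + (ct * (X + 1) + C * (Z + 1) ^ k * (X + 1) + ci * (X + 1))"
          using i by (simp only: Suc_diff_Suc)
        then show ?thesis using cc t1(4) t2(4) t3(4) by linarith
      qed
      ultimately show ?case using t3 by blast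
    qed
    have "\<exists>t m'. exec (compile (Asg j (Num 0) (Num 0))) m t m' \<and> models m' (run (Asg j (Num 0) (Num 0)) \<sigma>) \<and>
          bounded_store (2 ^ X) (run (Asg j (Num 0) (Num 0)) \<sigma>) \<and> t \<le> c0 * (X + 1)"
      unfolding c0_def using * X wf by (intro exec_asg[of _ _ _ _ _ _ "int Z"]) auto
    then obtain t0 m0 where t0: "exec (compile (Asg j (Num 0) (Num 0))) m t0 m0" "models m0 ((F ^^ 0) \<sigma>0)"
        "bounded_store (2 ^ X) ((F ^^ 0) \<sigma>0)" "t0 \<le> c0 * (X + 1)" by (auto simp: \<sigma>0_def)
    from loop[OF t0(2,3)] obtain t1 m1 where t1: "exec (WhilePos (cex test) (Seq (compile s) (compile inc))) m0 t1 m1"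
        "models m1 ((F ^^ nb) \<sigma>0)" "bounded_store (2 ^ X) ((F ^^ nb) \<sigma>0)"
        "t1 \<le> (ct * (X + 1) + nb * ((ct + C * (Z + 1) ^ k + ci) * (X + 1)))"
      unfolding diff_zero by blast
    have "exec (compile (For j b s)) m (t0 + t1) m1" unfolding comp
      using t0(1) t1(1) by (simp add: exec.Seq)
    moreover have "t0 + t1 \<le> (c0 + (ct + C + ci)) * (Z + 1) ^ Suc k * (X + 1)"
      unfolding power_Suc by (rule loop_time_bound[OF t0(4) t1(4) Z(2)]) simp
    ultimately show "\<exists>t m'. exec (compile (For j b s)) m t m' \<and> models m' (run (For j b s) \<sigma>) \<and>
      bounded_store (2 ^ X) (run (For j b s) \<sigma>) \<and> t \<le> (c0 + (ct + C + ci)) * (Z + 1) ^ Suc k * (X + 1)"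
      using t1(2,3) unfolding run by (intro exI[of _ "t0 + t1"] exI[of _ m1] conjI)
  qed
qed

section \<open>Rank-one updates of the adjugate\<close>

text \<open>The determinant of the bordered matrix \<open>?M\<close> is evaluated twice:
  \<open>?R\<close> clears its lower left block, and \<open>?S\<close> the upper right one. As
  \<open>?S\<close> is built from the adjugate, no division occurs until the factor
  \<open>det G\<close> is cancelled.\<close>

lemma det_add_rank_one:
  fixes G :: "'a :: idom mat"
  assumes G: "G \<in> carrier_mat d d" and u: "u \<in> carrier_mat d 1" and w: "w \<in> carrier_mat 1 d"
    and D: "det G \<noteq> 0"
  shows "det (G + u * w) = det G + (w * (adj_mat G * u)) $$ (0, 0)"
proof -
  note adj = adj_mat[OF G]
  let ?B = "adj_mat G"
  let ?M = "four_block_mat G (- u) w (1\<^sub>m 1)"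
  let ?R = "four_block_mat (1\<^sub>m d) (0\<^sub>m d 1) (- w) (1\<^sub>m 1)"
  let ?S = "four_block_mat (1\<^sub>m d) (?B * u) (0\<^sub>m 1 d) (det G \<cdot>\<^sub>m 1\<^sub>m 1)"
  have M: "?M \<in> carrier_mat (d + 1) (d + 1)" using G by auto
  have R: "?R \<in> carrier_mat (d + 1) (d + 1)" by auto
  have S: "?S \<in> carrier_mat (d + 1) (d + 1)" by auto
  have "?M * ?R = four_block_mat (G * 1\<^sub>m d + - u * - w) (G * 0\<^sub>m d 1 + - u * 1\<^sub>m 1)
      (w * 1\<^sub>m d + 1\<^sub>m 1 * - w) (w * 0\<^sub>m d 1 + 1\<^sub>m 1 * 1\<^sub>m 1)"
    by (rule mult_four_block_mat) (use G u w in auto)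
  also have "\<dots> = four_block_mat (G + u * w) (- u) (0\<^sub>m 1 d) (1\<^sub>m 1)"
  proof -
    have "w + - w = 0\<^sub>m 1 d" using w by auto
    then show ?thesis using G u w by (simp add: uminus_mult_left_mat uminus_mult_right_mat)
  qed
  finally have "det ?M * det ?R = det (four_block_mat (G + u * w) (- u) (0\<^sub>m 1 d) (1\<^sub>m 1))"
    using det_mult[OF M R] by simp
  also have "\<dots> = det (G + u * w) * det (1\<^sub>m 1 :: 'a mat)"
    by (rule det_four_block_mat_lower_left_zero) (use G u w in auto)
  also have "det ?R = det (1\<^sub>m d :: 'a mat) * det (1\<^sub>m 1 :: 'a mat)"
    by (rule det_four_block_mat_upper_right_zero) (use w in auto)
  finally have 1: "det ?M = det (G + u * w)" by simp
  have "?M * ?S = four_block_mat (G * 1\<^sub>m d + - u * 0\<^sub>m 1 d) (G * (?B * u) + - u * (det G \<cdot>\<^sub>m 1\<^sub>m 1))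
      (w * 1\<^sub>m d + 1\<^sub>m 1 * 0\<^sub>m 1 d) (w * (?B * u) + 1\<^sub>m 1 * (det G \<cdot>\<^sub>m 1\<^sub>m 1))"
    by (rule mult_four_block_mat) (use G u w adj in auto)
  also have "\<dots> = four_block_mat G (0\<^sub>m d 1) w (w * (?B * u) + det G \<cdot>\<^sub>m 1\<^sub>m 1)"
  proof -
    have "G * (?B * u) = det G \<cdot>\<^sub>m u"
      using adj G u by (simp add: mult_smult_assoc_mat[of _ d d _ 1] flip: assoc_mult_mat[of G d d ?B d u 1])
    then have "G * (?B * u) + - u * (det G \<cdot>\<^sub>m 1\<^sub>m 1) = 0\<^sub>m d 1"
      using u by (auto simp: mult_smult_distrib)
    then show ?thesis using G u w adj by simp
  qed
  finally have "det ?M * det ?S = det (four_block_mat G (0\<^sub>m d 1) w (w * (?B * u) + det G \<cdot>\<^sub>m 1\<^sub>m 1))"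
    using det_mult[OF M S] by simp
  also have "\<dots> = det G * det (w * (?B * u) + det G \<cdot>\<^sub>m 1\<^sub>m 1)"
    by (rule det_four_block_mat_upper_right_zero) (use G u w adj in auto)
  also have "det (w * (?B * u) + det G \<cdot>\<^sub>m 1\<^sub>m 1) = (w * (?B * u)) $$ (0, 0) + det G"
    by (subst det_single) (use w u adj in auto)
  also have "det ?S = det (1\<^sub>m d :: 'a mat) * det (det G \<cdot>\<^sub>m 1\<^sub>m 1 :: 'a mat)"
    by (rule det_four_block_mat_lower_left_zero) (use adj u in auto)
  finally have "det ?M * det G = det G * ((w * (?B * u)) $$ (0, 0) + det G)" by simp
  with D have "det ?M = (w * (?B * u)) $$ (0, 0) + det G" by (simp add: mult.commute)
  with 1 show ?thesis by (simp add: add.commute)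
qed

abbreviation fmat :: "nat \<Rightarrow> (nat \<Rightarrow> nat \<Rightarrow> 'a) \<Rightarrow> 'a mat" where
  "fmat d G \<equiv> mat d d (\<lambda>(x, y). G x y)"

definition adjugate :: "nat \<Rightarrow> (nat \<Rightarrow> nat \<Rightarrow> int) \<Rightarrow> (nat \<Rightarrow> nat \<Rightarrow> int) \<Rightarrow> int \<Rightarrow> bool" where
  "adjugate d G B D \<longleftrightarrow> D = det (fmat d G) \<and> (\<forall>x<d. \<forall>y<d. B x y = adj_mat (fmat d G) $$ (x, y))"

lemma adjugate_mult:
  assumes "adjugate d G B D" "x < d" "z < d"
  shows "(\<Sum>y<d. G x y * B y z) = (if x = z then D else 0)"
    and "(\<Sum>y<d. B x y * G y z) = (if x = z then D else 0)"
proof -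
  let ?G = "fmat d G"
  note adj = adj_mat[of ?G d, simplified]
  have "(\<Sum>y<d. G x y * B y z) = (?G * adj_mat ?G) $$ (x, z)"
    using assms adj(1) by (simp add: adjugate_def scalar_prod_def lessThan_atLeast0)
  also have "\<dots> = (if x = z then D else 0)"
    using assms by (simp add: adj(2) adjugate_def)
  finally show "(\<Sum>y<d. G x y * B y z) = (if x = z then D else 0)" .
  have "(\<Sum>y<d. B x y * G y z) = (adj_mat ?G * ?G) $$ (x, z)"
    using assms adj(1) by (simp add: adjugate_def scalar_prod_def lessThan_atLeast0)
  also have "\<dots> = (if x = z then D else 0)"
    using assms by (simp add: adj(3) adjugate_def)
  finally show "(\<Sum>y<d. B x y * G y z) = (if x = z then D else 0)" .
qed

text \<open>The transpose of \<open>B\<close> times \<open>G\<close> times \<open>B\<close> is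
  computed in two ways. Cancelling \<open>G\<close> against the right factor gives the entry at
  \<open>(y, x)\<close>; cancelling it against the left one, by symmetry of \<open>G\<close>, gives
  the entry at \<open>(x, y)\<close>, each times \<open>D\<close>.\<close>

lemma adjugate_sym:
  assumes "adjugate d G B D" "D \<noteq> 0" "\<And>x y. x < d \<Longrightarrow> y < d \<Longrightarrow> G x y = G y x" "x < d" "y < d"
  shows "B x y = B y x"
proof -
  have "(\<Sum>i<d. \<Sum>j<d. B i x * G i j * B j y) = (\<Sum>i<d. B i x * (if i = y then D else 0))"
    using assms by (intro sum.cong) (auto simp: mult.assoc adjugate_mult(1) simp flip: sum_distrib_left)
  also have "\<dots> = B y x * D" using assms by (simp add: if_distrib cong: if_cong)
  finally have 1: "(\<Sum>i<d. \<Sum>j<d. B i x * G i j * B j y) = B y x * D" .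
  have "(\<Sum>i<d. \<Sum>j<d. B i x * G i j * B j y) = (\<Sum>j<d. \<Sum>i<d. G j i * B i x * B j y)"
    by (subst sum.swap) (intro sum.cong, auto simp: assms(3) ac_simps)
  also have "\<dots> = (\<Sum>j<d. if j = x then D * B j y else 0)"
    using assms by (intro sum.cong) (auto simp: adjugate_mult(1) simp flip: sum_distrib_right)
  also have "\<dots> = D * B x y" using assms by simp
  finally show ?thesis using 1 assms(2) by simp
qed

text \<open>The Sherman-Morrison formula cleared of denominators, with \<open>h = B a\<close>. The
  division by \<open>D\<close> is exact, as the numerator turns out to be \<open>D\<close> times the
  adjugate of the new matrix.\<close>

lemma adjugate_update:
  fixes a :: "nat \<Rightarrow> int" and s :: int
  assumes adj: "adjugate d G B D" and D: "D > 0"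
    and sym: "\<And>x y. x < d \<Longrightarrow> y < d \<Longrightarrow> G x y = G y x"
  defines "h \<equiv> \<lambda>x. \<Sum>y<d. B x y * a y"
  defines "D' \<equiv> D + s * (\<Sum>x<d. a x * h x)"
  assumes D': "D' > 0"
  shows "adjugate d (\<lambda>x y. G x y + s * a x * a y) (\<lambda>x y. (D' * B x y - s * h x * h y) div D) D'"
proof -
  let ?G = "fmat d G" and ?G' = "fmat d (\<lambda>x y. G x y + s * a x * a y)"
  let ?u = "mat d 1 (\<lambda>(x, y). s * a x)" and ?w = "mat 1 d (\<lambda>(x, y). a y)"
  let ?X = "\<lambda>x y. D' * B x y - s * h x * h y"
  have "?G' = ?G + ?u * ?w" by (rule eq_matI) (auto simp: scalar_prod_def)
  then have "det ?G' = det ?G + (?w * (adj_mat ?G * ?u)) $$ (0, 0)"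
    using adj D by (simp add: det_add_rank_one[of _ d] adjugate_def)
  also have "(?w * (adj_mat ?G * ?u)) $$ (0, 0) = (\<Sum>x<d. a x * (\<Sum>y<d. B x y * (s * a y)))"
    using adj_mat(1)[of ?G d] adj
    by (simp add: scalar_prod_def adjugate_def lessThan_atLeast0)
  also have "\<dots> = s * (\<Sum>x<d. a x * h x)"
    by (simp add: h_def sum_distrib_left ac_simps)
  finally have det: "det ?G' = D'" using adj by (simp add: D'_def adjugate_def)
  have h: "(\<Sum>y<d. a y * B y z) = h z" if "z < d" for z
    unfolding h_def using adjugate_sym[OF adj _ sym] D that by (intro sum.cong) (auto simp: mult.commute)
  have Gh: "(\<Sum>y<d. G x y * h y) = D * a x" if "x < d" for x
  proof -
    have "(\<Sum>y<d. G x y * h y) = (\<Sum>z<d. \<Sum>y<d. G x y * B y z * a z)"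
      unfolding h_def by (subst sum.swap) (simp add: sum_distrib_left ac_simps)
    also have "\<dots> = (\<Sum>z<d. if x = z then D * a z else 0)"
      using that adj by (intro sum.cong) (auto simp: adjugate_mult(1) simp flip: sum_distrib_right)
    also have "\<dots> = D * a x" using that by simp
    finally show ?thesis .
  qed
  \<comment> \<open>Multiplying out leaves three rank-one terms, which cancel because
    \<open>s\<close> times the scalar product of \<open>a\<close> and \<open>h\<close> is
    \<open>D' - D\<close>.\<close>
  have prod: "(\<Sum>y<d. (G x y + s * a x * a y) * ?X y z) = (if x = z then D * D' else 0)"
    if "x < d" "z < d" for x z
  proof -
    have "(\<Sum>y<d. (G x y + s * a x * a y) * ?X y z) =
      D' * (\<Sum>y<d. G x y * B y z) - s * h z * (\<Sum>y<d. G x y * h y) + s * a x * D' * (\<Sum>y<d. a y * B y z)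
       - s * a x * h z * (s * (\<Sum>y<d. a y * h y))"
      by (simp add: sum_distrib_left sum.distrib sum_subtractf algebra_simps)
    also have "\<dots> = D' * (if x = z then D else 0) - s * h z * (D * a x) + s * a x * D' * h z
       - s * a x * h z * (D' - D)"
      by (simp only: adjugate_mult(1)[OF adj that] Gh[OF that(1)] h[OF that(2)] D'_def add_diff_cancel_left')
    also have "\<dots> = (if x = z then D * D' else 0)" by (simp add: algebra_simps)
    finally show ?thesis .
  qed
  \<comment> \<open>Multiplying the product by the adjugate of \<open>?G'\<close> from the left and
    cancelling \<open>D'\<close> identifies the numerator; this proves divisibility and the formula
    at once.\<close>
  have "?X x z = D * adj_mat ?G' $$ (x, z)" if "x < d" "z < d" for x z
  proof -
    note adj' = adj_mat[of ?G' d, simplified]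
    have "(adj_mat ?G' * ?G') * fmat d ?X = adj_mat ?G' * (?G' * fmat d ?X)"
      by (rule assoc_mult_mat) (use adj'(1) in auto)
    also have "?G' * fmat d ?X = (D * D') \<cdot>\<^sub>m 1\<^sub>m d"
      by (rule eq_matI) (simp_all add: scalar_prod_def prod flip: lessThan_atLeast0)
    finally have "D' \<cdot>\<^sub>m fmat d ?X = (D * D') \<cdot>\<^sub>m adj_mat ?G'"
      using adj' det by (simp add: mult_smult_distrib[of _ d d _ d] mult_smult_assoc_mat[of _ d d _ d])
    then have "(D' \<cdot>\<^sub>m fmat d ?X) $$ (x, z) = ((D * D') \<cdot>\<^sub>m adj_mat ?G') $$ (x, z)" by simp
    then have "D' * ?X x z = D * D' * adj_mat ?G' $$ (x, z)" using that adj'(1) by simp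
    with D' show ?thesis by simp
  qed
  then show ?thesis unfolding adjugate_def using det D by simp
qed

lemma adjugate_one: "adjugate d (\<lambda>x y. if x = y then 1 else 0) (\<lambda>x y. if x = y then 1 else 0) 1"
proof -
  have 1: "fmat d (\<lambda>x y. if x = y then 1 else (0::int)) = 1\<^sub>m d" by (rule eq_matI) auto
  have "adj_mat (1\<^sub>m d :: int mat) = 1\<^sub>m d"
    using adj_mat[of "1\<^sub>m d :: int mat" d] by (auto intro!: eq_matI)
  then show ?thesis unfolding adjugate_def 1 by simp
qed

section \<open>Solutions of bounded size\<close>

lemma sum_delta_mult:
  fixes f g :: "nat \<Rightarrow> 'a :: comm_ring_1"
  assumes "x < d"
  shows "(\<Sum>z<d. ((if x = z then c else 0) + f z) * g z) = c * g x + (\<Sum>z<d. f z * g z)"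
proof -
  have "(\<Sum>z<d. ((if x = z then c else 0) + f z) * g z) =
      (\<Sum>z<d. (if x = z then c * g z else 0) + f z * g z)"
    by (intro sum.cong) (auto simp: distrib_right)
  then show ?thesis using assms by (simp add: sum.distrib)
qed

lemma gram_mult:
  fixes g v :: "nat \<Rightarrow> 'a :: comm_ring_1"
  shows "(\<Sum>z<d. (\<Sum>q\<in>J. g q * a q x * a q z) * v z) = (\<Sum>q\<in>J. g q * a q x * (\<Sum>z<d. a q z * v z))"
  unfolding sum_distrib_right sum_distrib_left by (subst sum.swap) (simp add: mult.assoc)

text \<open>Turns the form of a weighted Gram matrix into a sum over the rows; for
  \<open>u = v\<close> and nonnegative weights this is a weighted sum of squares.\<close>

lemma gram_form:
  fixes g u v :: "nat \<Rightarrow> 'a :: comm_ring_1"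
  shows "(\<Sum>x<d. u x * (\<Sum>q\<in>J. g q * a q x * (\<Sum>z<d. a q z * v z))) =
    (\<Sum>q\<in>J. g q * (\<Sum>x<d. a q x * u x) * (\<Sum>z<d. a q z * v z))"
proof -
  have "(\<Sum>x<d. u x * (\<Sum>q\<in>J. g q * a q x * (\<Sum>z<d. a q z * v z))) =
    (\<Sum>q\<in>J. \<Sum>x<d. u x * (g q * a q x * (\<Sum>z<d. a q z * v z)))"
    unfolding sum_distrib_left[of "u _"] by (rule sum.swap)
  also have "\<dots> = (\<Sum>q\<in>J. g q * (\<Sum>x<d. a q x * u x) * (\<Sum>z<d. a q z * v z))"
  proof (intro sum.cong refl)
    fix q
    define w where "w = (\<Sum>z<d. a q z * v z)"
    show "(\<Sum>x<d. u x * (g q * a q x * (\<Sum>z<d. a q z * v z))) = g q * (\<Sum>x<d. a q x * u x) * (\<Sum>z<d. a q z * v z)"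
      unfolding w_def[symmetric] by (simp add: sum_distrib_left sum_distrib_right ac_simps)
  qed
  finally show ?thesis .
qed

section \<open>Linear forms and bounds for determinants\<close>

definition lin :: "nat \<Rightarrow> (nat \<Rightarrow> int) \<Rightarrow> (nat \<Rightarrow> real) \<Rightarrow> real" where
  "lin d a y = (\<Sum>x<d. of_int (a x) * y x)"

lemma lin_add: "lin d a (\<lambda>x. y x + z x) = lin d a y + lin d a z"
  by (simp add: lin_def sum.distrib algebra_simps)

lemma lin_scale: "lin d a (\<lambda>x. c * y x) = c * lin d a y"
  by (simp add: lin_def sum_distrib_left algebra_simps)

lemma abs_det_le:
  fixes A :: "int mat"
  assumes A: "A \<in> carrier_mat n n" and h: "\<And>i j. i < n \<Longrightarrow> j < n \<Longrightarrow> \<bar>A $$ (i, j)\<bar> \<le> h"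
  shows "\<bar>det A\<bar> \<le> fact n * h ^ n"
proof -
  have "\<bar>det A\<bar> \<le> (\<Sum>p | p permutes {0..<n}. \<bar>signof p * (\<Prod>i = 0..<n. A $$ (i, p i))\<bar>)"
    unfolding det_def'[OF A] by (rule sum_abs)
  also have "\<dots> \<le> (\<Sum>p | p permutes {0..<n}. h ^ n)"
  proof (rule sum_mono)
    fix p assume p: "p \<in> {p. p permutes {0..<n}}"
    have "\<bar>signof p * (\<Prod>i = 0..<n. A $$ (i, p i))\<bar> = (\<Prod>i = 0..<n. \<bar>A $$ (i, p i)\<bar>)"
      by (simp add: abs_mult abs_prod sign_def)
    also have "\<dots> \<le> (\<Prod>i = 0..<n. h)"
      using p by (intro prod_mono) (auto intro!: h dest: permutes_in_image)
    finally show "\<bar>signof p * (\<Prod>i = 0..<n. A $$ (i, p i))\<bar> \<le> h ^ n" by simp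
  qed
  also have "\<dots> = fact n * h ^ n" by (simp add: card_permutations[OF refl])
  finally show ?thesis .
qed

lemma abs_adj_mat_le:
  fixes A :: "int mat"
  assumes A: "A \<in> carrier_mat d d" and h: "\<And>i j. i < d \<Longrightarrow> j < d \<Longrightarrow> \<bar>A $$ (i, j)\<bar> \<le> h"
    and "1 \<le> h" "i < d" "j < d"
  shows "\<bar>adj_mat A $$ (i, j)\<bar> \<le> (int d * h) ^ d"
proof -
  have "adj_mat A $$ (i, j) = (-1) ^ (j + i) * det (mat_delete A j i)"
    using assms by (simp add: adj_mat_def cofactor_def)
  then have "\<bar>adj_mat A $$ (i, j)\<bar> = \<bar>det (mat_delete A j i)\<bar>" by (simp add: abs_mult power_abs)
  also have "\<dots> \<le> fact (d - 1) * h ^ (d - 1)"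
  proof (rule abs_det_le)
    show "mat_delete A j i \<in> carrier_mat (d - 1) (d - 1)" using A by (intro mat_delete_carrier)
    fix i' j' assume "i' < d - 1" "j' < d - 1"
    then show "\<bar>mat_delete A j i $$ (i', j')\<bar> \<le> h"
      using A by (auto simp: mat_delete_def intro!: h)
  qed
  also have "\<dots> \<le> int d ^ (d - 1) * h ^ (d - 1)"
  proof (intro mult_right_mono)
    have "fact (d - 1) \<le> int ((d - 1) ^ (d - 1))" by (rule fact_le_power)
    also have "\<dots> \<le> int d ^ (d - 1)" unfolding of_nat_power by (intro power_mono) auto
    finally show "fact (d - 1) \<le> int d ^ (d - 1)" .
  qed (use \<open>1 \<le> h\<close> in auto)
  also have "\<dots> = (int d * h) ^ (d - 1)" by (simp add: power_mult_distrib)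
  also have "\<dots> \<le> (int d * h) ^ d"
  proof (rule power_increasing)
    have "1 * 1 \<le> int d * h" using assms by (intro mult_mono) auto
    then show "1 \<le> int d * h" by simp
  qed simp
  finally show ?thesis .
qed

text \<open>A feasible point with the largest number of vanishing coordinates and tight constraints is
  the only solution of its tight constraints: along any other direction one could move
  until another constraint becomes tight.\<close>

lemma exists_vertex:
  fixes a :: "nat \<Rightarrow> nat \<Rightarrow> int"
  assumes "\<forall>q<N. lin d (a q) y0 > 0"
  shows "\<exists>y. (\<forall>q<N. lin d (a q) y \<ge> 1) \<and>
    (\<forall>h. (\<forall>x<d. y x = 0 \<longrightarrow> h x = 0) \<longrightarrow> (\<forall>q<N. lin d (a q) y = 1 \<longrightarrow> lin d (a q) h = 0) \<longrightarrow> (\<forall>x<d. h x = 0))"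
proof -
  define feas where "feas y \<longleftrightarrow> (\<forall>q<N. lin d (a q) y \<ge> 1)" for y
  define zs where "zs y = {x. x < d \<and> y x = (0::real)}" for y
  define ts where "ts y = {q. q < N \<and> lin d (a q) y = 1}" for y
  define score where "score y = card (zs y) + card (ts y)" for y
  have fin: "finite (zs y)" "finite (ts y)" for y by (auto simp: zs_def ts_def)
  have score_less: "score y < score z" if "zs y \<subseteq> zs z" "ts y \<subseteq> ts z" "zs y \<noteq> zs z \<or> ts y \<noteq> ts z" for y z
  proof (cases "zs y = zs z")
    case True
    then have "card (ts y) < card (ts z)" using that by (intro psubset_card_mono fin) auto
    then show ?thesis using True by (simp add: score_def)
  next
    case False
    then have "card (zs y) < card (zs z)" using that by (intro psubset_card_mono fin) auto
    moreover have "card (ts y) \<le> card (ts z)" using that by (intro card_mono fin)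
    ultimately show ?thesis by (simp add: score_def)
  qed
  have "score y < d + N + 1" for y
  proof -
    have "card (zs y) \<le> card {..<d}" "card (ts y) \<le> card {..<N}"
      by (intro card_mono; auto simp: zs_def ts_def)+
    then show ?thesis by (simp add: score_def)
  qed
  moreover have "\<exists>y. feas y"
  proof (cases "N = 0")
    case False
    define m where "m = Min ((\<lambda>q. lin d (a q) y0) ` {..<N})"
    have "m \<in> (\<lambda>q. lin d (a q) y0) ` {..<N}" unfolding m_def using False by (intro Min_in) auto
    then have "m > 0" using assms by auto
    moreover have "m \<le> lin d (a q) y0" if "q < N" for q using that by (simp add: m_def)
    ultimately have "feas (\<lambda>x. (1 / m) * y0 x)" unfolding feas_def lin_scale by (simp add: field_simps)
    then show ?thesis by blast
  qed (simp add: feas_def)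
  ultimately obtain y where y: "feas y" "\<And>z. feas z \<Longrightarrow> score z \<le> score y"
    using ex_has_greatest_nat[of feas _ score "d + N + 1"] by blast
  have "h x = 0" if h: "\<forall>x<d. y x = 0 \<longrightarrow> h x = 0" "\<forall>q<N. lin d (a q) y = 1 \<longrightarrow> lin d (a q) h = 0" and x: "x < d" for h x
  proof (rule ccontr)
    assume hx: "h x \<noteq> 0"
    with h x have yx: "y x \<noteq> 0" by auto
    \<comment> \<open>\<open>h\<close> is scaled so that the full step along it makes the nonzero
      coordinate \<open>x\<close> vanish; vanishing coordinates and tight constraints are kept by
      the assumptions on \<open>h\<close>.\<close>
    define g where "g = (\<lambda>z. (- y x / h x) * h z)"
    have gx: "y x + g x = 0" using hx by (simp add: g_def)
    have gz: "g z = 0" if "z < d" "y z = 0" for z using h that by (simp add: g_def)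
    have gt: "lin d (a q) g = 0" if "q < N" "lin d (a q) y = 1" for q
      using h that unfolding g_def lin_scale by simp
    define V where "V = {q. q < N \<and> lin d (a q) y + lin d (a q) g < 1}"
    have finV: "finite V" by (simp add: V_def)
    show False
    proof (cases "V = {}")
      case True
      let ?z = "\<lambda>z. y z + g z"
      have "feas ?z" using True by (simp add: feas_def lin_add V_def) (meson linorder_not_less)
      moreover have "score y < score ?z"
      proof (rule score_less)
        show "zs y \<subseteq> zs ?z" using gz by (auto simp: zs_def)
        show "ts y \<subseteq> ts ?z" using gt by (auto simp: ts_def lin_add)
        have "x \<in> zs ?z - zs y" using gx yx x by (auto simp: zs_def)
        then show "zs y \<noteq> zs ?z \<or> ts y \<noteq> ts ?z" by blast
      qed
      ultimately show False using y(2) by (metis leD)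
    next
      case False
      have V1: "lin d (a q) y > 1" "lin d (a q) g < 0" if "q \<in> V" for q
      proof -
        have "lin d (a q) y \<ge> 1" using y(1) that by (auto simp: feas_def V_def)
        moreover have "lin d (a q) y \<noteq> 1" using gt[of q] that by (auto simp: V_def)
        ultimately show "lin d (a q) y > 1" by simp
        then show "lin d (a q) g < 0" using that by (simp add: V_def)
      qed
      \<comment> \<open>A ratio test: at the parameter \<open>r q\<close> constraint
        \<open>q\<close> becomes tight. The least ratio lies strictly between 0 and 1, because the
        members of \<open>V\<close> are slack at \<open>y\<close> and violated after the full
        step.\<close>
      define r where "r q = (lin d (a q) y - 1) / (- lin d (a q) g)" for q
      define t where "t = Min (r ` V)"
      have "t \<in> r ` V" unfolding t_def using False finV by (intro Min_in) auto
      then obtain q where q: "q \<in> V" "t = r q" by blast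
      have tmin: "t \<le> r q'" if "q' \<in> V" for q' unfolding t_def using that finV by simp
      have t01: "0 < t" "t < 1" 
      proof -
        show "0 < t" unfolding q(2) r_def using V1[OF q(1)] by (intro divide_pos_pos) auto
        show "t < 1" unfolding q(2) r_def using V1[OF q(1)] q(1)
          by (subst divide_less_eq_1_pos) (auto simp: V_def)
      qed
      let ?z = "\<lambda>z. y z + t * g z"
      have tq: "lin d (a q) ?z = 1"
        using V1[OF q(1)] q(2) by (simp add: lin_add lin_scale r_def field_simps)
      have "feas ?z" unfolding feas_def
      proof (intro allI impI)
        fix q' assume q': "q' < N"
        show "1 \<le> lin d (a q') ?z"
        proof (cases "q' \<in> V")
          case True
          then show ?thesis using tmin[OF True] V1[OF True] by (simp add: lin_add lin_scale r_def field_simps)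
        next
          case False
          then have "1 \<le> lin d (a q') y + lin d (a q') g" using q' by (simp add: V_def)
          \<comment> \<open>\<open>?z\<close> is the convex combination of \<open>y\<close> and
            \<open>y + g\<close> with weight \<open>t\<close> on the latter, and this constraint
            holds at both.\<close>
          then have "t * 1 \<le> t * (lin d (a q') y + lin d (a q') g)" using t01 by (intro mult_left_mono) auto
          moreover have "(1 - t) * 1 \<le> (1 - t) * lin d (a q') y"
            using t01 y(1) q' by (intro mult_left_mono) (auto simp: feas_def)
          ultimately show ?thesis by (simp add: lin_add lin_scale algebra_simps)
        qed
      qed
      moreover have "score y < score ?z"
      proof (rule score_less)
        show "zs y \<subseteq> zs ?z" using gz by (auto simp: zs_def)
        show "ts y \<subseteq> ts ?z" using gt by (auto simp: ts_def lin_add lin_scale)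
        have "q \<in> ts ?z - ts y" using tq V1[OF q(1)] q(1) by (auto simp: ts_def V_def)
        then show "zs y \<noteq> zs ?z \<or> ts y \<noteq> ts ?z" by blast
      qed
      ultimately show False using y(2) by (metis leD)
    qed
  qed
  then show ?thesis using y(1) unfolding feas_def by blast
qed

text \<open>\<open>d\<close> times the bound \<open>1 + N * L\<^sup>2\<close> for the entries of the
  matrix \<open>H\<close> in \<open>small_solution\<close>; \<open>abs_adj_mat_le\<close> raises
  this product to the power \<open>d\<close>.\<close>

definition width :: "nat \<Rightarrow> nat \<Rightarrow> nat \<Rightarrow> nat" where
  "width d N L = d * (1 + N * L\<^sup>2)"

text \<open>By Cramer's rule for the Gram matrix of the tight constraints of a vertex.\<close>

lemma small_solution:
  fixes a :: "nat \<Rightarrow> nat \<Rightarrow> int"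
  assumes ex: "\<forall>q<N. lin d (a q) y0 > 0" and L: "\<And>q x. q < N \<Longrightarrow> x < d \<Longrightarrow> \<bar>a q x\<bar> \<le> int L"
    and pos: "0 < N" "0 < L" "0 < d"
  shows "\<exists>y. (\<forall>x<d. \<bar>y x\<bar> \<le> 1) \<and>
    (\<forall>q<N. 1 / 2 ^ (width d N L * (d + 2)) \<le> lin d (a q) y \<and> lin d (a q) y \<le> 1)"
proof -
  from exists_vertex[OF ex] obtain y where y: "\<forall>q<N. lin d (a q) y \<ge> 1"
    and uniq: "\<And>h. \<forall>x<d. y x = 0 \<longrightarrow> h x = 0 \<Longrightarrow> \<forall>q<N. lin d (a q) y = 1 \<longrightarrow> lin d (a q) h = 0 \<Longrightarrow> \<forall>x<d. h x = 0"
    by blast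
  define J where "J = {q. q < N \<and> lin d (a q) y = 1}"
  have J: "finite J" "J \<subseteq> {..<N}" by (auto simp: J_def)
  \<comment> \<open>The indicator of the vanishing coordinates, placed on the diagonal, does not
    disturb \<open>H y = b\<close>, as it multiplies zeros, and it makes \<open>H\<close>
    nonsingular.\<close>
  define e where "e x = (if y x = 0 then 1 else 0 :: int)" for x
  define H where "H x z = (if x = z then e x else 0) + (\<Sum>q\<in>J. a q x * a q z)" for x z
  define b where "b x = (\<Sum>q\<in>J. a q x)" for x
  define W where "W = int (width d N L)"
  let ?H = "fmat d H"
  define D where "D = det ?H"
  note adj = adj_mat[of ?H d, folded D_def, simplified]
  have cardJ: "int (card J) \<le> int N" using card_mono[OF _ J(2)] by simp
  have Hy: "(\<Sum>z<d. of_int (H x z) * y z) = of_int (b x)" if "x < d" for x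
  proof -
    have "(\<Sum>z<d. of_int (H x z) * y z) = (\<Sum>z<d. ((if x = z then of_int (e x) else 0) +
        (\<Sum>q\<in>J. 1 * of_int (a q x) * of_int (a q z))) * y z)"
      by (intro sum.cong) (auto simp: H_def)
    also have "\<dots> = of_int (e x) * y x + (\<Sum>q\<in>J. of_int (a q x) * lin d (a q) y)"
      unfolding sum_delta_mult[OF that] gram_mult[where a = "\<lambda>q x. of_int (a q x)"] by (simp add: lin_def)
    also have "\<dots> = of_int (b x)" by (simp add: e_def b_def J_def)
    finally show ?thesis .
  qed
  have "D \<noteq> 0"
  proof
    assume "D = 0"
    then obtain v where v: "v \<in> carrier_vec d" "v \<noteq> 0\<^sub>v d" "?H *\<^sub>v v = 0\<^sub>v d"
      using det_0_iff_vec_prod_zero[of ?H d] by (auto simp: D_def)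
    have Hv: "(\<Sum>z<d. H x z * v $ z) = 0" if "x < d" for x
    proof -
      have "(?H *\<^sub>v v) $ x = 0" using v(3) that by simp
      then show ?thesis using that v(1) by (simp add: scalar_prod_def lessThan_atLeast0)
    qed
    \<comment> \<open>A kernel vector makes a sum of squares vanish. So it is zero wherever
      \<open>y\<close> is and orthogonal to all tight rows, and the vertex property forces it to be
      zero.\<close>
    have "0 = (\<Sum>x<d. v $ x * (\<Sum>z<d. H x z * v $ z))" by (simp add: Hv)
    also have "\<dots> = (\<Sum>x<d. v $ x * (e x * v $ x + (\<Sum>q\<in>J. 1 * a q x * (\<Sum>z<d. a q z * v $ z))))"
      using gram_mult[where g = "\<lambda>_. 1" and a = a and v = "\<lambda>z. v $ z"]
      by (intro sum.cong refl arg_cong[where f = "(*) _"]) (simp add: H_def sum_delta_mult)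
    also have "\<dots> = (\<Sum>x<d. e x * (v $ x)\<^sup>2) + (\<Sum>x<d. v $ x * (\<Sum>q\<in>J. 1 * a q x * (\<Sum>z<d. a q z * v $ z)))"
      by (simp add: distrib_left sum.distrib power2_eq_square ac_simps)
    also have "(\<Sum>x<d. v $ x * (\<Sum>q\<in>J. 1 * a q x * (\<Sum>z<d. a q z * v $ z))) = (\<Sum>q\<in>J. (\<Sum>x<d. a q x * v $ x)\<^sup>2)"
      unfolding gram_form by (simp add: power2_eq_square)
    finally have 0: "(\<Sum>x<d. e x * (v $ x)\<^sup>2) + (\<Sum>q\<in>J. (\<Sum>x<d. a q x * v $ x)\<^sup>2) = 0" by simp
    have nn: "(\<Sum>x<d. e x * (v $ x)\<^sup>2) \<ge> 0" "(\<Sum>q\<in>J. (\<Sum>x<d. a q x * v $ x)\<^sup>2) \<ge> 0"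
      by (auto intro!: sum_nonneg simp: e_def)
    with 0 have "(\<Sum>x<d. e x * (v $ x)\<^sup>2) = 0" "(\<Sum>q\<in>J. (\<Sum>x<d. a q x * v $ x)\<^sup>2) = 0" by linarith+
    then have "\<forall>x<d. e x * (v $ x)\<^sup>2 = 0" "\<forall>q\<in>J. (\<Sum>x<d. a q x * v $ x) = 0"
      using J(1) by (simp_all add: sum_nonneg_eq_0_iff e_def)
    then have "\<forall>x<d. real_of_int (v $ x) = 0"
      by (intro uniq) (auto simp: e_def J_def lin_def simp flip: of_int_mult of_int_sum)
    then have "v = 0\<^sub>v d" using v(1) by (intro eq_vecI) auto
    with v(2) show False ..
  qed
  have Dy: "of_int D * y x = of_int (\<Sum>z<d. adj_mat ?H $$ (x, z) * b z)" if x: "x < d" for x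
  proof -
    have *: "(\<Sum>z<d. adj_mat ?H $$ (x, z) * H z w) = (if x = w then D else 0)" if "w < d" for w
    proof -
      have "(adj_mat ?H * ?H) $$ (x, w) = (if x = w then D else 0)" using x that by (simp add: adj(3))
      then show ?thesis using x that adj(1) by (simp add: scalar_prod_def lessThan_atLeast0)
    qed
    have "of_int (\<Sum>z<d. adj_mat ?H $$ (x, z) * b z) =
        (\<Sum>z<d. of_int (adj_mat ?H $$ (x, z)) * (\<Sum>w<d. of_int (H z w) * y w))"
      by (simp add: Hy)
    also have "\<dots> = (\<Sum>w<d. of_int (\<Sum>z<d. adj_mat ?H $$ (x, z) * H z w) * y w)"
      by (simp add: sum_distrib_left sum_distrib_right mult.assoc) (rule sum.swap)
    also have "\<dots> = (\<Sum>w<d. if x = w then of_int D * y w else 0)"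
      by (intro sum.cong) (auto simp: *)
    also have "\<dots> = of_int D * y x" using x by simp
    finally show ?thesis ..
  qed
  have L2: "\<bar>a q x * a q z\<bar> \<le> (int L)\<^sup>2" if "q < N" "x < d" "z < d" for q x z
    using L[OF that(1,2)] L[OF that(1,3)] by (simp add: abs_mult power2_eq_square mult_mono)
  have Hle: "\<bar>H x z\<bar> \<le> 1 + int N * (int L)\<^sup>2" if "x < d" "z < d" for x z
  proof -
    have "\<bar>H x z\<bar> \<le> 1 + \<bar>\<Sum>q\<in>J. a q x * a q z\<bar>" by (auto simp: H_def e_def)
    also have "\<bar>\<Sum>q\<in>J. a q x * a q z\<bar> \<le> (\<Sum>q\<in>J. \<bar>a q x * a q z\<bar>)" by (rule sum_abs)
    also have "\<dots> \<le> (\<Sum>q\<in>J. (int L)\<^sup>2)" using that J by (intro sum_mono L2) auto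
    also have "\<dots> \<le> int N * (int L)\<^sup>2" using cardJ by (simp add: mult_right_mono)
    finally show ?thesis by simp
  qed
  have adj_le: "\<bar>adj_mat ?H $$ (x, z)\<bar> \<le> W ^ d" if "x < d" "z < d" for x z
  proof -
    have "\<bar>adj_mat ?H $$ (x, z)\<bar> \<le> (int d * (1 + int N * (int L)\<^sup>2)) ^ d"
      by (rule abs_adj_mat_le) (use that Hle in auto)
    then show ?thesis
      by (simp only: W_def width_def of_nat_mult of_nat_add of_nat_1 of_nat_power)
  qed
  have b_le: "\<bar>b z\<bar> \<le> int N * int L" if "z < d" for z
  proof -
    have "\<bar>b z\<bar> \<le> (\<Sum>q\<in>J. \<bar>a q z\<bar>)" unfolding b_def by (rule sum_abs)
    also have "\<dots> \<le> (\<Sum>q\<in>J. int L)" using that J by (intro sum_mono L) auto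
    also have "\<dots> \<le> int N * int L" using cardJ by (simp add: mult_right_mono)
    finally show ?thesis .
  qed
  \<comment> \<open>Up to sign, \<open>Y\<close> is the integral vector \<open>adj_mat ?H\<close>
    times \<open>b\<close>. As \<open>\<bar>D\<bar>\<close> is at least 1, the constraints still
    have value at least 1 at \<open>Y\<close>.\<close>
  define Y where "Y = (\<lambda>x. of_int \<bar>D\<bar> * y x)"
  have Y_le: "\<bar>Y x\<bar> \<le> of_int (int d * (W ^ d * (int N * int L)))" if "x < d" for x
  proof -
    have "\<bar>\<Sum>z<d. adj_mat ?H $$ (x, z) * b z\<bar> \<le> (\<Sum>z<d. \<bar>adj_mat ?H $$ (x, z) * b z\<bar>)" by (rule sum_abs)
    also have "\<dots> \<le> (\<Sum>z<d. W ^ d * (int N * int L))"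
      using that adj_le b_le unfolding abs_mult by (intro sum_mono mult_mono) (auto simp: W_def)
    finally have "\<bar>\<Sum>z<d. adj_mat ?H $$ (x, z) * b z\<bar> \<le> int d * (W ^ d * (int N * int L))" by simp
    moreover have "\<bar>Y x\<bar> = \<bar>of_int D * y x\<bar>" by (simp add: Y_def abs_mult)
    ultimately show ?thesis unfolding Dy[OF that] by (simp only: of_int_abs[symmetric] of_int_le_iff)
  qed
  have lin_Y: "\<bar>lin d (a q) Y\<bar> \<le> of_int (int d * (int L * (int d * (W ^ d * (int N * int L)))))" if "q < N" for q
  proof -
    have "\<bar>lin d (a q) Y\<bar> \<le> (\<Sum>x<d. \<bar>of_int (a q x) * Y x\<bar>)" unfolding lin_def by (rule sum_abs)
    also have "\<dots> \<le> (\<Sum>x<d. of_int (int L) * of_int (int d * (W ^ d * (int N * int L))))"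
      unfolding abs_mult
    proof (intro sum_mono mult_mono)
      fix x assume "x \<in> {..<d}"
      then show "\<bar>real_of_int (a q x)\<bar> \<le> real_of_int (int L)" using L[OF that] by (simp only: of_int_abs[symmetric] of_int_le_iff) auto
      show "\<bar>Y x\<bar> \<le> of_int (int d * (W ^ d * (int N * int L)))" using \<open>x \<in> {..<d}\<close> Y_le by auto
    qed auto
    finally show ?thesis by simp
  qed
  have "int d * (int L * (int d * (W ^ d * (int N * int L)))) = (int d * int d) * (int N * (int L)\<^sup>2) * W ^ d"
    by (simp only: power2_eq_square ac_simps)
  also have "\<dots> \<le> (int d * int d) * (1 + int N * (int L)\<^sup>2)\<^sup>2 * W ^ d"
  proof (intro mult_right_mono mult_left_mono)
    show "int N * (int L)\<^sup>2 \<le> (1 + int N * (int L)\<^sup>2)\<^sup>2" by (simp add: power2_eq_square algebra_simps)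
  qed (auto simp: W_def)
  also have "\<dots> = W ^ (d + 2)"
  proof -
    have "W = int d * (1 + int N * (int L)\<^sup>2)"
      by (simp only: W_def width_def of_nat_mult of_nat_add of_nat_1 of_nat_power)
    then have "(int d * int d) * (1 + int N * (int L)\<^sup>2)\<^sup>2 = W\<^sup>2"
      by (simp only: power_mult_distrib power2_eq_square ac_simps)
    then show ?thesis by (simp only: power_add mult.commute)
  qed
  finally have bnd2: "int d * (int L * (int d * (W ^ d * (int N * int L)))) \<le> W ^ (d + 2)" .
  have bnd1: "int d * (W ^ d * (int N * int L)) \<le> W ^ (d + 2)"
  proof -
    define P where "P = int d * (W ^ d * (int N * int L))"
    have "1 * 1 \<le> int d * int L" using pos by (intro mult_mono) auto
    then have "1 * P \<le> (int d * int L) * P" by (intro mult_right_mono) (auto simp: P_def W_def)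
    then have "P \<le> int d * (int L * P)" by (simp only: mult.assoc mult_1)
    also have "\<dots> \<le> W ^ (d + 2)" using bnd2 by (simp only: P_def)
    finally show ?thesis by (simp only: P_def)
  qed
  \<comment> \<open>A power of two above \<open>W ^ (d + 2)\<close>, by which \<open>Y\<close> is
    scaled down. The exponent \<open>d\<close> comes from the adjugate; the 2 absorbs the factors
    \<open>d * d\<close> and \<open>N * L\<^sup>2\<close>.\<close>
  define K where "K = (2::int) ^ (width d N L * (d + 2))"
  have "W < 2 ^ width d N L" unfolding W_def by (rule of_nat_less_two_power)
  then have "W ^ (d + 2) \<le> (2 ^ width d N L) ^ (d + 2)" by (intro power_mono) (auto simp: W_def)
  also have "\<dots> = K" by (simp only: K_def power_mult)
  finally have K: "W ^ (d + 2) \<le> K" .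
  have Kpos: "K > 0" by (simp add: K_def)
  let ?y = "\<lambda>x. (1 / of_int K) * Y x"
  have "\<bar>?y x\<bar> \<le> 1" if "x < d" for x
  proof -
    have "real_of_int (int d * (W ^ d * (int N * int L))) \<le> of_int K" using bnd1 K by (simp only: of_int_le_iff)
    then have "\<bar>Y x\<bar> \<le> of_int K" using Y_le[OF that] by (rule order_trans[rotated])
    then show ?thesis using Kpos by (simp add: abs_mult)
  qed
  moreover have "1 / of_int K \<le> lin d (a q) ?y \<and> lin d (a q) ?y \<le> 1" if "q < N" for q
  proof -
    have "1 \<le> \<bar>D\<bar>" using \<open>D \<noteq> 0\<close> by simp
    then have "1 \<le> real_of_int \<bar>D\<bar>" by (metis of_int_1_le_iff)
    moreover have "1 \<le> lin d (a q) y" using y that by blast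
    ultimately have "1 * 1 \<le> of_int \<bar>D\<bar> * lin d (a q) y" by (intro mult_mono) auto
    then have "1 \<le> lin d (a q) Y" by (simp add: Y_def lin_scale)
    moreover have "real_of_int (int d * (int L * (int d * (W ^ d * (int N * int L))))) \<le> of_int K"
      using bnd2 K by (simp only: of_int_le_iff)
    then have "lin d (a q) Y \<le> of_int K" by (rule order_trans[OF abs_le_D1[OF lin_Y[OF that]]])
    ultimately show ?thesis unfolding lin_scale using Kpos by (simp add: divide_simps)
  qed
  ultimately show ?thesis unfolding K_def by (intro exI[of _ ?y]) (auto simp: K_def)
qed

section \<open>The rescaled perceptron\<close>

definition gram :: "nat \<Rightarrow> (nat \<Rightarrow> nat \<Rightarrow> int) \<Rightarrow> (nat \<Rightarrow> nat) \<Rightarrow> nat \<Rightarrow> nat \<Rightarrow> int" where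
  "gram N a m x z = (if x = z then 1 else 0) + (\<Sum>q<N. (4 ^ m q - 1) * a q x * a q z)"

lemma gram_sym: "gram N a m x z = gram N a m z x"
  by (simp add: gram_def ac_simps)

lemma gram_0: "gram N a (\<lambda>_. 0) = (\<lambda>x z. if x = z then 1 else 0)"
  by (simp add: gram_def fun_eq_iff)

text \<open>The difference of consecutive powers of 4 is \<open>3 * 4 ^ m j\<close>, so raising one
  exponent is a rank-one change of the matrix.\<close>

lemma gram_Suc:
  assumes "j < N"
  shows "gram N a (m(j := Suc (m j))) x z = gram N a m x z + (3 * 4 ^ m j) * a j x * a j z"
proof -
  have *: "(\<Sum>q<N. f q) = f j + (\<Sum>q\<in>{..<N}-{j}. f q)" for f :: "nat \<Rightarrow> int"
    using assms by (intro sum.remove) auto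
  let ?f = "\<lambda>m q. (4 ^ m q - 1) * a q x * a q z"
  have "(\<Sum>q<N. ?f (m(j := Suc (m j))) q) = ?f (m(j := Suc (m j))) j + (\<Sum>q\<in>{..<N}-{j}. ?f m q)"
    unfolding *[of "?f (m(j := Suc (m j)))"] by simp
  also have "\<dots> = (3 * 4 ^ m j) * a j x * a j z + (\<Sum>q<N. ?f m q)"
    unfolding *[of "?f m"] by (simp add: algebra_simps)
  finally show ?thesis by (simp add: gram_def)
qed

section \<open>Integral scalar products and the form of the adjugate\<close>

definition idot :: "nat \<Rightarrow> (nat \<Rightarrow> int) \<Rightarrow> (nat \<Rightarrow> int) \<Rightarrow> int" where
  "idot d f g = (\<Sum>x<d. f x * g x)"

definition apply_mat :: "nat \<Rightarrow> (nat \<Rightarrow> nat \<Rightarrow> int) \<Rightarrow> (nat \<Rightarrow> int) \<Rightarrow> nat \<Rightarrow> int" where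
  "apply_mat d B g x = (\<Sum>y<d. B x y * g y)"

lemma idot_commute: "idot d f g = idot d g f"
  by (simp add: idot_def mult.commute)

lemma idot_add: "idot d f (\<lambda>x. g x + h x) = idot d f g + idot d f h"
  by (simp add: idot_def distrib_left sum.distrib)

lemma idot_scale: "idot d f (\<lambda>x. c * g x) = c * idot d f g"
  by (simp add: idot_def sum_distrib_left ac_simps)

lemma apply_mat_add: "apply_mat d B (\<lambda>x. g x + h x) = (\<lambda>x. apply_mat d B g x + apply_mat d B h x)"
  by (simp add: apply_mat_def distrib_left sum.distrib fun_eq_iff)

lemma apply_mat_scale: "apply_mat d B (\<lambda>x. c * g x) = (\<lambda>x. c * apply_mat d B g x)"
  by (simp add: apply_mat_def sum_distrib_left ac_simps fun_eq_iff)

lemma idot_apply_mat_sym: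
  assumes "\<And>x y. x < d \<Longrightarrow> y < d \<Longrightarrow> B x y = B y x"
  shows "idot d f (apply_mat d B g) = idot d g (apply_mat d B f)"
proof -
  have "idot d f (apply_mat d B g) = (\<Sum>x<d. \<Sum>y<d. f x * B x y * g y)"
    by (simp add: idot_def apply_mat_def sum_distrib_left mult.assoc)
  also have "\<dots> = (\<Sum>y<d. \<Sum>x<d. f x * B x y * g y)" by (rule sum.swap)
  also have "\<dots> = (\<Sum>y<d. \<Sum>x<d. g y * B y x * f x)"
    by (intro sum.cong refl) (simp add: assms)
  also have "\<dots> = idot d g (apply_mat d B f)"
    by (simp add: idot_def apply_mat_def sum_distrib_left mult.assoc)
  finally show ?thesis .
qed

lemma abs_idot_le:
  assumes "\<And>x. x < d \<Longrightarrow> \<bar>f x\<bar> \<le> F" "\<And>x. x < d \<Longrightarrow> \<bar>g x\<bar> \<le> H" "i \<le> d" "0 \<le> F" "0 \<le> H"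
  shows "\<bar>\<Sum>x<i. f x * g x\<bar> \<le> int d * F * H"
proof -
  have "\<bar>\<Sum>x<i. f x * g x\<bar> \<le> (\<Sum>x<i. \<bar>f x * g x\<bar>)" by (rule sum_abs)
  also have "\<dots> \<le> (\<Sum>x<i. F * H)" using assms unfolding abs_mult by (intro sum_mono mult_mono) auto
  also have "\<dots> = int i * (F * H)" by simp
  also have "\<dots> \<le> int d * (F * H)" using assms by (intro mult_right_mono) auto
  finally show ?thesis by (simp add: mult.assoc)
qed

text \<open>Here \<open>apply_mat d B g\<close> is \<open>D\<close> times the direction
  \<open>G\<^sup>-\<^sup>1 g\<close>: the adjugate keeps the direction integral, and
  \<open>D > 0\<close> preserves the sign of every row on it.\<close>

locale lp_adjugate =
  fixes d N L :: nat and a :: "nat \<Rightarrow> nat \<Rightarrow> int" and m :: "nat \<Rightarrow> nat"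
    and B :: "nat \<Rightarrow> nat \<Rightarrow> int" and D :: int
  assumes L: "\<And>q x. q < N \<Longrightarrow> x < d \<Longrightarrow> \<bar>a q x\<bar> \<le> int L"
    and adj: "adjugate d (gram N a m) B D" and D: "D > 0"
begin

lemma B_sym: "x < d \<Longrightarrow> y < d \<Longrightarrow> B x y = B y x"
  using adjugate_sym[OF adj] D gram_sym by auto

lemma gram_apply:
  assumes "x < d"
  shows "(\<Sum>y<d. gram N a m x y * apply_mat d B g y) = D * g x"
proof -
  have "(\<Sum>y<d. gram N a m x y * apply_mat d B g y) = (\<Sum>z<d. \<Sum>y<d. gram N a m x y * B y z * g z)"
    unfolding apply_mat_def by (subst sum.swap) (simp add: sum_distrib_left ac_simps)
  also have "\<dots> = (\<Sum>z<d. if x = z then D * g z else 0)"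
    using assms by (intro sum.cong) (auto simp: adjugate_mult(1)[OF adj] simp flip: sum_distrib_right)
  also have "\<dots> = D * g x" using assms by simp
  finally show ?thesis .
qed

lemma gram_apply_expand:
  assumes "x < d"
  shows "u x + (\<Sum>q<N. (4 ^ m q - 1) * a q x * idot d (a q) u) = (\<Sum>y<d. gram N a m x y * u y)"
  unfolding gram_def sum_delta_mult[OF assms] gram_mult[where a = a] idot_def by simp

lemma apply_mat_eq:
  assumes "x < d"
  shows "D * g x = apply_mat d B g x + (\<Sum>q<N. (4 ^ m q - 1) * a q x * idot d (a q) (apply_mat d B g))"
  using gram_apply_expand[OF assms, of "apply_mat d B g"] gram_apply[OF assms, of g] by simp

text \<open>With \<open>u = apply_mat d B g\<close> one has \<open>D g = G u\<close>, so the left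
  side is the form of \<open>G\<close> at \<open>u\<close>. It splits into the contribution of the
  identity and those of the weighted rows, all nonnegative; the next estimates keep one of
  them.\<close>

lemma form_eq:
  "D * idot d g (apply_mat d B g) = (\<Sum>x<d. (apply_mat d B g x)\<^sup>2) +
    (\<Sum>q<N. (4 ^ m q - 1) * (idot d (a q) (apply_mat d B g))\<^sup>2)"
proof -
  let ?u = "apply_mat d B g"
  have "D * idot d g ?u = (\<Sum>x<d. ?u x * (D * g x))" by (simp add: idot_def sum_distrib_left ac_simps)
  also have "\<dots> = (\<Sum>x<d. ?u x * (?u x + (\<Sum>q<N. (4 ^ m q - 1) * a q x * (\<Sum>z<d. a q z * ?u z))))"
    using apply_mat_eq by (intro sum.cong) (auto simp: idot_def)
  also have "\<dots> = (\<Sum>x<d. (?u x)\<^sup>2) + (\<Sum>x<d. ?u x * (\<Sum>q<N. (4 ^ m q - 1) * a q x * (\<Sum>z<d. a q z * ?u z)))"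
    by (simp add: distrib_left sum.distrib power2_eq_square)
  also have "(\<Sum>x<d. ?u x * (\<Sum>q<N. (4 ^ m q - 1) * a q x * (\<Sum>z<d. a q z * ?u z))) =
      (\<Sum>q<N. (4 ^ m q - 1) * (idot d (a q) ?u)\<^sup>2)"
    unfolding gram_form by (simp add: idot_def power2_eq_square mult.assoc)
  finally show ?thesis .
qed

lemma weight_nonneg: "0 \<le> (4::int) ^ m q - 1"
  by simp

lemma form_nonneg: "0 \<le> idot d g (apply_mat d B g)"
proof -
  have "0 \<le> D * idot d g (apply_mat d B g)"
    unfolding form_eq using weight_nonneg by (intro add_nonneg_nonneg sum_nonneg mult_nonneg_nonneg) auto
  with D show ?thesis by (simp add: zero_le_mult_iff)
qed

lemma sum_squares_le: "(\<Sum>x<d. (apply_mat d B g x)\<^sup>2) \<le> D * idot d g (apply_mat d B g)"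
  unfolding form_eq using weight_nonneg by (simp add: sum_nonneg mult_nonneg_nonneg)

lemma weighted_square_le:
  assumes "q < N"
  shows "(4 ^ m q - 1) * (idot d (a q) (apply_mat d B g))\<^sup>2 \<le> D * idot d g (apply_mat d B g)"
proof -
  have "(4 ^ m q - 1) * (idot d (a q) (apply_mat d B g))\<^sup>2 \<le>
    (\<Sum>q<N. (4 ^ m q - 1) * (idot d (a q) (apply_mat d B g))\<^sup>2)"
    using assms weight_nonneg by (intro member_le_sum) (auto simp: mult_nonneg_nonneg)
  then show ?thesis unfolding form_eq by (simp add: sum_nonneg add_increasing)
qed

text \<open>\<open>G\<close> dominates the identity, so the identity dominates its inverse. In
  integers: the squares in column \<open>y\<close> of \<open>B\<close> sum to at most
  \<open>D * B y y\<close>, whence \<open>B y y \<le> D\<close>. The determinant thus controls the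
  size of the whole adjugate.\<close>

lemma abs_B_le:
  assumes "x < d" "y < d"
  shows "\<bar>B x y\<bar> \<le> D"
proof -
  let ?e = "\<lambda>z. if z = y then 1 else 0"
  have col: "apply_mat d B ?e z = B z y" for z using assms by (simp add: apply_mat_def if_distrib cong: if_cong)
  have "idot d ?e (apply_mat d B ?e) = (\<Sum>z<d. if z = y then B z y else 0)"
    unfolding idot_def by (intro sum.cong) (auto simp: col)
  also have "\<dots> = B y y" using assms by simp
  finally have "idot d ?e (apply_mat d B ?e) = B y y" .
  with form_nonneg[of ?e] sum_squares_le[of ?e] have nn: "0 \<le> B y y" and le: "(\<Sum>z<d. (B z y)\<^sup>2) \<le> D * B y y"
    by (auto simp: col)
  have *: "(B z y)\<^sup>2 \<le> D * B y y" if "z < d" for z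
  proof -
    have "(B z y)\<^sup>2 \<le> (\<Sum>z<d. (B z y)\<^sup>2)" using that by (intro member_le_sum) auto
    with le show ?thesis by simp
  qed
  have "B y y \<le> D"
  proof (rule ccontr)
    assume "\<not> B y y \<le> D"
    then have "D * B y y < B y y * B y y" using D by (intro mult_strict_right_mono) auto
    then show False using *[OF assms(2)] by (simp add: power2_eq_square)
  qed
  then have "D * B y y \<le> D\<^sup>2" using D by (simp add: power2_eq_square)
  with *[OF assms(1)] have "(B x y)\<^sup>2 \<le> D\<^sup>2" by simp
  then show ?thesis using D by (simp add: abs_le_square_iff[symmetric])
qed

lemma sum_squares_row_le:
  assumes "q < N"
  shows "(\<Sum>x<d. (a q x)\<^sup>2) \<le> int d * (int L)\<^sup>2"
proof -
  have "(\<Sum>x<d. (a q x)\<^sup>2) \<le> (\<Sum>x<d. (int L)\<^sup>2)"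
    using L[OF assms] by (intro sum_mono) (auto simp flip: abs_le_square_iff)
  then show ?thesis by simp
qed

text \<open>The factor \<open>4 ^ m q\<close> is split into \<open>4 ^ m q - 1\<close>, handled by
  the weighted rows of the form, and 1, handled by its identity part and Cauchy-Schwarz.\<close>

lemma row_form_le:
  assumes "q < N"
  shows "4 ^ m q * idot d (a q) (apply_mat d B (a q)) \<le> D * (1 + int d * (int L)\<^sup>2)"
proof -
  let ?u = "apply_mat d B (a q)"
  define r where "r = idot d (a q) ?u"
  have r: "0 \<le> r" unfolding r_def by (rule form_nonneg)
  have 1: "(4 ^ m q - 1) * r \<le> D"
  proof (cases "r = 0")
    case False
    have "((4 ^ m q - 1) * r) * r \<le> D * r"
      using weighted_square_le[OF assms, of "a q"] by (simp add: r_def[symmetric] power2_eq_square mult.assoc)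
    with r False show ?thesis by (simp add: mult_le_cancel_right)
  qed (use D in simp)
  have 2: "r \<le> D * (int d * (int L)\<^sup>2)"
  proof (cases "r = 0")
    case False
    have cs: "r\<^sup>2 \<le> (\<Sum>x<d. (a q x)\<^sup>2) * (\<Sum>x<d. (?u x)\<^sup>2)"
    proof -
      have "(\<Sum>x<d. real_of_int (a q x) * real_of_int (?u x))\<^sup>2 \<le>
         (\<Sum>x<d. (real_of_int (a q x))\<^sup>2) * (\<Sum>x<d. (real_of_int (?u x))\<^sup>2)"
        by (rule Cauchy_Schwarz_ineq_sum)
      then have "real_of_int (r\<^sup>2) \<le> real_of_int ((\<Sum>x<d. (a q x)\<^sup>2) * (\<Sum>x<d. (?u x)\<^sup>2))"
        by (simp add: r_def idot_def)
      then show ?thesis by (simp only: of_int_le_iff)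
    qed
    also have "\<dots> \<le> (int d * (int L)\<^sup>2) * (D * r)"
      using sum_squares_row_le[OF assms] sum_squares_le[of "a q"] unfolding r_def
      by (intro mult_mono) (auto intro!: sum_nonneg)
    finally have "r * r \<le> (D * (int d * (int L)\<^sup>2)) * r" by (simp add: power2_eq_square ac_simps)
    with r False show ?thesis by (simp add: mult_le_cancel_right)
  qed (use D in simp)
  have "4 ^ m q * r = (4 ^ m q - 1) * r + r" by (simp add: algebra_simps)
  also have "\<dots> \<le> D + D * (int d * (int L)\<^sup>2)" using 1 2 by (rule add_mono)
  finally show ?thesis by (simp add: r_def algebra_simps)
qed

text \<open>By \<open>row_form_le\<close> the determinant grows by at most
  \<open>3 * D * (1 + d * L\<^sup>2)\<close>; the resulting factor per round is the base of the
  power in \<open>determinant_bound\<close>.\<close>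

lemma update:
  assumes "j < N"
  defines "h \<equiv> apply_mat d B (a j)"
  defines "D' \<equiv> D + 3 * 4 ^ m j * idot d (a j) h"
  shows "lp_adjugate d N L a (m(j := Suc (m j))) (\<lambda>x y. (D' * B x y - 3 * 4 ^ m j * h x * h y) div D) D'"
    and "D' \<le> D * (4 * (1 + int d * (int L)\<^sup>2))"
proof -
  have nn: "0 \<le> idot d (a j) h" unfolding h_def by (rule form_nonneg)
  then have D': "D' > 0" using D by (simp add: D'_def add_pos_nonneg)
  have "adjugate d (\<lambda>x z. gram N a m x z + (3 * 4 ^ m j) * a j x * a j z)
     (\<lambda>x y. (D' * B x y - 3 * 4 ^ m j * h x * h y) div D) D'"
    using adjugate_update[OF adj D gram_sym, of "3 * 4 ^ m j" "a j"] D'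
    by (simp add: h_def apply_mat_def D'_def idot_def)
  then show "lp_adjugate d N L a (m(j := Suc (m j))) (\<lambda>x y. (D' * B x y - 3 * 4 ^ m j * h x * h y) div D) D'"
    unfolding lp_adjugate_def gram_Suc[OF assms(1)] using L D' by simp
  have "D' \<le> D + 3 * (D * (1 + int d * (int L)\<^sup>2))"
    using row_form_le[OF assms(1)] by (simp add: D'_def h_def)
  also have "\<dots> \<le> D * (4 * (1 + int d * (int L)\<^sup>2))" using D by (simp add: algebra_simps)
  finally show "D' \<le> D * (4 * (1 + int d * (int L)\<^sup>2))" .
qed

text \<open>The perceptron argument in the metric of the inverse: the cross term is not positive,
  since inequality \<open>j\<close> is violated at the current direction, and the scaling by
  \<open>2 ^ m j\<close> turns the quadratic term into that of \<open>row_form_le\<close>.\<close>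

lemma step:
  assumes "j < N" "idot d (a j) (apply_mat d B g) \<le> 0"
  defines "g' \<equiv> \<lambda>x. g x + 2 ^ m j * a j x"
  shows "idot d g' (apply_mat d B g') \<le> idot d g (apply_mat d B g) + D * (1 + int d * (int L)\<^sup>2)"
proof -
  have sym: "idot d g (apply_mat d B (a j)) = idot d (a j) (apply_mat d B g)"
    by (rule idot_apply_mat_sym) (rule B_sym)
  have "idot d g' (apply_mat d B g') = idot d g (apply_mat d B g) + 2 * 2 ^ m j * idot d (a j) (apply_mat d B g)
      + (2 ^ m j * 2 ^ m j) * idot d (a j) (apply_mat d B (a j))"
    unfolding g'_def apply_mat_add apply_mat_scale idot_add idot_scale idot_commute[of d "\<lambda>x. g x + _ x"]
      idot_commute[of d _ g] idot_commute[of d _ "a j"] sym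
    by (simp add: algebra_simps)
  also have "(2::int) ^ m j * 2 ^ m j = 4 ^ m j" by (simp flip: power_mult_distrib)
  also have "2 * 2 ^ m j * idot d (a j) (apply_mat d B g) \<le> 0"
    using assms(2) by (simp add: mult_nonneg_nonpos)
  finally show ?thesis using row_form_le[OF assms(1)] by linarith
qed

text \<open>Applied to the scalar product of \<open>G\<close> between \<open>u\<close> and
  \<open>y\<close>, which is \<open>D\<close> times \<open>lin d g y\<close> because
  \<open>D g = G u\<close>. The norm of \<open>u\<close> is controlled by the form of
  \<open>g\<close>, and the squared norm of \<open>y\<close> is at most \<open>d + N\<close>, as
  each scaled row value and each coordinate is at most 1.\<close>

lemma cauchy_schwarz:
  assumes y: "\<And>x. x < d \<Longrightarrow> \<bar>y x\<bar> \<le> 1" "\<And>q. q < N \<Longrightarrow> \<bar>2 ^ m q * lin d (a q) y\<bar> \<le> 1" and "0 < d"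
    and g: "idot d g (apply_mat d B g) \<le> T * D"
  shows "(lin d g y)\<^sup>2 \<le> of_int T * (real d + real N)"
proof -
  define u where "u x = real_of_int (apply_mat d B g x)" for x
  define w where "w q = (4::real) ^ m q - 1" for q
  define A where "A q = lin d (a q) u" for q
  define Y where "Y q = lin d (a q) y" for q
  define P where "P = (\<Sum>x<d. (u x)\<^sup>2) + (\<Sum>q<N. w q * (A q)\<^sup>2)"
  define S where "S = (\<Sum>x<d. u x * y x) + (\<Sum>q<N. w q * A q * Y q)"
  define R where "R = (\<Sum>x<d. (y x)\<^sup>2) + (\<Sum>q<N. w q * (Y q)\<^sup>2)"
  define R' where "R' = real d + real N"
  have A: "A q = of_int (idot d (a q) (apply_mat d B g))" for q
    by (simp add: A_def lin_def idot_def u_def)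
  have w: "0 \<le> w q" "w q = real_of_int (4 ^ m q - 1)" for q by (auto simp: w_def)
  have P: "P = of_int (D * idot d g (apply_mat d B g))"
    unfolding form_eq P_def A u_def w(2) by simp
  have "of_int D * lin d g y = (\<Sum>x<d. y x * of_int (D * g x))"
    by (simp add: lin_def sum_distrib_left ac_simps)
  also have "\<dots> = (\<Sum>x<d. y x * (u x + (\<Sum>q<N. w q * of_int (a q x) * (\<Sum>z<d. of_int (a q z) * u z))))"
  proof (intro sum.cong refl)
    fix x assume "x \<in> {..<d}"
    then have "D * g x = apply_mat d B g x + (\<Sum>q<N. (4 ^ m q - 1) * a q x * idot d (a q) (apply_mat d B g))"
      by (intro apply_mat_eq) auto
    then show "y x * of_int (D * g x) = y x * (u x + (\<Sum>q<N. w q * of_int (a q x) * (\<Sum>z<d. of_int (a q z) * u z)))"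
      by (simp only:) (simp add: u_def w_def idot_def)
  qed
  also have "\<dots> = (\<Sum>x<d. y x * u x) + (\<Sum>x<d. y x * (\<Sum>q<N. w q * of_int (a q x) * (\<Sum>z<d. of_int (a q z) * u z)))"
    by (simp add: distrib_left sum.distrib)
  also have "\<dots> = S"
    unfolding gram_form[where a = "\<lambda>q x. of_int (a q x)"] S_def A_def Y_def lin_def by (simp add: ac_simps)
  finally have S: "of_int D * lin d g y = S" .
  have "R \<le> (\<Sum>x<d. 1) + (\<Sum>q<N. 1)"
    unfolding R_def
  proof (intro add_mono sum_mono)
    fix x assume "x \<in> {..<d}"
    then show "(y x)\<^sup>2 \<le> 1" using y(1) by (simp add: abs_square_le_1)
  next
    fix q assume q: "q \<in> {..<N}"
    have "w q * (Y q)\<^sup>2 \<le> 4 ^ m q * (Y q)\<^sup>2" by (intro mult_right_mono) (auto simp: w_def)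
    also have "\<dots> = (2 ^ m q * Y q)\<^sup>2"
      by (simp add: power_mult_distrib power2_eq_square flip: power_mult_distrib[of 2 2])
    also have "\<dots> \<le> 1" using y(2)[of q] q by (simp add: Y_def abs_square_le_1)
    finally show "w q * (Y q)\<^sup>2 \<le> 1" .
  qed
  then have R: "R \<le> R'" by (simp add: R'_def)
  have R'0: "R' > 0" using \<open>0 < d\<close> by (simp add: R'_def)
  have quad: "0 \<le> P - 2 * t * S + t\<^sup>2 * R" for t
  proof -
    have "0 \<le> (\<Sum>x<d. (u x - t * y x)\<^sup>2) + (\<Sum>q<N. w q * (A q - t * Y q)\<^sup>2)"
      using w(1) by (intro add_nonneg_nonneg sum_nonneg mult_nonneg_nonneg) auto
    also have "(\<Sum>x<d. (u x - t * y x)\<^sup>2) = (\<Sum>x<d. (u x)\<^sup>2) - 2 * t * (\<Sum>x<d. u x * y x) + t\<^sup>2 * (\<Sum>x<d. (y x)\<^sup>2)"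
      by (simp add: power2_diff power_mult_distrib sum.distrib sum_subtractf sum_distrib_left ac_simps)
    also have "(\<Sum>q<N. w q * (A q - t * Y q)\<^sup>2) = (\<Sum>q<N. w q * (A q)\<^sup>2) - 2 * t * (\<Sum>q<N. w q * A q * Y q) + t\<^sup>2 * (\<Sum>q<N. w q * (Y q)\<^sup>2)"
      by (simp add: power2_diff power_mult_distrib sum.distrib sum_subtractf sum_distrib_left ring_distribs right_diff_distrib ac_simps)
    finally show ?thesis by (simp add: P_def S_def R_def algebra_simps)
  qed
  \<comment> \<open>The minimiser of the quadratic would be \<open>S / R\<close>; the upper bound
    \<open>R'\<close> replaces \<open>R\<close> because it is known to be positive.\<close>
  have "0 \<le> P - 2 * (S / R') * S + (S / R')\<^sup>2 * R" by (rule quad)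
  also have "(S / R')\<^sup>2 * R \<le> (S / R')\<^sup>2 * R'" using R by (intro mult_left_mono) auto
  also have "P - 2 * (S / R') * S + (S / R')\<^sup>2 * R' = P - S\<^sup>2 / R'"
    using R'0 by (simp add: power2_eq_square field_simps)
  finally have "S\<^sup>2 \<le> P * R'" using R'0 by (simp add: field_simps)
  also have "P \<le> of_int (D * (T * D))" unfolding P of_int_le_iff using g D by (intro mult_left_mono) auto
  finally have "S\<^sup>2 \<le> of_int (D * (T * D)) * R'" using R'0 by simp
  then have "(of_int D)\<^sup>2 * (lin d g y)\<^sup>2 \<le> (of_int D)\<^sup>2 * (of_int T * R')"
    unfolding S[symmetric] power_mult_distrib by (simp add: power2_eq_square ac_simps)
  then show ?thesis using D by (simp add: R'_def mult_le_cancel_left)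
qed

end

text \<open>The invariant of the rescaling. It speaks about all normalised solutions and is vacuous
  if there is none, so the algorithm may maintain it before solvability is known.\<close>

definition scaled_bound :: "nat \<Rightarrow> nat \<Rightarrow> (nat \<Rightarrow> nat \<Rightarrow> int) \<Rightarrow> (nat \<Rightarrow> nat) \<Rightarrow> bool" where
  "scaled_bound d N a m \<longleftrightarrow> (\<forall>y. (\<forall>x<d. \<bar>y x\<bar> \<le> 1) \<and> (\<forall>q<N. 0 < lin d (a q) y \<and> lin d (a q) y \<le> 1) \<longrightarrow>
     (\<forall>q<N. 2 ^ m q * lin d (a q) y \<le> 1))"

definition weighted_sum :: "nat \<Rightarrow> (nat \<Rightarrow> nat \<Rightarrow> int) \<Rightarrow> (nat \<Rightarrow> nat) \<Rightarrow> (nat \<Rightarrow> int) \<Rightarrow> nat \<Rightarrow> int" where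
  "weighted_sum N a m c x = (\<Sum>q<N. c q * 2 ^ m q * a q x)"

text \<open>With \<open>E = 1 + d * L\<^sup>2\<close> and \<open>T\<close> for this number,
  averaging over the counters and Cauchy-Schwarz give
  \<open>(T z)\<^sup>2 \<le> N\<^sup>2 T E (d + N)\<close> for the scaled slack \<open>z\<close> of
  the chosen row. The formula is chosen so that this means
  \<open>4 z\<^sup>2 \<le> 1\<close>.\<close>

definition steps :: "nat \<Rightarrow> nat \<Rightarrow> nat \<Rightarrow> nat" where
  "steps d N L = 4 * N * N * (d + N) * (1 + d * L * L)"

text \<open>By the inequality of Cauchy and Schwarz, the most frequently used constraint has at most half
  of the slack allowed so far in every normalised solution.\<close>

lemma (in lp_adjugate) scaled_bound_Suc:
  assumes sb: "scaled_bound d N a m" and pos: "0 < d" "0 < N"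
    and c: "\<And>q. q < N \<Longrightarrow> 0 \<le> c q" "(\<Sum>q<N. c q) = int (steps d N L)"
    and form: "idot d (weighted_sum N a m c) (apply_mat d B (weighted_sum N a m c)) \<le>
      int (steps d N L) * (1 + int d * (int L)\<^sup>2) * D"
    and j: "j < N" "\<And>q. q < N \<Longrightarrow> c q \<le> c j"
  shows "scaled_bound d N a (m(j := Suc (m j)))"
  unfolding scaled_bound_def
proof (intro allI impI)
  fix y q assume y: "(\<forall>x<d. \<bar>y x\<bar> \<le> 1) \<and> (\<forall>q<N. 0 < lin d (a q) y \<and> lin d (a q) y \<le> 1)" and q: "q < N"
  define T where "T = real (steps d N L)"
  define E where "E = 1 + real d * (real L)\<^sup>2"
  define z where "z = 2 ^ m j * lin d (a j) y"
  let ?g = "weighted_sum N a m c"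
  have le1: "2 ^ m q * lin d (a q) y \<le> 1" if "q < N" for q using sb y that unfolding scaled_bound_def by blast
  have nn: "0 \<le> 2 ^ m q * lin d (a q) y" if "q < N" for q using y that by (simp add: less_imp_le)
  have E: "0 < E" by (simp add: E_def add_pos_nonneg)
  have T: "T = 4 * (real N)\<^sup>2 * (real d + real N) * E"
    by (simp only: T_def steps_def E_def power2_eq_square of_nat_mult of_nat_add of_nat_1 of_nat_numeral mult.assoc)
  have T0: "T > 0" unfolding T using pos E by simp
  have "(lin d ?g y)\<^sup>2 \<le> of_int (int (steps d N L) * (1 + int d * (int L)\<^sup>2)) * (real d + real N)"
    by (rule cauchy_schwarz) (use y le1 nn form pos in auto)
  then have cs: "(lin d ?g y)\<^sup>2 \<le> T * E * (real d + real N)" by (simp add: T_def E_def)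
  have lin_g: "lin d ?g y = (\<Sum>q<N. of_int (c q) * (2 ^ m q * lin d (a q) y))"
  proof -
    have "lin d ?g y = (\<Sum>x<d. \<Sum>q<N. of_int (c q) * (2 ^ m q * (of_int (a q x) * y x)))"
      by (simp add: lin_def weighted_sum_def sum_distrib_right mult.assoc)
    then show ?thesis by (subst (asm) sum.swap) (simp add: lin_def sum_distrib_left)
  qed
  \<comment> \<open>At a solution all terms of \<open>lin d ?g y\<close> are nonnegative, so the
    term of \<open>j\<close> alone is a lower bound.\<close>
  have cj: "of_int (c j) * z \<le> lin d ?g y"
    unfolding lin_g z_def using j(1) c(1) nn
    by (intro member_le_sum[where f = "\<lambda>q. of_int (c q) * (2 ^ m q * lin d (a q) y)"] mult_nonneg_nonneg[OF _ nn]) auto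
  \<comment> \<open>The largest counter is at least the average.\<close>
  have "int (steps d N L) \<le> (\<Sum>q<N. c j)" unfolding c(2)[symmetric] using j(2) by (intro sum_mono) auto
  then have "int (steps d N L) \<le> int N * c j" by simp
  then have "real_of_int (int (steps d N L)) \<le> of_int (int N * c j)" by (simp only: of_int_le_iff)
  then have "T \<le> real N * of_int (c j)" by (simp add: T_def)
  moreover have z0: "0 \<le> z" unfolding z_def by (rule nn[OF j(1)])
  ultimately have "T * z \<le> real N * of_int (c j) * z" by (intro mult_right_mono)
  also have "\<dots> \<le> real N * lin d ?g y" using cj by (simp add: mult.assoc mult_left_mono)
  finally have "(T * z)\<^sup>2 \<le> (real N * lin d ?g y)\<^sup>2" using T0 z0 by (intro power_mono) auto
  also have "\<dots> \<le> (real N)\<^sup>2 * (T * E * (real d + real N))" using cs by (simp add: power_mult_distrib mult_left_mono)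
  finally have "T * (T * z\<^sup>2) \<le> T * ((real N)\<^sup>2 * E * (real d + real N))"
    by (simp add: power2_eq_square ac_simps)
  then have "T * z\<^sup>2 \<le> (real N)\<^sup>2 * E * (real d + real N)" using T0 by (simp add: mult_le_cancel_left)
  then have "((real N)\<^sup>2 * E * (real d + real N)) * (4 * z\<^sup>2) \<le> ((real N)\<^sup>2 * E * (real d + real N)) * 1"
    unfolding T by (simp add: ac_simps)
  then have "4 * z\<^sup>2 \<le> 1" using E pos by (subst (asm) mult_le_cancel_left_pos) auto
  then have "(2 * z)\<^sup>2 \<le> 1" by (simp add: power_mult_distrib)
  then have "\<bar>2 * z\<bar> \<le> 1" by (simp only: abs_square_le_1)
  then have "2 * z \<le> 1" by simp
  then show "2 ^ (m(j := Suc (m j))) q * lin d (a q) y \<le> 1" using le1[OF q] by (simp add: z_def mult.assoc)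
qed

text \<open>Pigeonhole: after \<open>N * l + 1\<close> increments some exponent exceeds
  \<open>l\<close>, where \<open>2 ^ - l\<close> is the slack guaranteed by
  \<open>small_solution\<close>.\<close>

definition rounds :: "nat \<Rightarrow> nat \<Rightarrow> nat \<Rightarrow> nat" where
  "rounds d N L = N * (width d N L * (d + 2)) + 1"

lemma infeasible_if_scaled_bound:
  assumes sb: "scaled_bound d N a m" and m: "(\<Sum>q<N. m q) = rounds d N L"
    and L: "\<And>q x. q < N \<Longrightarrow> x < d \<Longrightarrow> \<bar>a q x\<bar> \<le> int L" and pos: "0 < N" "0 < L" "0 < d"
  shows "\<not> (\<forall>q<N. lin d (a q) y > 0)"
proof
  define l where "l = width d N L * (d + 2)"
  assume "\<forall>q<N. lin d (a q) y > 0"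
  from small_solution[OF this L pos] obtain z where
    z: "\<forall>x<d. \<bar>z x\<bar> \<le> 1" "\<forall>q<N. 1 / 2 ^ l \<le> lin d (a q) z \<and> lin d (a q) z \<le> 1"
    by (auto simp: l_def)
  have zpos: "0 < lin d (a q) z" if "q < N" for q
  proof -
    have "(0::real) < 1 / 2 ^ l" by simp
    also have "\<dots> \<le> lin d (a q) z" using z(2) that by blast
    finally show ?thesis .
  qed
  then have le1: "2 ^ m q * lin d (a q) z \<le> 1" if "q < N" for q
    using sb z that unfolding scaled_bound_def by blast
  have "\<exists>q<N. l < m q"
  proof (rule ccontr)
    assume "\<not> (\<exists>q<N. l < m q)"
    then have "(\<Sum>q<N. m q) \<le> (\<Sum>q<N. l)" by (intro sum_mono) (meson lessThan_iff not_less)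
    then show False using m by (simp add: rounds_def l_def)
  qed
  then obtain q where q: "q < N" "l < m q" by blast
  have "(2::real) ^ l * (1 / 2 ^ l) < 2 ^ m q * (1 / 2 ^ l)" using q by (intro mult_strict_right_mono) auto
  also have "\<dots> \<le> 2 ^ m q * lin d (a q) z" using z(2) q by (intro mult_left_mono) auto
  also have "\<dots> \<le> 1" using q by (intro le1)
  finally show False by simp
qed

section \<open>Identities and separation of exponent vectors\<close>

lemma trop_sum_ge:
  fixes f :: "'i \<Rightarrow> trop"
  assumes "finite S" "x \<in> S" "f x = Fin c"
  shows "\<exists>c'\<ge>c. sum f S = Fin c'"
proof -
  have "sum f S = f x + sum f (S - {x})" using assms by (intro sum.remove)
  then show ?thesis using assms(3) by (cases "sum f (S - {x})") auto
qed

lemma trop_sum_attained: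
  fixes f :: "'i \<Rightarrow> trop"
  assumes "finite S" "sum f S = Fin c"
  shows "\<exists>x\<in>S. f x = Fin c"
  using assms
proof (induction S arbitrary: c rule: finite_induct)
  case (insert x F)
  show ?case
  proof (cases "f x")
    case (Fin a)
    then show ?thesis using insert by (cases "sum f F") (auto simp: max_def split: if_splits)
  qed (use insert in auto)
qed (auto simp: zero_trop_def)

lemma times_trop_Fin: "a * b = Fin c \<longleftrightarrow> (\<exists>x y. a = Fin x \<and> b = Fin y \<and> c = x + y)"
  by (cases a; cases b) auto

primrec mprod :: "nat \<Rightarrow> ('a \<Rightarrow> trop mat) \<Rightarrow> 'a list \<Rightarrow> trop mat" where
  "mprod n A [] = 1\<^sub>m n"
| "mprod n A (s # w) = A s * mprod n A w"

lemma mprod_carrier: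
  "(\<And>s. s \<in> set w \<Longrightarrow> A s \<in> carrier_mat n n) \<Longrightarrow> mprod n A w \<in> carrier_mat n n"
  by (induction w) (auto intro!: mult_carrier_mat)

lemma mprod_append:
  "(\<And>s. s \<in> set (u @ w) \<Longrightarrow> A s \<in> carrier_mat n n) \<Longrightarrow> mprod n A (u @ w) = mprod n A u * mprod n A w"
proof (induction u)
  case Nil
  then show ?case using mprod_carrier[of w A n] by auto
next
  case (Cons s u)
  then show ?case
    using mprod_carrier[of w A n] mprod_carrier[of u A n]
    by (auto intro!: assoc_mult_mat[symmetric, of _ n n _ n _ n])
qed

lemma mprod_Cons_entry:
  assumes "A s \<in> carrier_mat n n" "mprod n A w \<in> carrier_mat n n" "i < n" "j < n"
  shows "mprod n A (s # w) $$ (i, j) = (\<Sum>k<n. A s $$ (i, k) * mprod n A w $$ (k, j))"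
  using assms by (simp add: scalar_prod_def lessThan_atLeast0)

text \<open>One half of the description of an entry as a maximum over paths. No monotonicity is
  asked of the path: finite weights along it suffice.\<close>

lemma mprod_ge_path:
  fixes w :: "'a list"
  assumes "\<And>s. s \<in> set w \<Longrightarrow> A s \<in> carrier_mat n n" "\<And>t. t \<le> length w \<Longrightarrow> \<pi> t < n"
    and "\<And>t. t < length w \<Longrightarrow> A (w ! t) $$ (\<pi> t, \<pi> (Suc t)) = Fin (r t)"
  shows "\<exists>c\<ge>(\<Sum>t<length w. r t). mprod n A w $$ (\<pi> 0, \<pi> (length w)) = Fin c"
  using assms
proof (induction w arbitrary: \<pi> r)
  case Nil
  then show ?case by (auto simp: one_trop_def)
next
  case (Cons s w)
  have "\<exists>c\<ge>(\<Sum>t<length w. r (Suc t)). mprod n A w $$ (\<pi> (Suc 0), \<pi> (Suc (length w))) = Fin c"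
    using Cons.prems(3)[of "Suc _"] Cons.prems(1,2) by (intro Cons.IH) auto
  then obtain c where c: "c \<ge> (\<Sum>t<length w. r (Suc t))" "mprod n A w $$ (\<pi> (Suc 0), \<pi> (Suc (length w))) = Fin c"
    by blast
  have lt: "\<pi> 0 < n" "\<pi> (Suc 0) < n" "\<pi> (Suc (length w)) < n" using Cons.prems(2) by auto
  have "A s $$ (\<pi> 0, \<pi> (Suc 0)) = Fin (r 0)" using Cons.prems(3)[of 0] by simp
  then have "A s $$ (\<pi> 0, \<pi> (Suc 0)) * mprod n A w $$ (\<pi> (Suc 0), \<pi> (Suc (length w))) = Fin (r 0 + c)"
    using c by simp
  then have "\<exists>c'\<ge>r 0 + c. (\<Sum>k<n. A s $$ (\<pi> 0, k) * mprod n A w $$ (k, \<pi> (Suc (length w)))) = Fin c'"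
    using lt by (intro trop_sum_ge) auto
  then have "\<exists>c'\<ge>r 0 + c. mprod n A (s # w) $$ (\<pi> 0, \<pi> (Suc (length w))) = Fin c'"
    using Cons.prems(1) lt mprod_carrier[of w A n] by (subst mprod_Cons_entry) auto
  moreover have "(\<Sum>t<length (s # w). r t) = r 0 + (\<Sum>t<length w. r (Suc t))"
    by (simp add: sum.lessThan_Suc_shift del: sum.lessThan_Suc)
  ultimately show ?case using c(1) by (auto intro: order_trans)
qed

text \<open>The other half: a finite tropical sum is a maximum and hence attained, so a path can be
  read off letter by letter. It is monotone since finite entries lie on or above the
  diagonal.\<close>

lemma mprod_attained:
  fixes w :: "'a list"
  assumes "\<And>s. s \<in> set w \<Longrightarrow> A s \<in> UT_trop n" "i < n" "j < n" "mprod n A w $$ (i, j) = Fin c"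
  shows "\<exists>\<pi> r. \<pi> 0 = i \<and> \<pi> (length w) = j \<and> (\<forall>t\<le>length w. \<pi> t < n) \<and>
    (\<forall>t<length w. \<pi> t \<le> \<pi> (Suc t) \<and> A (w ! t) $$ (\<pi> t, \<pi> (Suc t)) = Fin (r t)) \<and> (\<Sum>t<length w. r t) = c"
  using assms
proof (induction w arbitrary: i c)
  case Nil
  then have "i = j" "c = 0" by (auto simp: one_trop_def zero_trop_def split: if_splits)
  with Nil show ?case by (intro exI[of _ "\<lambda>_. i"]) auto
next
  case (Cons s w)
  have carrier: "A s \<in> carrier_mat n n" "mprod n A w \<in> carrier_mat n n"
    using Cons.prems(1) mprod_carrier[of w A n] by (auto simp: UT_trop_def)
  from Cons.prems(4) have "(\<Sum>k<n. A s $$ (i, k) * mprod n A w $$ (k, j)) = Fin c"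
    unfolding mprod_Cons_entry[OF carrier Cons.prems(2,3)] .
  then obtain k where k: "k < n" "A s $$ (i, k) * mprod n A w $$ (k, j) = Fin c"
    using trop_sum_attained[of "{..<n}"] by auto
  then obtain a b where ab: "A s $$ (i, k) = Fin a" "mprod n A w $$ (k, j) = Fin b" "c = a + b"
    by (auto simp: times_trop_Fin)
  from Cons.IH[OF _ k(1) Cons.prems(3) ab(2)] Cons.prems(1) obtain \<pi> r where
    IH: "\<pi> 0 = k" "\<pi> (length w) = j" "\<forall>t\<le>length w. \<pi> t < n"
      "\<forall>t<length w. \<pi> t \<le> \<pi> (Suc t) \<and> A (w ! t) $$ (\<pi> t, \<pi> (Suc t)) = Fin (r t)" "(\<Sum>t<length w. r t) = b"
    by auto
  have "i \<le> k"
  proof (rule ccontr)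
    assume "\<not> i \<le> k"
    then have "A s $$ (i, k) = 0" using Cons.prems(1)[of s] Cons.prems(2) by (auto simp: UT_trop_def upper_triangular_def)
    with ab show False by (simp add: zero_trop_def)
  qed
  then have "\<forall>t<length (s # w). case_nat i \<pi> t \<le> case_nat i \<pi> (Suc t) \<and>
      A ((s # w) ! t) $$ (case_nat i \<pi> t, case_nat i \<pi> (Suc t)) = Fin (case_nat a r t)"
    using IH ab by (auto split: nat.split)
  moreover have "\<forall>t\<le>length (s # w). case_nat i \<pi> t < n" using IH Cons.prems(2) by (auto split: nat.split)
  moreover have "(\<Sum>t<length (s # w). case_nat a r t) = c"
    using IH ab by (simp add: sum.lessThan_Suc_shift del: sum.lessThan_Suc)
  ultimately show ?case using IH by (intro exI[of _ "case_nat i \<pi>"] exI[of _ "case_nat a r"]) auto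
qed

subsection \<open>Monotone paths and their codes\<close>

definition digit :: "nat \<Rightarrow> nat \<Rightarrow> nat \<Rightarrow> nat" where
  "digit b c m = c div b ^ m mod b"

text \<open>The digits of a code are the times at which the path moves up by one state; a digit that
  exceeds the length of the path stands for no move.\<close>

definition code_path :: "nat \<Rightarrow> nat \<Rightarrow> nat \<Rightarrow> nat \<Rightarrow> nat" where
  "code_path n' l c t = (\<Sum>m<n'. if digit (l + 2) c m \<le> t then 1 else 0)"

lemma code_path_le: "code_path n' l c t \<le> n'"
proof -
  have "code_path n' l c t \<le> (\<Sum>m<n'. 1)" unfolding code_path_def by (intro sum_mono) auto
  then show ?thesis by simp
qed

lemma code_path_mono: "t \<le> t' \<Longrightarrow> code_path n' l c t \<le> code_path n' l c t'"
  unfolding code_path_def by (intro sum_mono) auto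

lemma ex_digits:
  assumes "\<And>m. m < n' \<Longrightarrow> D m < b"
  shows "\<exists>c < b ^ n'. \<forall>m<n'. digit b c m = D m"
  using assms
proof (induction n' arbitrary: D)
  case (Suc n')
  from Suc.IH[of "\<lambda>m. D (Suc m)"] Suc.prems obtain c where c: "c < b ^ n'" "\<forall>m<n'. digit b c m = D (Suc m)" by auto
  have D0: "D 0 < b" using Suc.prems by auto
  have "c * b + D 0 < (c + 1) * b" using D0 by simp
  also have "\<dots> \<le> b ^ n' * b" using c(1) by (intro mult_right_mono) auto
  finally have "c * b + D 0 < b ^ Suc n'" by (simp add: mult.commute)
  moreover have "digit b (c * b + D 0) m = D m" if "m < Suc n'" for m
  proof (cases m)
    case 0
    then show ?thesis using D0 by (simp add: digit_def)
  next
    case (Suc m')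
    have "(c * b + D 0) div b ^ Suc m' = (c * b + D 0) div b div b ^ m'" by (simp add: div_mult2_eq)
    also have "(c * b + D 0) div b = c" using D0 by simp
    finally show ?thesis using c(2) that Suc by (simp add: digit_def)
  qed
  ultimately show ?case by blast
qed simp

text \<open>Digit \<open>m\<close> is the first time at which the state exceeds \<open>m\<close>. It
  is 0 for \<open>m\<close> below the initial state, and equal digits encode a jump over several
  states. Codes are not unique, as the order of the digits is immaterial.\<close>

lemma ex_path:
  assumes "\<And>t. t \<le> l \<Longrightarrow> \<pi> t \<le> n'" "\<And>t. t < l \<Longrightarrow> \<pi> t \<le> \<pi> (Suc t)"
  shows "\<exists>c < (l + 2) ^ n'. \<forall>t\<le>l. code_path n' l c t = \<pi> t"
proof -
  have mono: "\<pi> t \<le> \<pi> t'" if "t \<le> t'" "t' \<le> l" for t t'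
    using that
  proof (induction t' rule: dec_induct)
    case (step t')
    then show ?case using assms(2)[of t'] by simp
  qed simp
  define D where "D m = (if \<exists>t\<le>l. m < \<pi> t then (LEAST t. t \<le> l \<and> m < \<pi> t) else l + 1)" for m
  have D: "D m \<le> t \<longleftrightarrow> m < \<pi> t" if t: "t \<le> l" for m t
  proof (cases "\<exists>t\<le>l. m < \<pi> t")
    case True
    then have *: "D m \<le> l \<and> m < \<pi> (D m)" unfolding D_def using LeastI_ex[of "\<lambda>t. t \<le> l \<and> m < \<pi> t"] by auto
    show ?thesis
    proof
      assume "D m \<le> t"
      then show "m < \<pi> t" using mono[of "D m" t] * t by simp
    next
      assume "m < \<pi> t"
      then show "D m \<le> t" using True t unfolding D_def by (auto intro: Least_le)
    qed
  next
    case False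
    then show ?thesis using t by (auto simp: D_def)
  qed
  have Dlt: "D m < l + 2" for m
  proof (cases "\<exists>t\<le>l. m < \<pi> t")
    case True
    then show ?thesis using D by (meson le_less_trans le_trans less_add_same_cancel1 zero_less_numeral)
  next
    case False
    then show ?thesis by (auto simp: D_def)
  qed
  from ex_digits[of n' D "l + 2"] Dlt obtain c where c: "c < (l + 2) ^ n'" "\<forall>m<n'. digit (l + 2) c m = D m" by blast
  have "code_path n' l c t = \<pi> t" if t: "t \<le> l" for t
  proof -
    have "code_path n' l c t = (\<Sum>m<n'. if m < \<pi> t then 1 else 0)"
      unfolding code_path_def using c(2) D[OF t] by (intro sum.cong) auto
    also have "\<dots> = card {m \<in> {..<n'}. m < \<pi> t}" by (simp add: sum.If_cases Int_def)
    also have "{m \<in> {..<n'}. m < \<pi> t} = {..<\<pi> t}" using assms(1)[OF t] by auto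
    finally show ?thesis by simp
  qed
  with c(1) show ?thesis by blast
qed

subsection \<open>Exponent vectors\<close>

text \<open>The exponent of the variable for entry \<open>(i, j)\<close> of the matrix of the letter \<open>s\<close> has index
  \<open>(s n + i) n + j\<close>; the last \<open>2 n\<close> coordinates mark the first and the last state of the path.\<close>

definition expvec :: "nat \<Rightarrow> nat \<Rightarrow> nat list \<Rightarrow> (nat \<Rightarrow> nat) \<Rightarrow> nat \<Rightarrow> int" where
  "expvec k n w \<pi> x = (\<Sum>t<length w. if x = (w ! t * n + \<pi> t) * n + \<pi> (Suc t) then 1 else 0) +
     (if x = k * n * n + \<pi> 0 then 1 else 0) + (if x = k * n * n + n + \<pi> (length w) then 1 else 0)"

definition nvars :: "nat \<Rightarrow> nat \<Rightarrow> nat" where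
  "nvars k n = k * n * n + n + n"

lemma entry_index_less:
  assumes "s < k" "i < n" "j < n"
  shows "(s * n + i) * n + j < k * n * (n :: nat)"
proof -
  have "(s + 1) * n \<le> k * n" using assms by (intro mult_right_mono) auto
  then have "s * n + i < k * n" using assms by simp
  then have "(s * n + i + 1) * n \<le> k * n * n" by (intro mult_right_mono) auto
  then show ?thesis using assms by simp
qed

lemma lin_expvec:
  assumes "set w \<subseteq> {..<k}" "\<And>t. t \<le> length w \<Longrightarrow> \<pi> t < n"
  shows "lin (nvars k n) (expvec k n w \<pi>) y =
    (\<Sum>t<length w. y ((w ! t * n + \<pi> t) * n + \<pi> (Suc t))) + y (k * n * n + \<pi> 0) + y (k * n * n + n + \<pi> (length w))"
proof -
  let ?d = "nvars k n" and ?i = "\<lambda>t. (w ! t * n + \<pi> t) * n + \<pi> (Suc t)"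
  have idx: "?i t < ?d" if "t < length w" for t
  proof -
    have "w ! t < k" using assms(1) nth_mem[OF that] by auto
    then have "?i t < k * n * n" using assms(2) that by (intro entry_index_less) auto
    then show ?thesis by (simp add: nvars_def)
  qed
  have s: "k * n * n + \<pi> 0 < ?d" "k * n * n + n + \<pi> (length w) < ?d"
    using assms(2)[of 0] assms(2)[of "length w"] by (auto simp: nvars_def)
  have delta: "(\<Sum>x<?d. (if x = j then 1 else 0) * y x) = y j" if "j < ?d" for j
  proof -
    have "(\<Sum>x<?d. (if x = j then 1 else 0) * y x) = (\<Sum>x<?d. if x = j then y x else 0)"
      by (intro sum.cong) auto
    then show ?thesis using that by simp
  qed
  have "lin ?d (expvec k n w \<pi>) y = (\<Sum>x<?d. (\<Sum>t<length w. (if x = ?i t then 1 else 0) * y x)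
      + (if x = k * n * n + \<pi> 0 then 1 else 0) * y x + (if x = k * n * n + n + \<pi> (length w) then 1 else 0) * y x)"
    unfolding lin_def expvec_def by (intro sum.cong) (auto simp: distrib_right sum_distrib_right of_int_sum intro!: sum.cong)
  also have "\<dots> = (\<Sum>t<length w. y (?i t)) + y (k * n * n + \<pi> 0) + y (k * n * n + n + \<pi> (length w))"
    unfolding sum.distrib delta[OF s(1)] delta[OF s(2)]
    by (subst sum.swap) (use idx delta in auto)
  finally show ?thesis .
qed

text \<open>The word \<open>v\<close> has a monomial that exceeds, at some point, all monomials of the word \<open>w\<close>.\<close>

definition separated :: "nat \<Rightarrow> nat \<Rightarrow> nat list \<Rightarrow> nat list \<Rightarrow> bool" where
  "separated k n' v w \<longleftrightarrow> (\<exists>c < (length v + 2) ^ n'. \<exists>y. \<forall>c' < (length w + 2) ^ n'.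
     lin (nvars k (Suc n')) (\<lambda>x. expvec k (Suc n') v (code_path n' (length v) c) x -
       expvec k (Suc n') w (code_path n' (length w) c') x) y > 0)"

section \<open>Translation between identities and separation\<close>

lemma lin_diff: "lin d (\<lambda>x. f x - g x) y = lin d f y - lin d g y"
  by (simp add: lin_def sum_subtractf algebra_simps)

lemma separated_if_exceeds:
  assumes vw: "set v \<subseteq> {..<k}" "set w \<subseteq> {..<k}" and A: "\<And>s. s < k \<Longrightarrow> A s \<in> UT_trop (Suc n')"
    and ij: "i < Suc n'" "j < Suc n'" and v: "mprod (Suc n') A v $$ (i, j) = Fin a"
    and w: "\<And>b. mprod (Suc n') A w $$ (i, j) = Fin b \<Longrightarrow> b < a"
  shows "separated k n' v w"
proof -
  let ?n = "Suc n'"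
  from mprod_attained[of v A ?n i j a] vw(1) A ij v obtain \<pi> r where
    \<pi>: "\<pi> 0 = i" "\<pi> (length v) = j" "\<forall>t\<le>length v. \<pi> t < ?n"
      "\<forall>t<length v. \<pi> t \<le> \<pi> (Suc t) \<and> A (v ! t) $$ (\<pi> t, \<pi> (Suc t)) = Fin (r t)" "(\<Sum>t<length v. r t) = a"
    by auto
  from ex_path[of "length v" \<pi> n'] \<pi> obtain c where c: "c < (length v + 2) ^ n'" "\<forall>t\<le>length v. code_path n' (length v) c t = \<pi> t"
    by (auto simp: less_Suc_eq_le)
  define ent where "ent x = A (x div ?n div ?n) $$ (x div ?n mod ?n, x mod ?n)" for x
  \<comment> \<open>The coordinates to be penalised: entries equal to minus infinity, and end marks
    other than those of \<open>i\<close> and \<open>j\<close>. The path of \<open>v\<close> uses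
    none of them.\<close>
  define bad where "bad x = (if x < k * ?n * ?n then ent x = NegInf else x \<noteq> k * ?n * ?n + i \<and> x \<noteq> k * ?n * ?n + ?n + j)" for x
  define f where "f x = (if x < k * ?n * ?n then case ent x of NegInf \<Rightarrow> 0 | Fin a \<Rightarrow> a else 0)" for x
  have ent: "ent ((s * ?n + p) * ?n + q) = A s $$ (p, q)" if "p < ?n" "q < ?n" for s p q
  proof -
    have "((s * ?n + p) * ?n + q) div ?n = s * ?n + p" using that by (simp only: div_mult_self3 div_less)
    moreover have "((s * ?n + p) * ?n + q) mod ?n = q" using that by (simp only: mod_mult_self3 mod_less)
    moreover have "(s * ?n + p) div ?n = s" using that by (simp only: div_mult_self3 div_less)
    moreover have "(s * ?n + p) mod ?n = p" using that by (simp only: mod_mult_self3 mod_less)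
    ultimately show ?thesis by (simp only: ent_def)
  qed
  define F where "F c' = lin (nvars k ?n) (expvec k ?n w (code_path n' (length w) c')) f" for c'
  \<comment> \<open>\<open>K\<close> exceeds the unpenalised value of every form of \<open>w\<close>
    by more than \<open>\<bar>a\<bar>\<close>, so a single bad coordinate pushes the form below
    \<open>a\<close>.\<close>
  define K where "K = 1 + \<bar>a\<bar> + (\<Sum>c'<(length w + 2) ^ n'. \<bar>F c'\<bar>)"
  have K: "F c' - K < a" if "c' < (length w + 2) ^ n'" for c'
  proof -
    have "\<bar>F c'\<bar> \<le> (\<Sum>c'<(length w + 2) ^ n'. \<bar>F c'\<bar>)" using that by (intro member_le_sum) auto
    then show ?thesis by (simp add: K_def)
  qed
  have K0: "K \<ge> 0" by (simp add: K_def add_nonneg_nonneg sum_nonneg)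
  define y where "y x = f x - K * (if bad x then 1 else 0)" for x
  have idx: "(u ! t * ?n + p) * ?n + q < k * ?n * ?n" if "set u \<subseteq> {..<k}" "t < length u" "p < ?n" "q < ?n" for u t p q
    using that(1) nth_mem[OF that(2)] that(3,4) by (intro entry_index_less) auto
  have lin_v: "lin (nvars k ?n) (expvec k ?n v (code_path n' (length v) c)) y = a"
  proof -
    have "y ((v ! t * ?n + \<pi> t) * ?n + \<pi> (Suc t)) = r t" if "t < length v" for t
    proof -
      have lt: "\<pi> t < ?n" "\<pi> (Suc t) < ?n" using \<pi>(3) that by auto
      show ?thesis
        using idx[OF vw(1) that lt] ent[OF lt, of "v ! t"] \<pi>(4) that
        by (simp add: y_def f_def bad_def del: mult_Suc_right)
    qed
    moreover have "y (k * ?n * ?n + i) = 0" "y (k * ?n * ?n + ?n + j) = 0" by (simp_all add: y_def f_def bad_def del: mult_Suc_right)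
    ultimately show ?thesis
      using \<pi> c(2) by (subst lin_expvec[OF vw(1)]) (simp_all del: mult_Suc_right add: code_path_le less_Suc_eq_le)
  qed
  have "lin (nvars k ?n) (expvec k ?n w (code_path n' (length w) c')) y < a" if c': "c' < (length w + 2) ^ n'" for c'
  proof -
    let ?\<rho> = "code_path n' (length w) c'"
    have \<rho>: "?\<rho> t < ?n" for t using code_path_le[of n' "length w" c' t] by simp
    let ?i = "\<lambda>t. (w ! t * ?n + ?\<rho> t) * ?n + ?\<rho> (Suc t)"
    let ?s = "k * ?n * ?n + ?\<rho> 0" and ?e = "k * ?n * ?n + ?n + ?\<rho> (length w)"
    define b where "b x = (if bad x then 1 else 0 :: real)" for x
    have lin_y: "lin (nvars k ?n) (expvec k ?n w ?\<rho>) y =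
        F c' - K * ((\<Sum>t<length w. b (?i t)) + b ?s + b ?e)"
      unfolding F_def lin_expvec[OF vw(2) \<rho>] y_def b_def[symmetric]
      by (simp add: sum_subtractf sum_distrib_left[symmetric] algebra_simps del: mult_Suc_right mult_Suc)
    show ?thesis
    proof (cases "(\<exists>t<length w. bad (?i t)) \<or> bad ?s \<or> bad ?e")
      case True
      have b0: "0 \<le> b x" for x by (simp add: b_def)
      have "1 \<le> (\<Sum>t<length w. b (?i t)) + b ?s + b ?e"
      proof (cases "\<exists>t<length w. bad (?i t)")
        case True
        then obtain t where t: "t < length w" "bad (?i t)" by blast
        then have "b (?i t) \<le> (\<Sum>t<length w. b (?i t))" using b0 by (intro member_le_sum[where f = "\<lambda>t. b (?i t)"]) auto
        moreover have "b (?i t) = 1" using t by (simp add: b_def)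
        ultimately show ?thesis using b0[of ?s] b0[of ?e] by linarith
      next
        case False
        have "0 \<le> (\<Sum>t<length w. b (?i t))" using b0 by (intro sum_nonneg)
        moreover have "b ?s = 1 \<or> b ?e = 1" using False \<open>_ \<or> _\<close> by (auto simp: b_def)
        ultimately show ?thesis using b0[of ?s] b0[of ?e] by linarith
      qed
      then have "K * 1 \<le> K * ((\<Sum>t<length w. b (?i t)) + b ?s + b ?e)" using K0 by (intro mult_left_mono)
      then show ?thesis using K[OF c'] unfolding lin_y by linarith
    next
      case False
      \<comment> \<open>A path without bad coordinates runs from \<open>i\<close> to
        \<open>j\<close> through finite entries, so its weight is at most the entry of
        \<open>w\<close>, which is less than \<open>a\<close>.\<close>
      then have good: "\<And>t. t < length w \<Longrightarrow> \<not> bad (?i t)" "\<not> bad ?s" "\<not> bad ?e" by auto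
      have s: "?\<rho> 0 = i" using good(2) \<rho>[of 0] ij by (auto simp: bad_def)
      have e: "?\<rho> (length w) = j" using good(3) \<rho>[of "length w"] ij by (auto simp: bad_def)
      have "A (w ! t) $$ (?\<rho> t, ?\<rho> (Suc t)) = Fin (f (?i t))" if "t < length w" for t
      proof -
        have "ent (?i t) \<noteq> NegInf" using good(1)[OF that] idx[OF vw(2) that \<rho> \<rho>] by (simp add: bad_def del: mult_Suc_right)
        then show ?thesis using idx[OF vw(2) that \<rho> \<rho>]
          by (auto simp: f_def ent[OF \<rho> \<rho>, symmetric] simp del: mult_Suc_right split: trop.split)
      qed
      then have "\<exists>b\<ge>(\<Sum>t<length w. f (?i t)). mprod ?n A w $$ (?\<rho> 0, ?\<rho> (length w)) = Fin b"
        using A vw(2) by (intro mprod_ge_path \<rho>) (auto simp: UT_trop_def)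
      then have "(\<Sum>t<length w. f (?i t)) < a" using w s e by force
      moreover have "f ?s = 0" "f ?e = 0" by (simp_all add: f_def del: mult_Suc_right)
      moreover have "b (?i t) = 0" if "t < length w" for t using good(1)[OF that] by (simp add: b_def)
      moreover have "b ?s = 0" "b ?e = 0" using good(2,3) by (simp_all add: b_def)
      moreover have "F c' = (\<Sum>t<length w. f (?i t)) + f ?s + f ?e"
        unfolding F_def by (rule lin_expvec[OF vw(2) \<rho>])
      ultimately show ?thesis unfolding lin_y by (simp del: mult_Suc_right mult_Suc)
    qed
  qed
  with c(1) lin_v show ?thesis unfolding separated_def lin_diff
    by (intro exI[of _ c] conjI exI[of _ y]) auto
qed

text \<open>The point itself provides the matrices, with finite entries exactly on and above the
  diagonal. If the products agreed, a path of \<open>w\<close> attaining the common entry would have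
  the end points of the path of \<open>v\<close>; the end marks then cancel, and separation is
  contradicted.\<close>

lemma not_identity_if_separated:
  assumes vw: "v \<in> free_semigroup {..<k}" "w \<in> free_semigroup {..<k}" and sep: "separated k n' v w"
  shows "\<exists>\<phi>. semigroup_morphism {..<k} (UT_trop (Suc n')) (*) \<phi> \<and> \<phi> v \<noteq> \<phi> w"
proof -
  let ?n = "Suc n'"
  from sep obtain c y where cy: "\<And>c'. c' < (length w + 2) ^ n' \<Longrightarrow>
    lin (nvars k ?n) (expvec k ?n w (code_path n' (length w) c')) y <
    lin (nvars k ?n) (expvec k ?n v (code_path n' (length v) c)) y"
    unfolding separated_def lin_diff by auto
  define A where "A s = mat ?n ?n (\<lambda>(i, j). if i \<le> j then Fin (y ((s * ?n + i) * ?n + j)) else NegInf)" for s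
  have A: "A s \<in> carrier_mat ?n ?n" "A s \<in> UT_trop ?n" for s
    by (auto simp: A_def UT_trop_def upper_triangular_def zero_trop_def)
  have UT_mult: "P * Q \<in> UT_trop ?n" if "P \<in> UT_trop ?n" "Q \<in> UT_trop ?n" for P Q :: "trop mat"
  proof -
    have "(P * Q) $$ (i, j) = 0" if "j < i" "i < ?n" for i j
    proof -
      have "P $$ (i, k) * Q $$ (k, j) = 0" if "k < ?n" for k
        using \<open>P \<in> _\<close> \<open>Q \<in> _\<close> \<open>j < i\<close> \<open>i < ?n\<close> that by (cases "k < i") (auto simp: UT_trop_def upper_triangular_def)
      then show ?thesis using \<open>P \<in> _\<close> \<open>Q \<in> _\<close> that by (auto simp: UT_trop_def scalar_prod_def)
    qed
    then show ?thesis using that by (auto simp: UT_trop_def upper_triangular_def)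
  qed
  have one: "1\<^sub>m ?n \<in> UT_trop ?n" by (auto simp: UT_trop_def upper_triangular_def)
  have UT: "mprod ?n A u \<in> UT_trop ?n" for u by (induction u) (use A UT_mult one in auto)
  have morph: "semigroup_morphism {..<k} (UT_trop ?n) (*) (mprod ?n A)"
    unfolding semigroup_morphism_def using UT A(1) by (auto intro: mprod_append)
  let ?\<pi> = "code_path n' (length v) c"
  have \<pi>: "?\<pi> t < ?n" for t using code_path_le[of n' "length v" c t] by simp
  have set: "set v \<subseteq> {..<k}" "set w \<subseteq> {..<k}" using vw by (auto simp: free_semigroup_def)
  have "\<exists>b\<ge>(\<Sum>t<length v. y ((v ! t * ?n + ?\<pi> t) * ?n + ?\<pi> (Suc t))). mprod ?n A v $$ (?\<pi> 0, ?\<pi> (length v)) = Fin b"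
    using A(1) \<pi> by (intro mprod_ge_path) (auto simp: A_def code_path_mono simp del: mult_Suc_right)
  then obtain b where b: "(\<Sum>t<length v. y ((v ! t * ?n + ?\<pi> t) * ?n + ?\<pi> (Suc t))) \<le> b"
    "mprod ?n A v $$ (?\<pi> 0, ?\<pi> (length v)) = Fin b" by blast
  have "mprod ?n A v \<noteq> mprod ?n A w"
  proof
    assume "mprod ?n A v = mprod ?n A w"
    with b have "mprod ?n A w $$ (?\<pi> 0, ?\<pi> (length v)) = Fin b" by simp
    from mprod_attained[OF A(2) \<pi> \<pi> this] obtain \<rho> r where \<rho>: "\<rho> 0 = ?\<pi> 0" "\<rho> (length w) = ?\<pi> (length v)"
       "\<forall>t\<le>length w. \<rho> t < ?n" "\<forall>t<length w. \<rho> t \<le> \<rho> (Suc t) \<and> A (w ! t) $$ (\<rho> t, \<rho> (Suc t)) = Fin (r t)"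
       "(\<Sum>t<length w. r t) = b" by blast
    from ex_path[of "length w" \<rho> n'] \<rho> obtain c' where c': "c' < (length w + 2) ^ n'" "\<forall>t\<le>length w. code_path n' (length w) c' t = \<rho> t"
      by (auto simp: less_Suc_eq_le)
    have r: "y ((w ! t * ?n + \<rho> t) * ?n + \<rho> (Suc t)) = r t" if "t < length w" for t
      using \<rho>(3,4) that by (auto simp: A_def Suc_le_eq simp del: mult_Suc_right)
    have p: "code_path n' (length w) c' t < ?n" for t using code_path_le[of n' "length w" c' t] by simp
    have "lin (nvars k ?n) (expvec k ?n w (code_path n' (length w) c')) y =
      (\<Sum>t<length w. y ((w ! t * ?n + \<rho> t) * ?n + \<rho> (Suc t))) + y (k * ?n * ?n + \<rho> 0) + y (k * ?n * ?n + ?n + \<rho> (length w))"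
      unfolding lin_expvec[OF set(2) p] using c'(2) by (simp del: mult_Suc_right)
    also have "\<dots> = b + y (k * ?n * ?n + \<rho> 0) + y (k * ?n * ?n + ?n + \<rho> (length w))"
      using r \<rho>(5) by simp
    also have "\<dots> \<ge> lin (nvars k ?n) (expvec k ?n v ?\<pi>) y"
      unfolding lin_expvec[OF set(1) \<pi>] \<rho>(1,2) using b(1) by simp
    finally show False using cy[OF c'(1)] by simp
  qed
  with morph show ?thesis by blast
qed

theorem identity_holds_iff:
  assumes vw: "v \<in> free_semigroup {..<k}" "w \<in> free_semigroup {..<k}"
  shows "identity_holds {..<k} (UT_trop (Suc n')) (*) v w \<longleftrightarrow> \<not> separated k n' v w \<and> \<not> separated k n' w v"
proof
  assume "identity_holds {..<k} (UT_trop (Suc n')) (*) v w"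
  then show "\<not> separated k n' v w \<and> \<not> separated k n' w v"
    using not_identity_if_separated[OF vw] not_identity_if_separated[OF vw(2,1)]
    unfolding identity_holds_def by metis
next
  let ?n = "Suc n'"
  assume sep: "\<not> separated k n' v w \<and> \<not> separated k n' w v"
  show "identity_holds {..<k} (UT_trop ?n) (*) v w" unfolding identity_holds_def
  proof (intro allI impI)
    fix \<phi> assume \<phi>: "semigroup_morphism {..<k} (UT_trop ?n) (*) \<phi>"
    define A where "A s = \<phi> [s]" for s
    have A: "A s \<in> UT_trop ?n" if "s < k" for s
      using \<phi> that by (auto simp: semigroup_morphism_def A_def free_semigroup_def)
    \<comment> \<open>A morphism is determined by the images of the letters; the empty word, where
      \<open>mprod\<close> is the unit matrix, lies outside the free semigroup.\<close>
    have \<phi>_eq: "\<phi> u = mprod ?n A u" if "u \<in> free_semigroup {..<k}" for u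
      using that
    proof (induction u)
      case (Cons s u)
      then have s: "s < k" "A s \<in> carrier_mat ?n ?n" using A by (auto simp: free_semigroup_def UT_trop_def)
      show ?case
      proof (cases "u = []")
        case True
        then show ?thesis using s by (simp add: A_def)
      next
        case False
        with Cons.prems have u: "u \<in> free_semigroup {..<k}" "[s] \<in> free_semigroup {..<k}" by (auto simp: free_semigroup_def)
        then have "\<phi> ([s] @ u) = \<phi> [s] * \<phi> u" using \<phi> unfolding semigroup_morphism_def by blast
        then show ?thesis using Cons.IH u by (simp add: A_def)
      qed
    qed (simp add: free_semigroup_def)
    have set: "set v \<subseteq> {..<k}" "set w \<subseteq> {..<k}" using vw by (auto simp: free_semigroup_def)
    have carrier: "mprod ?n A v \<in> carrier_mat ?n ?n" "mprod ?n A w \<in> carrier_mat ?n ?n"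
      using A set by (auto intro!: mprod_carrier simp: UT_trop_def)
    have "mprod ?n A v = mprod ?n A w"
    proof (rule eq_matI)
      fix i j assume "i < dim_row (mprod ?n A w)" "j < dim_col (mprod ?n A w)"
      then have ij: "i < ?n" "j < ?n" using carrier by auto
      show "mprod ?n A v $$ (i, j) = mprod ?n A w $$ (i, j)"
      proof (rule ccontr)
        assume ne: "mprod ?n A v $$ (i, j) \<noteq> mprod ?n A w $$ (i, j)"
        \<comment> \<open>The condition on \<open>b\<close> is an implication, so that an entry
          minus infinity counts as smaller.\<close>
        consider a where "mprod ?n A v $$ (i, j) = Fin a" "\<And>b. mprod ?n A w $$ (i, j) = Fin b \<Longrightarrow> b < a"
          | a where "mprod ?n A w $$ (i, j) = Fin a" "\<And>b. mprod ?n A v $$ (i, j) = Fin b \<Longrightarrow> b < a"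
          using ne by (cases "mprod ?n A v $$ (i, j)"; cases "mprod ?n A w $$ (i, j)")
            (auto, metis linorder_neqE_linordered_idom)
        then show False
        proof cases
          case 1
          then show False using separated_if_exceeds[where A = A, OF set _ ij] A sep by blast
        next
          case 2
          then show False using separated_if_exceeds[where A = A, OF set(2,1) _ ij] A sep by blast
        qed
      qed
    qed (use carrier in auto)
    then show "\<phi> v = \<phi> w" using \<phi>_eq vw by simp
  qed
qed

subsection \<open>Weakest preconditions\<close>

text \<open>Joins safety, which yields the time bound, with functional correctness, so that both are
  proved in a single pass through a program.\<close>

definition wp :: "int \<Rightarrow> int \<Rightarrow> stm \<Rightarrow> store \<Rightarrow> (store \<Rightarrow> bool) \<Rightarrow> bool" where
  "wp M Z s \<sigma> Q \<longleftrightarrow> safe M Z s \<sigma> \<and> Q (run s \<sigma>)"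

lemma upd_apply [simp]: "upd \<sigma> j i v j' = (if j' = j then (\<sigma> j)(i := v) else \<sigma> j')"
  by (simp add: upd_def)

lemma wp_Asg [simp]: "wp M Z (Asg j a e) \<sigma> Q \<longleftrightarrow>
    eok M a \<sigma> \<and> 0 \<le> ev a \<sigma> \<and> eok M e \<sigma> \<and> \<bar>ev e \<sigma>\<bar> \<le> M \<and> Q (upd \<sigma> j (ev a \<sigma>) (ev e \<sigma>))"
  by (auto simp: wp_def)

lemma wp_Sq [simp]: "wp M Z (Sq s t) \<sigma> Q \<longleftrightarrow> wp M Z s \<sigma> (\<lambda>\<tau>. wp M Z t \<tau> Q)"
  by (auto simp: wp_def)

lemma wp_Cond [simp]: "wp M Z (Cond e s t) \<sigma> Q \<longleftrightarrow>
    eok M e \<sigma> \<and> (if ev e \<sigma> > 0 then wp M Z s \<sigma> Q else wp M Z t \<sigma> Q)"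
  by (auto simp: wp_def)

text \<open>Besides the invariant, the premises supply that arrays outside \<open>wr s\<close> keep
  their initial values, so invariants mention only what the body writes. \<open>I (Suc i)\<close> is
  asked of the state with the counter already advanced.\<close>

lemma wp_For:
  assumes j: "j \<notin> wr s \<and> b \<notin> wr s \<and> j \<noteq> b" and b: "\<sigma> b 0 = int n" "int n \<le> Z"
    and init: "I 0 (upd \<sigma> j 0 0)"
    and step: "\<And>i \<tau>. i < n \<Longrightarrow> (\<And>x. x \<notin> insert j (wr s) \<Longrightarrow> \<tau> x = \<sigma> x) \<Longrightarrow> \<tau> j 0 = int i \<Longrightarrow> I i \<tau> \<Longrightarrow>
      wp M Z s \<tau> (\<lambda>\<tau>'. I (Suc i) (upd \<tau>' j 0 (1 + int i)))"
    and final: "\<And>\<tau>. (\<And>x. x \<notin> insert j (wr s) \<Longrightarrow> \<tau> x = \<sigma> x) \<Longrightarrow> \<tau> j 0 = int n \<Longrightarrow> I n \<tau> \<Longrightarrow> Q \<tau>"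
  shows "wp M Z (For j b s) \<sigma> Q"
proof -
  define F where "F = (\<lambda>\<tau>. upd (run s \<tau>) j 0 (\<tau> j 0 + 1))"
  define S where "S i = (F ^^ i) (upd \<sigma> j 0 0)" for i
  have fr: "S i x = \<sigma> x" if "x \<notin> insert j (wr s)" for i x
    by (induction i) (use that in \<open>auto simp: S_def F_def run_frame\<close>)
  have j0: "S i j 0 = int i" for i
    by (induction i) (auto simp: S_def F_def)
  have I: "I i (S i)" if "i \<le> n" for i
    using that
  proof (induction i)
    case 0
    then show ?case using init by (simp add: S_def del: upd_apply)
  next
    case (Suc i)
    have "wp M Z s (S i) (\<lambda>\<tau>'. I (Suc i) (upd \<tau>' j 0 (1 + int i)))"
      using Suc by (intro step fr j0) auto
    then show ?case using j0[of i] by (simp add: wp_def S_def F_def add.commute del: upd_apply)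
  qed
  have "safe M Z s (S i)" if "i < n" for i
    using step[of i "S i"] fr j0 I[of i] that by (simp add: wp_def)
  moreover have "Q (S n)" using final[of "S n"] fr j0 I by simp
  ultimately show ?thesis unfolding wp_def using b by (simp add: S_def F_def)
qed

definition sum_into :: "nat \<Rightarrow> ex \<Rightarrow> nat \<Rightarrow> nat \<Rightarrow> ex \<Rightarrow> stm" where
  "sum_into acc a j b e = Sq (Asg acc a (Num 0)) (For j b (Asg acc a (Plus (Rd acc a) e)))"

lemma wr_sum_into [simp]: "wr (sum_into acc a j b e) = {acc, j}"
  by (auto simp: sum_into_def)

text \<open>The accumulator is a cell, so every prefix sum has to obey \<open>M\<close>. Address and
  summand are evaluated in states that differ from \<open>\<sigma>\<close> at most in the
  accumulator and the counter.\<close>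

lemma wp_sum_into:
  assumes dist: "j \<noteq> acc \<and> b \<noteq> acc \<and> j \<noteq> b" and b: "\<sigma> b 0 = int n" "int n \<le> Z" and M: "0 \<le> M"
    and a: "\<And>\<tau>. (\<And>x. x \<notin> {acc, j} \<Longrightarrow> \<tau> x = \<sigma> x) \<Longrightarrow> ev a \<tau> = p \<and> eok M a \<tau>" "0 \<le> p"
    and e: "\<And>\<tau> i. (\<And>x. x \<notin> {acc, j} \<Longrightarrow> \<tau> x = \<sigma> x) \<Longrightarrow> \<tau> j 0 = int i \<Longrightarrow> i < n \<Longrightarrow> ev e \<tau> = f i \<and> eok M e \<tau>"
    and bound: "\<And>i. i \<le> n \<Longrightarrow> \<bar>\<Sum>k<i. f k\<bar> \<le> M"
    and Q: "\<And>\<tau>. (\<And>x. x \<notin> {acc, j} \<Longrightarrow> \<tau> x = \<sigma> x) \<Longrightarrow> \<tau> acc = (\<sigma> acc)(p := \<Sum>k<n. f k) \<Longrightarrow> Q \<tau>"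
  shows "wp M Z (sum_into acc a j b e) \<sigma> Q"
proof -
  have a0: "ev a \<sigma> = p" "eok M a \<sigma>" using a(1)[of \<sigma>] by auto
  show ?thesis
    unfolding sum_into_def wp_Sq wp_Asg
    apply (intro conjI)
    subgoal by (rule a0)
    subgoal using a0 a(2) by simp
    subgoal using M by simp
    subgoal using M by simp
    apply (rule wp_For[where n = n and I = "\<lambda>i \<tau>. \<tau> acc = (\<sigma> acc)(p := \<Sum>k<i. f k)"])
    subgoal using dist by simp
    subgoal using dist b by simp
    subgoal using b by simp
    subgoal using dist a0 by simp
    subgoal premises prems for i \<tau>
    proof -
      have fr: "\<tau> x = \<sigma> x" if "x \<notin> {acc, j}" for x using prems(2)[of x] that by auto
      have "ev a \<tau> = p \<and> eok M a \<tau>" "ev e \<tau> = f i \<and> eok M e \<tau>"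
        by (intro a(1) e fr prems(1,3); assumption)+
      then show ?thesis using prems a(2) bound[of "Suc i"] dist by simp
    qed
    subgoal premises prems for \<tau>
      using prems by (intro Q) auto
    done
qed

notation Plus (infixl "\<^bold>+" 65) and Minus (infixl "\<^bold>-" 65) and Times (infixl "\<^bold>*" 70) and Quo (infixl "\<^bold>'/" 70)
notation Sq (infixr ";;" 55)

section \<open>The program\<close>

text \<open>A scalar variable is the cell 0 of its array.\<close>

abbreviation (input) "vK \<equiv> 2 :: nat"
abbreviation (input) "vNN \<equiv> 3 :: nat"
abbreviation (input) "vN1 \<equiv> 4 :: nat"
abbreviation (input) "vDIM \<equiv> 5 :: nat"
abbreviation (input) "vRES \<equiv> 6 :: nat"
abbreviation (input) "vPASS \<equiv> 7 :: nat"
abbreviation (input) "vTWO \<equiv> 8 :: nat"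
abbreviation (input) "vO \<equiv> 10 :: nat"
abbreviation (input) "vL \<equiv> 11 :: nat"
abbreviation (input) "vCODE \<equiv> 12 :: nat"
abbreviation (input) "vCD \<equiv> 13 :: nat"
abbreviation (input) "vAL \<equiv> 14 :: nat"
abbreviation (input) "vPI \<equiv> 15 :: nat"
abbreviation (input) "vQ \<equiv> 16 :: nat"
abbreviation (input) "iM \<equiv> 17 :: nat"
abbreviation (input) "iT \<equiv> 18 :: nat"
abbreviation (input) "iX \<equiv> 19 :: nat"
abbreviation (input) "vL1 \<equiv> 20 :: nat"
abbreviation (input) "vX \<equiv> 21 :: nat"
abbreviation (input) "vBASE \<equiv> 22 :: nat"

text \<open>There is no remainder operation, so a digit is obtained by subtracting the quotient
  times the base.\<close>

definition decode_digits :: stm where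
  "decode_digits =
    Asg vCD (Num 0) (Sc vCODE) ;;
    Asg vBASE (Num 0) (Sc vL \<^bold>+ Num 2) ;;
    For iM vN1 (
      Asg vAL (Sc iM) (Sc vCD \<^bold>- Sc vCD \<^bold>/ Sc vBASE \<^bold>* Sc vBASE) ;;
      Asg vCD (Num 0) (Sc vCD \<^bold>/ Sc vBASE))"

lemma wr_decode_digits [simp]: "wr decode_digits = {vCD, vBASE, vAL, iM}"
  by (auto simp: decode_digits_def)

lemma wp_decode_digits:
  assumes \<sigma>: "\<sigma> vN1 0 = int n'" "\<sigma> vL 0 = int l" "\<sigma> vCODE 0 = int c"
    and M: "int l + 2 \<le> M" "int c \<le> M" "int n' \<le> Z"
    and Q: "\<And>\<tau>. (\<And>x. x \<notin> wr decode_digits \<Longrightarrow> \<tau> x = \<sigma> x) \<Longrightarrow>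
      (\<And>m. m < n' \<Longrightarrow> \<tau> vAL (int m) = int (digit (l + 2) c m)) \<Longrightarrow> Q \<tau>"
  shows "wp M Z decode_digits \<sigma> Q"
proof -
  define b where "b = l + 2"
  have b: "int l + 2 = int b" by (simp add: b_def)
  have M0: "0 \<le> M" "2 \<le> M" "int b \<le> M" using M by (auto simp: b_def)
  have digit_le: "int (digit b c m) \<le> M" for m
  proof -
    have "digit b c m < b" by (simp add: digit_def b_def)
    then show ?thesis using M0 by linarith
  qed
  have div_le: "int (c div q) \<le> M" for q
    using M by (meson div_le_dividend of_nat_mono order_trans)
  have digit_eq: "int q - int (q div b) * int b = int (q mod b)" for q
    by (simp add: zdiv_int zmod_int minus_div_mult_eq_mod)
  show ?thesis
    unfolding decode_digits_def
    apply (simp add: \<sigma> b M0)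
    apply (intro conjI)
    subgoal using M by simp
    apply (rule wp_For[where n = n' and I = "\<lambda>i \<tau>. \<tau> vCD 0 = int (c div b ^ i) \<and>
        (\<forall>m<i. \<tau> vAL (int m) = int (digit b c m))"])
    subgoal by simp
    subgoal using \<sigma> by simp
    subgoal using M by simp
    subgoal by simp
    subgoal for i \<tau>
      using digit_le[of i] div_le[of "b ^ Suc i"] M0
      by (auto simp: digit_eq less_Suc_eq div_mult2_eq mult.commute[of b] zdiv_int[symmetric] digit_def)
    subgoal for \<tau>
      using Q unfolding b_def by auto
    done
qed

text \<open>The test \<open>t + 1 - digit > 0\<close> means \<open>digit \<le> t\<close>. There is
  no empty statement, so the other branch copies a cell to itself.\<close>

definition compute_path :: stm where
  "compute_path =
    Asg vL1 (Num 0) (Sc vL \<^bold>+ Num 1) ;;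
    For iT vL1 (
      Asg vPI (Sc iT) (Num 0) ;;
      For iM vN1 (
        Cond (Sc iT \<^bold>+ Num 1 \<^bold>- Rd vAL (Sc iM))
          (Asg vPI (Sc iT) (Rd vPI (Sc iT) \<^bold>+ Num 1))
          (Asg vPI (Sc iT) (Rd vPI (Sc iT)))))"

lemma wr_compute_path [simp]: "wr compute_path = {vL1, iT, iM, vPI}"
  by (auto simp: compute_path_def)

lemma wp_compute_path:
  assumes \<sigma>: "\<sigma> vN1 0 = int n'" "\<sigma> vL 0 = int l"
    and digits: "\<And>m. m < n' \<Longrightarrow> \<sigma> vAL (int m) = int (digit (l + 2) c m)"
    and M: "int l + 1 \<le> Z" "int n' \<le> Z" "Z \<le> M"
    and Q: "\<And>\<tau>. (\<And>x. x \<notin> wr compute_path \<Longrightarrow> \<tau> x = \<sigma> x) \<Longrightarrow>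
      (\<And>t. t \<le> l \<Longrightarrow> \<tau> vPI (int t) = int (code_path n' l c t)) \<Longrightarrow> Q \<tau>"
  shows "wp M Z compute_path \<sigma> Q"
proof -
  have M0: "0 \<le> M" "1 \<le> M" using M by auto
  define cnt where "cnt k t = (\<Sum>m<k. if digit (l + 2) c m \<le> t then 1 else 0 :: int)" for k t
  have path_eq: "int (code_path n' l c t) = cnt n' t" for t
    unfolding code_path_def of_nat_sum cnt_def by (intro sum.cong) auto
  have cnt_Suc: "cnt (Suc k) t = cnt k t + (if digit (l + 2) c k \<le> t then 1 else 0)" "cnt 0 t = 0" for k t
    by (simp_all add: cnt_def)
  have cnt: "0 \<le> cnt k t" "cnt k t \<le> int k" for k t
    by (induction k) (auto simp: cnt_Suc)
  show ?thesis
    unfolding compute_path_def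
    apply (simp add: \<sigma> M0)
    apply (intro conjI)
    subgoal using M by simp
    apply (rule wp_For[where n = "l + 1" and I = "\<lambda>i \<tau>. \<forall>t<i. \<tau> vPI (int t) = cnt n' t"])
    subgoal by simp
    subgoal using \<sigma> by simp
    subgoal using M by simp
    subgoal by simp
    subgoal premises prems for i \<tau>
      apply (simp add: M0 prems(3))
      apply (rule wp_For[where n = n' and I = "\<lambda>k \<tau>'. (\<forall>t<i. \<tau>' vPI (int t) = cnt n' t) \<and> \<tau>' vPI (int i) = cnt k i"])
      subgoal by simp
      subgoal using \<sigma> prems by simp
      subgoal using M by simp
      subgoal using prems by (simp add: cnt_Suc)
      subgoal premises q for k \<tau>'
      proof -
        have *: "\<tau>' iT 0 = int i" "\<tau>' vAL (int k) = int (digit (l + 2) c k)" "\<tau>' iM 0 = int k"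
          using q prems digits[OF q(1)] by auto
        have "\<bar>cnt k i\<bar> \<le> M" "\<bar>cnt k i + 1\<bar> \<le> M" using cnt[of k i] q(1) M by linarith+
        then show ?thesis using * q(4) M0 by (auto simp: cnt_Suc)
      qed
      subgoal for \<tau>'
        using prems by (auto simp: less_Suc_eq)
      done
    subgoal for \<tau>
      using Q by (auto simp: path_eq)
    done
qed

definition count_transitions :: stm where
  "count_transitions =
    For iX vDIM (Asg vQ (Sc iX) (Num 0)) ;;
    For iT vL (
      Asg vX (Num 0) ((Rd 0 (Sc vO \<^bold>+ Sc iT) \<^bold>* Sc vNN \<^bold>+ Rd vPI (Sc iT)) \<^bold>* Sc vNN \<^bold>+ Rd vPI (Sc iT \<^bold>+ Num 1)) ;;
      Asg vQ (Sc vX) (Rd vQ (Sc vX) \<^bold>+ Num 1)) ;;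
    Asg vX (Num 0) (Sc vK \<^bold>* Sc vNN \<^bold>* Sc vNN \<^bold>+ Rd vPI (Num 0)) ;;
    Asg vQ (Sc vX) (Rd vQ (Sc vX) \<^bold>+ Num 1) ;;
    Asg vX (Num 0) (Sc vK \<^bold>* Sc vNN \<^bold>* Sc vNN \<^bold>+ Sc vNN \<^bold>+ Rd vPI (Sc vL)) ;;
    Asg vQ (Sc vX) (Rd vQ (Sc vX) \<^bold>+ Num 1)"

lemma wr_count_transitions [simp]: "wr count_transitions = {iX, vQ, iT, vX}"
  by (auto simp: count_transitions_def)

lemma wp_count_transitions:
  assumes \<sigma>: "\<sigma> vDIM 0 = int (nvars k n)" "\<sigma> vL 0 = int (length w)" "\<sigma> vO 0 = int a" "\<sigma> vNN 0 = int n" "\<sigma> vK 0 = int k"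
    and word: "\<And>t. t < length w \<Longrightarrow> \<sigma> 0 (int (a + t)) = int (w ! t)" "set w \<subseteq> {..<k}"
    and path: "\<And>t. t \<le> length w \<Longrightarrow> \<sigma> vPI (int t) = int (\<pi> t)" "\<And>t. t \<le> length w \<Longrightarrow> \<pi> t < n"
    and M: "int (length w) + 2 \<le> Z" "int (nvars k n) \<le> Z" "Z \<le> M"
    and Q: "\<And>\<tau>. (\<And>x. x \<notin> wr count_transitions \<Longrightarrow> \<tau> x = \<sigma> x) \<Longrightarrow>
      (\<And>x. x < nvars k n \<Longrightarrow> \<tau> vQ (int x) = expvec k n w \<pi> x) \<Longrightarrow> Q \<tau>"
  shows "wp M Z count_transitions \<sigma> Q"
proof -
  have M0: "0 \<le> M" "1 \<le> M" using M by auto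
  let ?i = "\<lambda>t. (w ! t * n + \<pi> t) * n + \<pi> (Suc t)"
  have idx: "?i t < nvars k n" if "t < length w" for t
  proof -
    have "w ! t < k" using word(2) nth_mem[OF that] by auto
    then have "?i t < k * n * n" using path(2) that by (intro entry_index_less) auto
    then show ?thesis by (simp add: nvars_def)
  qed
  define s where "s = k * n * n + \<pi> 0"
  define e where "e = k * n * n + n + \<pi> (length w)"
  have se: "s < nvars k n" "e < nvars k n"
    using path(2)[of 0] path(2)[of "length w"] by (auto simp: s_def e_def nvars_def)
  define cnt where "cnt i x = (\<Sum>t<i. if x = ?i t then 1 else 0 :: int)" for i x
  have cnt: "0 \<le> cnt i x" "cnt i x \<le> int i" for i x
  proof -
    show "0 \<le> cnt i x" unfolding cnt_def by (intro sum_nonneg) auto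
    have "cnt i x \<le> (\<Sum>t<i. 1)" unfolding cnt_def by (intro sum_mono) auto
    then show "cnt i x \<le> int i" by simp
  qed
  have le_M: "int x \<le> M" if "x < nvars k n" for x using that M by linarith
  have cnt_Suc: "cnt (Suc i) x = cnt i x + (if x = ?i i then 1 else 0)" for i x
    by (simp add: cnt_def)
  show ?thesis
    unfolding count_transitions_def wp_Sq
    apply (rule wp_For[where n = "nvars k n" and I = "\<lambda>i \<tau>. \<forall>x<i. \<tau> vQ (int x) = 0"])
    subgoal by simp
    subgoal using \<sigma> by simp
    subgoal using M by simp
    subgoal by simp
    subgoal using M0 by (auto simp: less_Suc_eq)
    subgoal premises q0 for \<sigma>'
      apply (rule wp_For[where n = "length w" and I = "\<lambda>i \<tau>. \<forall>x<nvars k n. \<tau> vQ (int x) = cnt i x"])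
      subgoal by simp
      subgoal using \<sigma> q0 by simp
      subgoal using M by simp
      subgoal using q0 by (simp add: cnt_def)
      subgoal premises prems for i \<tau>
      proof -
        have i: "i < length w" by fact
        define p where "p = ?i i"
        have p: "p < nvars k n" unfolding p_def by (rule idx[OF i])
        have *: "\<tau> 0 (int a + int i) = int (w ! i)" "\<tau> vPI (int i) = int (\<pi> i)" "\<tau> vPI (int i + 1) = int (\<pi> (Suc i))"
          "\<tau> vO 0 = int a" "\<tau> vNN 0 = int n"
          using prems(2) q0(1) i word(1)[OF i] path(1)[of i] path(1)[of "Suc i"] \<sigma> by (auto simp: add.commute)
        have cast: "(int (w ! i) * int n + int (\<pi> i)) * int n + int (\<pi> (Suc i)) = int p"
          by (simp add: p_def)
        have "\<bar>cnt i p + 1\<bar> \<le> M" using cnt[of i p] i M by linarith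
        then show ?thesis
          using p le_M[OF p] prems(4) M0
          by (auto simp: * prems(3) cast cnt_Suc p_def[symmetric])
      qed
      subgoal premises prems for \<tau>
      proof -
        have *: "\<tau> vPI 0 = int (\<pi> 0)" "\<tau> vPI (int (length w)) = int (\<pi> (length w))"
          "\<tau> vK 0 = int k" "\<tau> vNN 0 = int n" "\<tau> vL 0 = int (length w)"
          using prems(1) q0(1) path(1)[of 0] path(1)[of "length w"] \<sigma> by auto
        have cast: "int k * int n * int n + int (\<pi> 0) = int s" "int k * int n * int n + int n + int (\<pi> (length w)) = int e"
          by (simp_all add: s_def e_def)
        have "\<bar>cnt (length w) x + 1\<bar> \<le> M" "\<bar>2 + cnt (length w) x\<bar> \<le> M" for x
          using cnt[of "length w" x] M by linarith+
        moreover have "expvec k n w \<pi> x = cnt (length w) x + (if x = s then 1 else 0) + (if x = e then 1 else 0)" for x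
          unfolding expvec_def cnt_def s_def e_def ..
        ultimately show ?thesis
          using se le_M[OF se(1)] le_M[OF se(2)] prems(3) M0 * cast
          apply simp
          apply (intro conjI impI Q)
          using prems(1) q0(1)
          apply (auto)
          done
      qed
      done
    done
qed

subsection \<open>Deciding strict feasibility\<close>

abbreviation (input) "vN \<equiv> 30 :: nat"
abbreviation (input) "vA \<equiv> 36 :: nat"
abbreviation (input) "vT \<equiv> 40 :: nat"
abbreviation (input) "vR \<equiv> 41 :: nat"
abbreviation (input) "vB \<equiv> 42 :: nat"
abbreviation (input) "vD \<equiv> 43 :: nat"
abbreviation (input) "vMU \<equiv> 44 :: nat"
abbreviation (input) "vC \<equiv> 45 :: nat"
abbreviation (input) "vFE \<equiv> 46 :: nat"
abbreviation (input) "iRR \<equiv> 47 :: nat"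
abbreviation (input) "iTT \<equiv> 48 :: nat"
abbreviation (input) "vG \<equiv> 49 :: nat"
abbreviation (input) "vETA \<equiv> 50 :: nat"
abbreviation (input) "vVI \<equiv> 51 :: nat"
abbreviation (input) "jQ \<equiv> 52 :: nat"
abbreviation (input) "jX \<equiv> 53 :: nat"
abbreviation (input) "jY \<equiv> 54 :: nat"
abbreviation (input) "vS \<equiv> 55 :: nat"
abbreviation (input) "vBQ \<equiv> 56 :: nat"
abbreviation (input) "vH \<equiv> 57 :: nat"
abbreviation (input) "vD2 \<equiv> 58 :: nat"
abbreviation (input) "vSS \<equiv> 59 :: nat"

definition determinant_bound :: "nat \<Rightarrow> nat \<Rightarrow> nat \<Rightarrow> nat" where
  "determinant_bound d N L = (4 * (1 + d * L * L)) ^ rounds d N L"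

definition direction_bound :: "nat \<Rightarrow> nat \<Rightarrow> nat \<Rightarrow> nat" where
  "direction_bound d N L = N * (steps d N L * 2 ^ rounds d N L) * L"

text \<open>Adds up bounds for all numbers that the solver stores: counters, powers of two, the
  vector \<open>g\<close>, the direction, its products with rows, and the corresponding numbers of
  the update. As a sum it dominates each of them at once.\<close>

definition lp_bound :: "nat \<Rightarrow> nat \<Rightarrow> nat \<Rightarrow> nat" where
  "lp_bound d N L = steps d N L + N + 1 + 2 ^ rounds d N L + 3 * 4 ^ rounds d N L + L + determinant_bound d N L +
     direction_bound d N L + d * determinant_bound d N L * direction_bound d N L +
     d * L * (d * determinant_bound d N L * direction_bound d N L) +
     d * determinant_bound d N L * L + d * L * (d * determinant_bound d N L * L)"

text \<open>\<open>vVI\<close> is 0 if no inequality is violated, and otherwise one plus the last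
  violated index, since later iterations overwrite it. The vector \<open>g\<close> is recomputed
  from the counters in every step.\<close>

definition find_step :: stm where
  "find_step =
    For jX vDIM (sum_into vG (Sc jX) jQ vN
      (Rd vC (Sc jQ) \<^bold>* Rd vMU (Sc jQ) \<^bold>* Rd vA (Sc jQ \<^bold>* Sc vDIM \<^bold>+ Sc jX))) ;;
    For jX vDIM (sum_into vETA (Sc jX) jY vDIM
      (Rd vB (Sc jX \<^bold>* Sc vDIM \<^bold>+ Sc jY) \<^bold>* Rd vG (Sc jY))) ;;
    Asg vVI (Num 0) (Num 0) ;;
    For jQ vN (
      sum_into vS (Num 0) jX vDIM (Rd vA (Sc jQ \<^bold>* Sc vDIM \<^bold>+ Sc jX) \<^bold>* Rd vETA (Sc jX)) ;;
      Cond (Sc vS) (Asg vVI (Num 0) (Sc vVI)) (Asg vVI (Num 0) (Sc jQ \<^bold>+ Num 1))) ;;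
    Cond (Sc vVI)
      (Asg vC (Sc vVI \<^bold>- Num 1) (Rd vC (Sc vVI \<^bold>- Num 1) \<^bold>+ Num 1))
      (Asg vFE (Num 0) (Num 1))"

lemma wr_find_step [simp]: "wr find_step = {jX, vG, jQ, vETA, jY, vVI, vS, vC, vFE}"
  by (auto simp: find_step_def)

definition lp_store :: "nat \<Rightarrow> nat \<Rightarrow> (nat \<Rightarrow> nat \<Rightarrow> int) \<Rightarrow> (nat \<Rightarrow> nat) \<Rightarrow> (nat \<Rightarrow> nat \<Rightarrow> int) \<Rightarrow> int \<Rightarrow> store \<Rightarrow> bool" where
  "lp_store d N a m B D \<sigma> \<longleftrightarrow> \<sigma> vDIM 0 = int d \<and> \<sigma> vN 0 = int N \<and>
    (\<forall>q<N. \<forall>x<d. \<sigma> vA (int q * int d + int x) = a q x) \<and> (\<forall>q<N. \<sigma> vMU (int q) = 2 ^ m q) \<and>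
    (\<forall>x<d. \<forall>y<d. \<sigma> vB (int x * int d + int y) = B x y) \<and> \<sigma> vD 0 = D"

lemma lp_store_cong:
  assumes "lp_store d N a m B D \<sigma>" "\<And>x. x \<in> {vDIM, vN, vA, vMU, vB, vD} \<Longrightarrow> \<tau> x = \<sigma> x"
  shows "lp_store d N a m B D \<tau>"
  using assms by (simp add: lp_store_def)

locale lp_run = lp_adjugate +
  fixes M Z :: int and R :: nat
  assumes M: "int (lp_bound d N L) \<le> M" and Z: "int d \<le> Z" "int N \<le> Z" "Z \<le> M"
    and m: "\<And>q. q < N \<Longrightarrow> m q \<le> rounds d N L"
    and D_le: "D \<le> int (determinant_bound d N L)"
    and pos: "0 < d" "0 < N" "0 < L"
begin

lemma lp_bound_ge: "x \<le> lp_bound d N L \<Longrightarrow> int x \<le> M"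
  using M by linarith

lemma M0: "0 \<le> M" "1 \<le> M"
  using lp_bound_ge[of 1] by (auto simp: lp_bound_def)

lemma B_le: "x < d \<Longrightarrow> y < d \<Longrightarrow> \<bar>B x y\<bar> \<le> int (determinant_bound d N L)"
  using abs_B_le D_le by (meson order_trans)

lemma mu_le: "q < N \<Longrightarrow> (2::int) ^ m q \<le> 2 ^ rounds d N L"
  using m by (intro power_increasing) auto

lemma partial_weighted_sum_le:
  assumes "\<And>q. q < N \<Longrightarrow> 0 \<le> c q \<and> c q \<le> int (steps d N L)" "x < d" "i \<le> N"
  shows "\<bar>\<Sum>q<i. c q * 2 ^ m q * a q x\<bar> \<le> int (direction_bound d N L)"
proof -
  have "\<bar>\<Sum>q<i. c q * 2 ^ m q * a q x\<bar> \<le> int N * (int (steps d N L) * 2 ^ rounds d N L) * int L"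
  proof (rule abs_idot_le)
    fix q assume "q < N"
    then show "\<bar>c q * 2 ^ m q\<bar> \<le> int (steps d N L) * 2 ^ rounds d N L"
      using assms(1) mu_le by (auto simp: abs_mult intro!: mult_mono)
    show "\<bar>a q x\<bar> \<le> int L" by (intro L \<open>q < N\<close> assms)
  qed (use assms in auto)
  then show ?thesis by (simp add: direction_bound_def)
qed

lemma wp_find_step:
  assumes \<sigma>: "lp_store d N a m B D \<sigma>" "\<And>q. q < N \<Longrightarrow> \<sigma> vC (int q) = c q"
    and c: "\<And>q. q < N \<Longrightarrow> 0 \<le> c q \<and> c q < int (steps d N L)"
  defines "g \<equiv> weighted_sum N a m c"
  assumes violated: "\<And>\<tau> j. (\<And>x. x \<notin> wr find_step \<Longrightarrow> \<tau> x = \<sigma> x) \<Longrightarrow> j < N \<Longrightarrow>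
      idot d (a j) (apply_mat d B g) \<le> 0 \<Longrightarrow> \<tau> vC = (\<sigma> vC)(int j := c j + 1) \<Longrightarrow> \<tau> vFE = \<sigma> vFE \<Longrightarrow> Q \<tau>"
    and feasible: "\<And>\<tau>. (\<And>x. x \<notin> wr find_step \<Longrightarrow> \<tau> x = \<sigma> x) \<Longrightarrow>
      (\<And>j. j < N \<Longrightarrow> 0 < idot d (a j) (apply_mat d B g)) \<Longrightarrow> \<tau> vC = \<sigma> vC \<Longrightarrow> \<tau> vFE 0 = 1 \<Longrightarrow> Q \<tau>"
  shows "wp M Z find_step \<sigma> Q"
proof -
  let ?DB = "determinant_bound d N L" and ?GB = "direction_bound d N L"
  have c': "0 \<le> c q \<and> c q \<le> int (steps d N L)" if "q < N" for q using c[OF that] by auto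
  have g_le: "\<bar>g x\<bar> \<le> int ?GB" if "x < d" for x
    unfolding g_def weighted_sum_def by (rule partial_weighted_sum_le) (use c' that in auto)
  have eta_part: "\<bar>\<Sum>y<i. B x y * g y\<bar> \<le> int (d * ?DB * ?GB)" if "x < d" "i \<le> d" for x i
    using abs_idot_le[of d "B x" "int ?DB" g "int ?GB" i] B_le[OF that(1)] g_le that(2) by simp
  have eta_le: "\<bar>apply_mat d B g x\<bar> \<le> int (d * ?DB * ?GB)" if "x < d" for x
    unfolding apply_mat_def by (rule eta_part) (use that in auto)
  have s_part: "\<bar>\<Sum>x<i. a q x * apply_mat d B g x\<bar> \<le> int (d * L * (d * ?DB * ?GB))" if "q < N" "i \<le> d" for q i
    using abs_idot_le[of d "a q" "int L" "apply_mat d B g" "int (d * ?DB * ?GB)" i] L[OF that(1)] eta_le that(2) by simp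
  have GB: "int ?GB \<le> M" "int (d * ?DB * ?GB) \<le> M" "int (d * L * (d * ?DB * ?GB)) \<le> M" "int (steps d N L) \<le> M"
    by (intro lp_bound_ge; simp add: lp_bound_def)+
  have NM: "int N \<le> M" using Z by simp
  show ?thesis
    unfolding find_step_def wp_Sq
    apply (rule wp_For[where n = d and I = "\<lambda>i \<tau>. \<forall>x<i. \<tau> vG (int x) = g x"])
    subgoal by simp
    subgoal using \<sigma> by (simp add: lp_store_def)
    subgoal using Z by simp
    subgoal by simp
    subgoal premises p for i \<tau>
    proof -
      have st: "lp_store d N a m B D \<tau>" by (rule lp_store_cong[OF \<sigma>(1)]) (use p(2) in auto)
      have C: "\<tau> vC = \<sigma> vC" using p(2) by simp
      show ?thesis
        apply (rule wp_sum_into[where n = N and p = "int i" and f = "\<lambda>q. c q * 2 ^ m q * a q i"])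
        subgoal by simp
        subgoal using st by (simp add: lp_store_def)
        subgoal using Z by simp
        subgoal using M0 by simp
        subgoal using p(3) M0 by simp
        subgoal by simp
        subgoal for \<tau>' q using st p(1,3) \<sigma>(2) C M0 by (simp add: lp_store_def)
        subgoal using partial_weighted_sum_le[of c i] c' p(1) GB(1) by (meson order_trans)
        subgoal for \<tau>' using p(4) by (auto simp: less_Suc_eq g_def weighted_sum_def)
        done
    qed
    subgoal premises p1 for \<sigma>1
      apply (rule wp_For[where n = d and I = "\<lambda>i \<tau>. \<forall>x<i. \<tau> vETA (int x) = apply_mat d B g x"])
      subgoal by simp
      subgoal using \<sigma> p1(1) by (simp add: lp_store_def)
      subgoal using Z by simp
      subgoal by simp
      subgoal premises p for i \<tau>
      proof -
        have st: "lp_store d N a m B D \<tau>" by (rule lp_store_cong[OF \<sigma>(1)]) (use p(2) p1(1) in auto)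
        have G: "\<tau> vG = \<sigma>1 vG" using p(2) by simp
        show ?thesis
          apply (rule wp_sum_into[where n = d and p = "int i" and f = "\<lambda>y. B i y * g y"])
          subgoal by simp
          subgoal using st by (simp add: lp_store_def)
          subgoal using Z by simp
          subgoal using M0 by simp
          subgoal using p(3) M0 by simp
          subgoal by simp
          subgoal for \<tau>' q using st p(1,3) p1(3) G M0 by (simp add: lp_store_def)
          subgoal using eta_part[OF p(1)] GB(2) by (meson order_trans)
          subgoal for \<tau>' using p(4) by (auto simp: less_Suc_eq apply_mat_def)
          done
      qed
      subgoal premises p2 for \<sigma>2
        apply (simp add: M0)
        apply (rule wp_For[where n = N and I = "\<lambda>i \<tau>. (\<tau> vVI 0 = 0 \<and> (\<forall>j<i. 0 < idot d (a j) (apply_mat d B g))) \<or>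
            (\<exists>j<i. \<tau> vVI 0 = int j + 1 \<and> idot d (a j) (apply_mat d B g) \<le> 0)"])
        subgoal by simp
        subgoal using \<sigma> p1(1) p2(1) by (simp add: lp_store_def)
        subgoal using Z by simp
        subgoal by simp
        subgoal premises p for i \<tau>
        proof -
          have st: "lp_store d N a m B D \<tau>" by (rule lp_store_cong[OF \<sigma>(1)]) (use p(2) p1(1) p2(1) in auto)
          have ETA: "\<tau> vETA = \<sigma>2 vETA" using p(2) by simp
          have iM: "int i + 1 \<le> M" using p(1) NM by linarith
          have vi: "\<bar>\<tau> vVI 0\<bar> \<le> M" using p(1,4) NM M0 by auto
          show ?thesis
            unfolding wp_Sq
            apply (rule wp_sum_into[where n = d and p = 0 and f = "\<lambda>x. a i x * apply_mat d B g x"])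
            subgoal by simp
            subgoal using st by (simp add: lp_store_def)
            subgoal using Z by simp
            subgoal using M0 by simp
            subgoal using M0 by simp
            subgoal by simp
            subgoal for \<tau>' q using st p(1,3) p2(3) ETA M0 by (simp add: lp_store_def)
            subgoal using s_part[OF p(1)] GB(3) by (meson order_trans)
            subgoal premises q for \<tau>'
            proof -
              have S: "\<tau>' vS 0 = idot d (a i) (apply_mat d B g)" using q(2) by (simp add: idot_def)
              have V: "\<tau>' vVI = \<tau> vVI" "\<tau>' jQ 0 = int i" using q(1) p(3) by auto
              show ?thesis using S V vi iM M0 p(4) by (auto simp: less_Suc_eq)
            qed
            done
        qed
        subgoal premises p3 for \<sigma>3
        proof -
          have fr: "\<sigma>3 x = \<sigma> x" if "x \<notin> {jX, vG, jQ, vETA, jY, vVI, vS}" for x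
            using p1(1)[of x] p2(1)[of x] p3(1)[of x] that by simp
          from p3(3) show ?thesis
          proof (elim disjE conjE exE)
            fix j assume j: "j < N" "\<sigma>3 vVI 0 = int j + 1" "idot d (a j) (apply_mat d B g) \<le> 0"
            \<comment> \<open>The strict bound on the counters leaves room for the
              increment.\<close>
            have "\<bar>c j + 1\<bar> \<le> M" using c[OF j(1)] GB(4) by linarith
            then show ?thesis
              using j M0 \<sigma>(2)[OF j(1)] fr[of vC]
              apply simp
              apply (rule violated[of _ j])
              by (auto simp: fr)
          next
            assume "\<sigma>3 vVI 0 = 0" "\<forall>j<N. 0 < idot d (a j) (apply_mat d B g)"
            then show ?thesis
              using M0 fr[of vC]
              apply simp
              apply (rule feasible)
              by (auto simp: fr)
          qed
        qed
        done
      done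
    done
qed

end

section \<open>The rescaling step\<close>

definition choose_row :: stm where
  "choose_row = Asg vBQ (Num 0) (Num 0) ;;
    For jQ vN (Cond (Rd vC (Sc jQ) \<^bold>- Rd vC (Sc vBQ)) (Asg vBQ (Num 0) (Sc jQ)) (Asg vBQ (Num 0) (Sc vBQ)))"

lemma wr_choose_row [simp]: "wr choose_row = {vBQ, jQ}"
  by (auto simp: choose_row_def)

lemma wp_choose_row:
  assumes \<sigma>: "\<sigma> vN 0 = int N" and N: "0 < N" "int N \<le> Z" "Z \<le> M"
    and Q: "\<And>\<tau> j. (\<And>x. x \<notin> wr choose_row \<Longrightarrow> \<tau> x = \<sigma> x) \<Longrightarrow> \<tau> vBQ 0 = int j \<Longrightarrow> j < N \<Longrightarrow>
       (\<And>q. q < N \<Longrightarrow> \<sigma> vC (int q) \<le> \<sigma> vC (int j)) \<Longrightarrow> Q \<tau>"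
  shows "wp M Z choose_row \<sigma> Q"
proof -
  have M0: "0 \<le> M" "int N \<le> M" using N by auto
  show ?thesis
    unfolding choose_row_def wp_Sq
    apply (simp add: M0)
    apply (rule wp_For[where n = N and I = "\<lambda>i \<tau>. \<exists>j<N. \<tau> vBQ 0 = int j \<and> (\<forall>q<i. \<sigma> vC (int q) \<le> \<sigma> vC (int j))"])
    subgoal by simp
    subgoal using \<sigma> by simp
    subgoal using N by simp
    subgoal using N by auto
    subgoal premises p for i \<tau>
    proof -
      from p(4) obtain j where j: "j < N" "\<tau> vBQ 0 = int j" "\<forall>q<i. \<sigma> vC (int q) \<le> \<sigma> vC (int j)" by blast
      have C: "\<tau> vC = \<sigma> vC" using p(2) by simp
      have "int i \<le> M" "int j \<le> M" using p(1) j(1) M0 by linarith+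
      then show ?thesis
        using p(1,3) j C M0
        apply simp
        apply (intro conjI impI)
        subgoal by (auto simp: less_Suc_eq intro: order_trans less_imp_le)
        subgoal by (auto simp: less_Suc_eq)
        done
    qed
    subgoal premises p for \<tau>
    proof -
      from p(3) obtain j where "j < N" "\<tau> vBQ 0 = int j" "\<forall>q<N. \<sigma> vC (int q) \<le> \<sigma> vC (int j)" by blast
      then show ?thesis using p(1) by (intro Q[of \<tau> j]) auto
    qed
    done
qed

text \<open>The matrix is updated in place: apart from \<open>vH\<close>, \<open>vSS\<close>,
  \<open>vD\<close> and \<open>vD2\<close>, a new entry depends only on the old entry at the same
  position. The old determinant stays in \<open>vD\<close> until all divisions are done, and
  \<open>vSS\<close> is computed before the factor in \<open>vMU\<close> is doubled.\<close>

definition update_step :: stm where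
  "update_step =
    Asg vSS (Num 0) (Num 3 \<^bold>* Rd vMU (Sc vBQ) \<^bold>* Rd vMU (Sc vBQ)) ;;
    Asg vMU (Sc vBQ) (Num 2 \<^bold>* Rd vMU (Sc vBQ)) ;;
    For jX vDIM (sum_into vH (Sc jX) jY vDIM
      (Rd vB (Sc jX \<^bold>* Sc vDIM \<^bold>+ Sc jY) \<^bold>* Rd vA (Sc vBQ \<^bold>* Sc vDIM \<^bold>+ Sc jY))) ;;
    sum_into vS (Num 0) jX vDIM (Rd vA (Sc vBQ \<^bold>* Sc vDIM \<^bold>+ Sc jX) \<^bold>* Rd vH (Sc jX)) ;;
    Asg vD2 (Num 0) (Sc vD \<^bold>+ Sc vSS \<^bold>* Sc vS) ;;
    For jX vDIM (For jY vDIM (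
      Asg vB (Sc jX \<^bold>* Sc vDIM \<^bold>+ Sc jY)
        ((Sc vD2 \<^bold>* Rd vB (Sc jX \<^bold>* Sc vDIM \<^bold>+ Sc jY) \<^bold>- Sc vSS \<^bold>* Rd vH (Sc jX) \<^bold>* Rd vH (Sc jY)) \<^bold>/ Sc vD))) ;;
    Asg vD (Num 0) (Sc vD2)"

lemma wr_update_step [simp]: "wr update_step = {vSS, vMU, jX, vH, jY, vS, vD2, vB, vD}"
  by (auto simp: update_step_def)

text \<open>Row-major addresses are injective, so writing one entry leaves the others
  intact.\<close>

lemma index_eq_iff:
  assumes "y < d" "k < d"
  shows "int x * int d + int y = int i * int d + int k \<longleftrightarrow> x = i \<and> y = k"
proof
  assume "int x * int d + int y = int i * int d + int k"
  then have "int (x * d + y) = int (i * d + k)" by simp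
  then have eq: "x * d + y = i * d + k" by (simp only: of_nat_eq_iff)
  have "(x * d + y) div d = x" "(i * d + k) div d = i" using assms by auto
  with eq show "x = i \<and> y = k" by simp
qed simp

lemma (in lp_run) wp_update_step:
  assumes \<sigma>: "lp_store d N a m B D \<sigma>" "\<sigma> vBQ 0 = int j"
    and j: "j < N" "m j < rounds d N L"
  defines "h \<equiv> apply_mat d B (a j)"
  defines "D' \<equiv> D + 3 * 4 ^ m j * idot d (a j) h"
  assumes D'_le: "D' \<le> int (determinant_bound d N L)"
    and Q: "\<And>\<tau>. (\<And>x. x \<notin> wr update_step \<Longrightarrow> \<tau> x = \<sigma> x) \<Longrightarrow>
      lp_store d N a (m(j := Suc (m j))) (\<lambda>x y. (D' * B x y - 3 * 4 ^ m j * h x * h y) div D) D' \<tau> \<Longrightarrow> Q \<tau>"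
  shows "wp M Z update_step \<sigma> Q"
proof -
  let ?DB = "determinant_bound d N L"
  define B' where "B' = (\<lambda>x y. (D' * B x y - 3 * 4 ^ m j * h x * h y) div D)"
  have B'_eq: "(D' * B x y - 3 * 4 ^ m j * h x * h y) div D = B' x y" for x y by (simp add: B'_def)
  \<comment> \<open>The estimates for the adjugate apply to the new data as well, so the quotients
    that are stored are at most \<open>D'\<close>, however large the numerators are.\<close>
  interpret u: lp_adjugate d N L a "m(j := Suc (m j))" B' D'
    using update(1)[OF j(1)] unfolding B'_def D'_def h_def .
  have B'_le: "\<bar>B' x y\<bar> \<le> int ?DB" if "x < d" "y < d" for x y
    using u.abs_B_le[OF that] D'_le by linarith
  have h_part: "\<bar>\<Sum>y<i. B x y * a j y\<bar> \<le> int (d * ?DB * L)" if "x < d" "i \<le> d" for x i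
    using abs_idot_le[of d "B x" "int ?DB" "a j" "int L" i] B_le[OF that(1)] L[OF j(1)] that(2) by simp
  have h_le: "\<bar>h x\<bar> \<le> int (d * ?DB * L)" if "x < d" for x
    unfolding h_def apply_mat_def by (rule h_part) (use that in auto)
  have s_part: "\<bar>\<Sum>x<i. a j x * h x\<bar> \<le> int (d * L * (d * ?DB * L))" if "i \<le> d" for i
    using abs_idot_le[of d "a j" "int L" h "int (d * ?DB * L)" i] L[OF j(1)] h_le that by simp
  have bounds: "int ?DB \<le> M" "int (d * ?DB * L) \<le> M" "int (d * L * (d * ?DB * L)) \<le> M"
    "int (3 * 4 ^ rounds d N L) \<le> M" "int (2 ^ rounds d N L) \<le> M"
    by (intro lp_bound_ge; simp add: lp_bound_def)+
  have "(4::int) ^ m j \<le> 4 ^ rounds d N L" using j(2) by (intro power_increasing) auto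
  moreover have "3 * (4::int) ^ rounds d N L \<le> M" using bounds(4) by simp
  ultimately have ss_le: "3 * (4::int) ^ m j \<le> M" by linarith
  have ss: "3 * (2::int) ^ m j * 2 ^ m j = 3 * 4 ^ m j" by (simp flip: power_mult_distrib)
  have "(2::int) ^ Suc (m j) \<le> 2 ^ rounds d N L" using j(2) by (intro power_increasing) auto
  moreover have "(2::int) ^ rounds d N L \<le> M" using bounds(5) by simp
  ultimately have mu_le: "2 * (2::int) ^ m j \<le> M" by simp
  have D'_M: "\<bar>D'\<bar> \<le> M" using D'_le bounds(1) u.D by linarith
  have M3: "3 \<le> M" using ss_le by (smt (verit) one_le_power)
  have MU: "\<sigma> vMU (int j) = 2 ^ m j" using \<sigma>(1) j(1) by (simp add: lp_store_def)
  show ?thesis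
    unfolding update_step_def wp_Sq
    apply (simp add: M3 M0 \<sigma>(2) MU ss ss_le mu_le abs_mult)
    apply (intro conjI)
    subgoal using M3 by simp
    apply (rule wp_For[where n = d and I = "\<lambda>i \<tau>. \<forall>x<i. \<tau> vH (int x) = h x"])
    subgoal by simp
    subgoal using \<sigma> by (simp add: lp_store_def)
    subgoal using Z by simp
    subgoal by simp
    subgoal premises p for i \<tau>
    proof -
      have fr: "\<tau> vB = \<sigma> vB" "\<tau> vA = \<sigma> vA" "\<tau> vDIM = \<sigma> vDIM" "\<tau> vBQ = \<sigma> vBQ" using p(2) by simp_all
      show ?thesis
        apply (rule wp_sum_into[where n = d and p = "int i" and f = "\<lambda>y. B i y * a j y"])
        subgoal by simp
        subgoal using \<sigma> fr by (simp add: lp_store_def)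
        subgoal using Z by simp
        subgoal using M0 by simp
        subgoal using p(3) M0 by simp
        subgoal by simp
        subgoal for \<tau>' q using \<sigma> p(1,3) fr j(1) M0 by (simp add: lp_store_def)
        subgoal using h_part[OF p(1)] bounds(2) by (meson order_trans)
        subgoal for \<tau>' using p(4) by (auto simp: less_Suc_eq h_def apply_mat_def)
        done
    qed
    subgoal premises p1 for \<sigma>1
    proof -
      have fr1: "\<sigma>1 vB = \<sigma> vB" "\<sigma>1 vA = \<sigma> vA" "\<sigma>1 vDIM = \<sigma> vDIM" "\<sigma>1 vBQ = \<sigma> vBQ" "\<sigma>1 vD = \<sigma> vD"
        "\<sigma>1 vSS 0 = 3 * 4 ^ m j" "\<sigma>1 vMU = (\<sigma> vMU)(int j := 2 * 2 ^ m j)" "\<sigma>1 vN = \<sigma> vN" using p1(1) by simp_all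
      show ?thesis
        unfolding wp_Sq
        apply (rule wp_sum_into[where n = d and p = 0 and f = "\<lambda>x. a j x * h x"])
        subgoal by simp
        subgoal using \<sigma> fr1 by (simp add: lp_store_def)
        subgoal using Z by simp
        subgoal using M0 by simp
        subgoal using M0 by simp
        subgoal by simp
        subgoal for \<tau>' q using \<sigma> p1(3) fr1 j(1) M0 by (simp add: lp_store_def)
        subgoal using s_part bounds(3) by (meson order_trans)
        subgoal premises p2 for \<sigma>2
        proof -
          have fr2: "\<sigma>2 vB = \<sigma> vB" "\<sigma>2 vA = \<sigma> vA" "\<sigma>2 vDIM = \<sigma> vDIM" "\<sigma>2 vD 0 = D"
            "\<sigma>2 vSS 0 = 3 * 4 ^ m j" "\<sigma>2 vH = \<sigma>1 vH" "\<sigma>2 vS 0 = idot d (a j) h"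
            using p2 fr1 \<sigma>(1) by (simp_all add: lp_store_def idot_def)
          have Deq: "D + 3 * 4 ^ m j * idot d (a j) h = D'" by (simp add: D'_def)
          show ?thesis
            apply (simp add: M0 fr2 Deq D'_M)
            apply (rule wp_For[where n = d and I = "\<lambda>i \<tau>. \<forall>x<d. \<forall>y<d. \<tau> vB (int x * int d + int y) = (if x < i then B' x y else B x y)"])
            subgoal by simp
            subgoal using \<sigma> fr2 by (simp add: lp_store_def)
            subgoal using Z by simp
            subgoal using \<sigma>(1) fr2 by (simp add: lp_store_def)
            subgoal premises p3 for i \<tau>
              apply (rule wp_For[where n = d and I = "\<lambda>k \<tau>. \<forall>x<d. \<forall>y<d. \<tau> vB (int x * int d + int y) = (if x < i \<or> x = i \<and> y < k then B' x y else B x y)"])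
              subgoal by simp
              subgoal using \<sigma> fr2 p3(2) by (simp add: lp_store_def)
              subgoal using Z by simp
              subgoal using p3(4) by simp
              subgoal premises p4 for k \<tau>'
              proof -
                have fr4: "\<tau>' vDIM 0 = int d" "\<tau>' jX 0 = int i" "\<tau>' jY 0 = int k" "\<tau>' vD 0 = D" "\<tau>' vD2 0 = D'"
                   "\<tau>' vSS 0 = 3 * 4 ^ m j" "\<tau>' vH (int i) = h i" "\<tau>' vH (int k) = h k"
                  using p4(1,2,3) p3(1,2,3) fr2 \<sigma>(1) p1(3) by (simp_all add: lp_store_def)
                have Bik: "\<tau>' vB (int i * int d + int k) = B i k" using p4(1,4) p3(1) by simp
                have "\<bar>B' i k\<bar> \<le> M" using B'_le[OF p3(1) p4(1)] bounds(1) by linarith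
                then show ?thesis
                  using p4(4) p4(1) p3(1)
                  by (auto simp: fr4 Bik B'_eq index_eq_iff less_Suc_eq)
              qed
              subgoal using p3(1) by (auto simp: less_Suc_eq)
              done
            subgoal premises p3 for \<tau>
            proof -
              have "\<tau> vD2 0 = D'" using p3(1) by simp
              then show ?thesis
                apply (simp add: M0 D'_M)
                apply (rule Q)
                subgoal using p3(1) p2(1) p1(1) by auto
                subgoal using p3(1,3) fr1 p2(1) \<sigma>(1) j(1) by (auto simp: lp_store_def B'_def)
                done
            qed
            done
        qed
        done
    qed
    done
qed

text \<open>Runs all steps and then rescales even if a solution is already known.
  \<open>find_step\<close> only ever sets the flag \<open>vFE\<close> to 1, so later rounds do no
  harm.\<close>

definition perceptron_round :: stm where
  "perceptron_round =
    For jQ vN (Asg vC (Sc jQ) (Num 0)) ;;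
    For iTT vT find_step ;;
    choose_row ;;
    update_step"

lemma wr_perceptron_round [simp]: "wr perceptron_round =
   {jQ, vC, iTT, jX, vG, vETA, jY, vVI, vS, vFE, vBQ, vSS, vMU, vH, vD2, vB, vD}"
  by (auto simp: perceptron_round_def)

definition feasible :: "nat \<Rightarrow> nat \<Rightarrow> (nat \<Rightarrow> nat \<Rightarrow> int) \<Rightarrow> bool" where
  "feasible d N a \<longleftrightarrow> (\<exists>y. \<forall>q<N. 0 < lin d (a q) y)"

text \<open>The claims about \<open>B\<close> and \<open>D\<close> are kept after success as well,
  because the remaining rounds still compute with these numbers and must stay within
  \<open>M\<close>.\<close>

definition round_inv :: "nat \<Rightarrow> nat \<Rightarrow> nat \<Rightarrow> (nat \<Rightarrow> nat \<Rightarrow> int) \<Rightarrow> nat \<Rightarrow> store \<Rightarrow> bool" where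
  "round_inv d N L a r \<sigma> \<longleftrightarrow> (\<exists>m B D. lp_store d N a m B D \<sigma> \<and> lp_adjugate d N L a m B D \<and> (\<Sum>q<N. m q) = r \<and>
     D \<le> (4 * (1 + int d * (int L)\<^sup>2)) ^ r \<and>
     (\<sigma> vFE 0 = 0 \<and> scaled_bound d N a m \<or> \<sigma> vFE 0 = 1 \<and> feasible d N a))"

lemma feasible_if_idot_pos:
  assumes "\<And>j. j < N \<Longrightarrow> 0 < idot d (a j) u"
  shows "feasible d N a"
proof -
  have "lin d (a j) (\<lambda>x. real_of_int (u x)) = real_of_int (idot d (a j) u)" for j
    by (simp add: lin_def idot_def)
  then show ?thesis unfolding feasible_def using assms by (intro exI[of _ "\<lambda>x. real_of_int (u x)"]) simp
qed

lemma wp_perceptron_round: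
  assumes inv: "round_inv d N L a r \<sigma>" and r: "r < rounds d N L"
    and M: "int (lp_bound d N L) \<le> M" and Zs: "int d \<le> Z" "int N \<le> Z" "int (steps d N L) \<le> Z" "Z \<le> M"
    and pos: "0 < d" "0 < N" "0 < L" and T: "\<sigma> vT 0 = int (steps d N L)"
    and Q: "\<And>\<tau>. (\<And>x. x \<notin> wr perceptron_round \<Longrightarrow> \<tau> x = \<sigma> x) \<Longrightarrow> round_inv d N L a (Suc r) \<tau> \<Longrightarrow> Q \<tau>"
  shows "wp M Z perceptron_round \<sigma> Q"
proof -
  let ?E = "1 + int d * (int L)\<^sup>2"
  let ?T = "steps d N L"
  from inv obtain m B D where st: "lp_store d N a m B D \<sigma>" and lp: "lp_adjugate d N L a m B D"
    and m_sum: "(\<Sum>q<N. m q) = r" and D_pow: "D \<le> (4 * ?E) ^ r"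
    and FE: "\<sigma> vFE 0 = 0 \<and> scaled_bound d N a m \<or> \<sigma> vFE 0 = 1 \<and> feasible d N a"
    unfolding round_inv_def by blast
  interpret lp_adjugate d N L a m B D by (rule lp)
  have m_le: "m q \<le> r" if "q < N" for q
    using member_le_sum[of q "{..<N}" m] that m_sum by simp
  have pow_le: "(4 * ?E) ^ i \<le> int (determinant_bound d N L)" if "i \<le> rounds d N L" for i
  proof -
    have "1 \<le> 4 * ?E" by (simp add: add_pos_nonneg)
    then have "(4 * ?E) ^ i \<le> (4 * ?E) ^ rounds d N L" using that by (intro power_increasing)
    then show ?thesis by (simp add: determinant_bound_def power2_eq_square mult.assoc)
  qed
  interpret lp_run d N L a m B D M Z "rounds d N L"
  proof
    show "D \<le> int (determinant_bound d N L)" using D_pow pow_le[of r] r by linarith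
    show "m q \<le> rounds d N L" if "q < N" for q using m_le[OF that] r by simp
  qed (use M Zs pos in auto)
  define g where "g c = weighted_sum N a m c" for c
  define form where "form c = idot d (g c) (apply_mat d B (g c))" for c
  have step_form: "form (c(j := c j + 1)) \<le> form c + D * ?E"
    if "j < N" "idot d (a j) (apply_mat d B (g c)) \<le> 0" for c j
  proof -
    have "g (c(j := c j + 1)) = (\<lambda>x. g c x + 2 ^ m j * a j x)"
    proof
      fix x
      have *: "(\<Sum>q<N. f q) = f j + (\<Sum>q\<in>{..<N}-{j}. f q)" for f :: "nat \<Rightarrow> int"
        using that by (intro sum.remove) auto
      show "g (c(j := c j + 1)) x = g c x + 2 ^ m j * a j x"
        unfolding g_def weighted_sum_def *[of "\<lambda>q. _ q * 2 ^ m q * a q x"] by (simp add: algebra_simps)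
    qed
    then show ?thesis unfolding form_def using step[OF that] by simp
  qed
  \<comment> \<open>While no solution is found, every step increases exactly one counter, so the
    counters sum to \<open>i\<close>, and the form grows by at most \<open>D * ?E\<close> per step.
    At \<open>i = ?T\<close> these are the premises of \<open>scaled_bound_Suc\<close>.\<close>
  define I where "I i \<tau> \<longleftrightarrow> (\<exists>c. (\<forall>q<N. \<tau> vC (int q) = c q \<and> 0 \<le> c q \<and> c q \<le> int i) \<and>
      (\<tau> vFE 0 = 0 \<and> scaled_bound d N a m \<and> (\<Sum>q<N. c q) = int i \<and> form c \<le> int i * (D * ?E) \<or>
       \<tau> vFE 0 = 1 \<and> feasible d N a))" for i and \<tau> :: store
  show ?thesis
    unfolding perceptron_round_def wp_Sq
    apply (rule wp_For[where n = N and I = "\<lambda>i \<tau>. \<forall>q<i. \<tau> vC (int q) = 0"])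
    subgoal by simp
    subgoal using st by (simp add: lp_store_def)
    subgoal using Zs by simp
    subgoal by simp
    subgoal using M0 by (auto simp: less_Suc_eq)
    subgoal premises p1 for \<sigma>1
      apply (rule wp_For[where n = ?T and I = I])
      subgoal by simp
      subgoal using T p1(1) by simp
      subgoal using Zs by simp
      subgoal
      proof -
        have "form (\<lambda>_. 0) = 0" by (simp add: form_def g_def weighted_sum_def idot_def)
        moreover have "\<sigma>1 vFE 0 = \<sigma> vFE 0" using p1(1) by simp
        ultimately show ?thesis unfolding I_def using FE p1(3) by (intro exI[of _ "\<lambda>_. 0"]) auto
      qed
      subgoal premises p for i \<tau>
      proof -
        from p(4) obtain c where c: "\<And>q. q < N \<Longrightarrow> \<tau> vC (int q) = c q" "\<And>q. q < N \<Longrightarrow> 0 \<le> c q" "\<And>q. q < N \<Longrightarrow> c q \<le> int i"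
          and cases: "\<tau> vFE 0 = 0 \<and> scaled_bound d N a m \<and> (\<Sum>q<N. c q) = int i \<and> form c \<le> int i * (D * ?E) \<or>
            \<tau> vFE 0 = 1 \<and> feasible d N a" unfolding I_def by blast
        have c3: "c q \<le> 1 + int i" if "q < N" for q using c(3)[OF that] by simp
        have st': "lp_store d N a m B D \<tau>" by (rule lp_store_cong[OF st]) (use p(2) p1(1) in auto)
        show ?thesis
        proof (rule wp_find_step[OF st' c(1)])
          fix q assume "q < N"
          then show "0 \<le> c q \<and> c q < int ?T" using c(2,3)[of q] p(1) by linarith
        next
          fix \<tau>' j assume *: "j < N" "idot d (a j) (apply_mat d B (weighted_sum N a m c)) \<le> 0"
            "\<tau>' vC = (\<tau> vC)(int j := c j + 1)" "\<tau>' vFE = \<tau> vFE"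
          have sum: "(\<Sum>q<N. (c(j := c j + 1)) q) = (\<Sum>q<N. c q) + 1"
          proof -
            have "(\<Sum>q<N. f q) = f j + (\<Sum>q\<in>{..<N}-{j}. f q)" for f :: "nat \<Rightarrow> int"
              using *(1) by (intro sum.remove) auto
            from this[of "c(j := c j + 1)"] this[of c] show ?thesis by simp
          qed
          have "form (c(j := c j + 1)) \<le> form c + D * ?E" by (rule step_form) (use * in \<open>auto simp: g_def\<close>)
          then have "form c \<le> int i * (D * ?E) \<Longrightarrow> form (c(j := c j + 1)) \<le> int (Suc i) * (D * ?E)"
            by (simp add: algebra_simps)
          then show "I (Suc i) (upd \<tau>' iTT 0 (1 + int i))"
            unfolding I_def using * c c3 cases sum
            by (intro exI[of _ "c(j := c j + 1)"]) (auto simp: add_increasing2 intro: order_trans)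
        next
          fix \<tau>' assume *: "\<And>j. j < N \<Longrightarrow> 0 < idot d (a j) (apply_mat d B (weighted_sum N a m c))"
            "\<tau>' vC = \<tau> vC" "\<tau>' vFE 0 = 1"
          have "feasible d N a" using *(1) by (rule feasible_if_idot_pos)
          then show "I (Suc i) (upd \<tau>' iTT 0 (1 + int i))"
            unfolding I_def using * c c3 by (intro exI[of _ c]) (auto intro: order_trans)
        qed
      qed
      subgoal premises p2 for \<sigma>2
      proof -
        from p2(3) obtain c where c: "\<And>q. q < N \<Longrightarrow> \<sigma>2 vC (int q) = c q" "\<And>q. q < N \<Longrightarrow> 0 \<le> c q"
          and cases: "\<sigma>2 vFE 0 = 0 \<and> scaled_bound d N a m \<and> (\<Sum>q<N. c q) = int ?T \<and> form c \<le> int ?T * (D * ?E) \<or>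
            \<sigma>2 vFE 0 = 1 \<and> feasible d N a" unfolding I_def by blast
        have fr2: "\<sigma>2 x = \<sigma> x" if "x \<notin> {jQ, vC, iTT, jX, vG, vETA, jY, vVI, vS, vFE}" for x
          using p1(1)[of x] p2(1)[of x] that by simp
        show ?thesis
        proof (rule wp_choose_row)
          show "\<sigma>2 vN 0 = int N" using st fr2 by (simp add: lp_store_def)
          fix \<sigma>3 j
          assume p3: "\<And>x. x \<notin> wr choose_row \<Longrightarrow> \<sigma>3 x = \<sigma>2 x" "\<sigma>3 vBQ 0 = int j" "j < N"
            "\<And>q. q < N \<Longrightarrow> \<sigma>2 vC (int q) \<le> \<sigma>2 vC (int j)"
          have st3: "lp_store d N a m B D \<sigma>3" by (rule lp_store_cong[OF st]) (use p3(1) fr2 in auto)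
          have sb: "\<sigma>2 vFE 0 = 0 \<and> scaled_bound d N a (m(j := Suc (m j))) \<or> \<sigma>2 vFE 0 = 1 \<and> feasible d N a"
            using cases
          proof (elim disjE conjE)
            assume *: "\<sigma>2 vFE 0 = 0" "scaled_bound d N a m" "(\<Sum>q<N. c q) = int ?T" "form c \<le> int ?T * (D * ?E)"
            have "scaled_bound d N a (m(j := Suc (m j)))"
            proof (rule scaled_bound_Suc[OF *(2) pos(1,2) c(2) *(3)])
              show "idot d (weighted_sum N a m c) (apply_mat d B (weighted_sum N a m c)) \<le> int ?T * ?E * D"
                using *(4) by (simp add: form_def g_def ac_simps)
              show "c q \<le> c j" if "q < N" for q using p3(4)[OF that] c(1)[OF that] c(1)[OF p3(3)] by simp
            qed (use p3 in auto)
            with * show ?thesis by simp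
          qed simp
          have D'_le: "D + 3 * 4 ^ m j * idot d (a j) (apply_mat d B (a j)) \<le> (4 * ?E) ^ Suc r"
          proof -
            have "D + 3 * 4 ^ m j * idot d (a j) (apply_mat d B (a j)) \<le> D * (4 * ?E)"
              by (rule update(2)[OF p3(3)])
            also have "\<dots> \<le> (4 * ?E) ^ r * (4 * ?E)"
              using D_pow by (intro mult_right_mono) auto
            finally show ?thesis by (simp add: mult.commute)
          qed
          show "wp M Z update_step \<sigma>3 Q"
          proof (rule wp_update_step[OF st3 p3(2,3)])
            show "m j < rounds d N L" using m_le[OF p3(3)] r by simp
            show "D + 3 * 4 ^ m j * idot d (a j) (apply_mat d B (a j)) \<le> int (determinant_bound d N L)"
              using D'_le pow_le[of "Suc r"] r by linarith
            fix \<tau>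
            let ?D' = "D + 3 * 4 ^ m j * idot d (a j) (apply_mat d B (a j))"
            let ?B' = "\<lambda>x y. (?D' * B x y - 3 * 4 ^ m j * apply_mat d B (a j) x * apply_mat d B (a j) y) div D"
            assume p4: "\<And>x. x \<notin> wr update_step \<Longrightarrow> \<tau> x = \<sigma>3 x"
              "lp_store d N a (m(j := Suc (m j))) ?B' ?D' \<tau>"
            have "(\<Sum>q<N. (m(j := Suc (m j))) q) = Suc r"
            proof -
              have "(\<Sum>q<N. f q) = f j + (\<Sum>q\<in>{..<N}-{j}. f q)" for f :: "nat \<Rightarrow> nat"
                using p3(3) by (intro sum.remove) auto
              from this[of "m(j := Suc (m j))"] this[of m] m_sum show ?thesis by simp
            qed
            moreover have "\<tau> vFE 0 = \<sigma>2 vFE 0" using p4(1) p3(1) by simp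
            ultimately have "round_inv d N L a (Suc r) \<tau>"
              unfolding round_inv_def using p4(2) update(1)[OF p3(3)] D'_le sb by fastforce
            then show "Q \<tau>" by (rule Q[rotated]) (use p4(1) p3(1) fr2 in auto)
          qed
        qed (use Zs pos in auto)
      qed
      done
    done
qed

definition init_lp :: stm where
  "init_lp =
    For jX vDIM (For jY vDIM (Asg vB (Sc jX \<^bold>* Sc vDIM \<^bold>+ Sc jY) (Num 0)) ;; Asg vB (Sc jX \<^bold>* Sc vDIM \<^bold>+ Sc jX) (Num 1)) ;;
    Asg vD (Num 0) (Num 1) ;;
    For jQ vN (Asg vMU (Sc jQ) (Num 1)) ;;
    Asg vFE (Num 0) (Num 0)"

lemma wr_init_lp [simp]: "wr init_lp = {jX, jY, vB, vD, jQ, vMU, vFE}"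
  by (auto simp: init_lp_def)

lemma wp_init_lp:
  assumes \<sigma>: "\<sigma> vDIM 0 = int d" "\<sigma> vN 0 = int N" "\<And>q x. q < N \<Longrightarrow> x < d \<Longrightarrow> \<sigma> vA (int q * int d + int x) = a q x"
    and L: "\<And>q x. q < N \<Longrightarrow> x < d \<Longrightarrow> \<bar>a q x\<bar> \<le> int L"
    and M: "1 \<le> M" "int d \<le> Z" "int N \<le> Z"
    and Q: "\<And>\<tau>. (\<And>x. x \<notin> wr init_lp \<Longrightarrow> \<tau> x = \<sigma> x) \<Longrightarrow> round_inv d N L a 0 \<tau> \<Longrightarrow> Q \<tau>"
  shows "wp M Z init_lp \<sigma> Q"
proof -
  let ?id = "\<lambda>x y. if x = y then 1 else 0 :: int"
  have M0: "0 \<le> M" using M by simp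
  show ?thesis
    unfolding init_lp_def wp_Sq
    apply (rule wp_For[where n = d and I = "\<lambda>i \<tau>. \<forall>x<i. \<forall>y<d. \<tau> vB (int x * int d + int y) = ?id x y"])
    subgoal by simp
    subgoal using \<sigma> by simp
    subgoal using M by simp
    subgoal by simp
    subgoal premises p for i \<tau>
      unfolding wp_Sq
      apply (rule wp_For[where n = d and I = "\<lambda>k \<tau>. (\<forall>x<i. \<forall>y<d. \<tau> vB (int x * int d + int y) = ?id x y) \<and>
          (\<forall>y<k. \<tau> vB (int i * int d + int y) = 0)"])
      subgoal by simp
      subgoal using \<sigma> p by simp
      subgoal using M by simp
      subgoal using p by simp
      subgoal premises q for k \<tau>'
      proof -
        have "\<tau>' vDIM 0 = int d" "\<tau>' jX 0 = int i" using q(2) p(2,3) \<sigma>(1) by simp_all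
        then show ?thesis using q(1,3,4) p(1) M0 by (auto simp: index_eq_iff less_Suc_eq)
      qed
      subgoal premises q for \<tau>'
      proof -
        have "\<tau>' vDIM 0 = int d" "\<tau>' jX 0 = int i" using q(1) p(2,3) \<sigma>(1) by simp_all
        then show ?thesis using q(3) p(1) M M0 by (auto simp: index_eq_iff less_Suc_eq)
      qed
      done
    subgoal premises p1 for \<sigma>1
      apply (simp add: M M0)
      apply (rule wp_For[where n = N and I = "\<lambda>i \<tau>. \<forall>q<i. \<tau> vMU (int q) = 1"])
      subgoal by simp
      subgoal using \<sigma> p1(1) by simp
      subgoal using M by simp
      subgoal by simp
      subgoal using M M0 by (auto simp: less_Suc_eq)
      subgoal premises p2 for \<sigma>2
        apply (rule Q)
        subgoal using p1(1) p2(1) by auto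
        subgoal
        proof -
          have "lp_store d N a (\<lambda>_. 0) ?id 1 (upd \<sigma>2 vFE 0 0)"
            using p1(1,3) p2(1,3) \<sigma> by (simp add: lp_store_def)
          moreover have "lp_adjugate d N L a (\<lambda>_. 0) ?id 1"
            unfolding lp_adjugate_def gram_0 using L adjugate_one by simp
          moreover have "scaled_bound d N a (\<lambda>_. 0)" by (simp add: scaled_bound_def)
          ultimately show ?thesis unfolding round_inv_def
            by (intro exI[of _ "\<lambda>_. 0"] exI[of _ ?id] exI[of _ 1]) simp
        qed
        done
      done
    done
qed

definition decide_feasible :: stm where
  "decide_feasible = init_lp ;; For iRR vR perceptron_round"

lemma wr_decide_feasible [simp]: "wr decide_feasible =
   {iRR, jQ, vC, iTT, jX, vG, vETA, jY, vVI, vS, vFE, vBQ, vSS, vMU, vH, vD2, vB, vD}"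
  by (auto simp: decide_feasible_def)

text \<open>If the flag is still 0 at the end, then \<open>scaled_bound\<close> holds for exponents
  with sum \<open>rounds d N L\<close>, which \<open>infeasible_if_scaled_bound\<close> excludes for
  a solvable system.\<close>

lemma wp_decide_feasible:
  assumes \<sigma>: "\<sigma> vDIM 0 = int d" "\<sigma> vN 0 = int N" "\<sigma> vT 0 = int (steps d N L)" "\<sigma> vR 0 = int (rounds d N L)"
      "\<And>q x. q < N \<Longrightarrow> x < d \<Longrightarrow> \<sigma> vA (int q * int d + int x) = a q x"
    and L: "\<And>q x. q < N \<Longrightarrow> x < d \<Longrightarrow> \<bar>a q x\<bar> \<le> int L"
    and M: "int (lp_bound d N L) \<le> M" and Z: "int d \<le> Z" "int N \<le> Z" "int (steps d N L) \<le> Z" "int (rounds d N L) \<le> Z" "Z \<le> M"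
    and pos: "0 < d" "0 < N" "0 < L"
    and Q: "\<And>\<tau>. (\<And>x. x \<notin> wr decide_feasible \<Longrightarrow> \<tau> x = \<sigma> x) \<Longrightarrow> \<tau> vFE 0 = (if feasible d N a then 1 else 0) \<Longrightarrow> Q \<tau>"
  shows "wp M Z decide_feasible \<sigma> Q"
proof -
  have M1: "1 \<le> M" using Z pos by linarith
  show ?thesis
    unfolding decide_feasible_def wp_Sq
  proof (rule wp_init_lp[OF \<sigma>(1,2,5) L M1 Z(1,2)])
    fix \<sigma>1
    assume p1: "\<And>x. x \<notin> wr init_lp \<Longrightarrow> \<sigma>1 x = \<sigma> x" "round_inv d N L a 0 \<sigma>1"
    have upd_inv: "round_inv d N L a r (upd \<tau> iRR 0 v) = round_inv d N L a r \<tau>" for r \<tau> v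
      by (simp add: round_inv_def lp_store_def)
    show "wp M Z (For iRR vR perceptron_round) \<sigma>1 Q"
      apply (rule wp_For[where n = "rounds d N L" and I = "round_inv d N L a"])
      subgoal by simp
      subgoal using \<sigma> p1(1) by simp
      subgoal using Z by simp
      subgoal unfolding upd_inv by (rule p1(2))
      subgoal premises p for i \<tau>
      proof (rule wp_perceptron_round[OF p(4) p(1) M Z(1,2,3,5) pos])
        show "\<tau> vT 0 = int (steps d N L)" using p(2) p1(1) \<sigma> by simp
      qed (unfold upd_inv)
      subgoal premises p for \<tau>
      proof (rule Q)
        from p(3) obtain m where "(\<Sum>q<N. m q) = rounds d N L"
          "\<tau> vFE 0 = 0 \<and> scaled_bound d N a m \<or> \<tau> vFE 0 = 1 \<and> feasible d N a"
          unfolding round_inv_def by blast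
        then show "\<tau> vFE 0 = (if feasible d N a then 1 else 0)"
          using infeasible_if_scaled_bound[where a = a and m = m, OF _ _ L pos(2,3,1)] unfolding feasible_def by auto
      qed (use p(1) p1(1) in auto)
      done
  qed
qed

subsection \<open>The decision procedure\<close>

abbreviation (input) "vOV \<equiv> 25 :: nat"
abbreviation (input) "vLV \<equiv> 26 :: nat"
abbreviation (input) "vOW \<equiv> 27 :: nat"
abbreviation (input) "vLW \<equiv> 28 :: nat"
abbreviation (input) "vNV \<equiv> 29 :: nat"
abbreviation (input) "vLL \<equiv> 31 :: nat"
abbreviation (input) "vP \<equiv> 32 :: nat"
abbreviation (input) "iS \<equiv> 33 :: nat"
abbreviation (input) "iQ \<equiv> 34 :: nat"
abbreviation (input) "iY \<equiv> 35 :: nat"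

definition exponent_vector :: "nat \<Rightarrow> nat \<Rightarrow> nat \<Rightarrow> stm" where
  "exponent_vector off len code =
    Asg vO (Num 0) (Sc off) ;; Asg vL (Num 0) (Sc len) ;; Asg vCODE (Num 0) (Sc code) ;;
    decode_digits ;; compute_path ;; count_transitions"

lemma wr_exponent_vector [simp]: "wr (exponent_vector off len code) =
    {vO, vL, vCODE, vCD, vBASE, vAL, iM, vL1, iT, vPI, iX, vQ, vX}"
  by (auto simp: exponent_vector_def)

lemma wp_exponent_vector:
  assumes ids: "off \<notin> {vO, vL, vCODE}" "len \<notin> {vO, vL, vCODE}" "code \<notin> {vO, vL, vCODE}"
    and \<sigma>: "\<sigma> vDIM 0 = int (nvars k (Suc n'))" "\<sigma> vNN 0 = int (Suc n')" "\<sigma> vN1 0 = int n'" "\<sigma> vK 0 = int k"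
    "\<sigma> off 0 = int a" "\<sigma> len 0 = int (length w)" "\<sigma> code 0 = int c"
    and word: "\<And>t. t < length w \<Longrightarrow> \<sigma> 0 (int (a + t)) = int (w ! t)" "set w \<subseteq> {..<k}"
    and M: "int (length w) + 2 \<le> Z" "int (nvars k (Suc n')) \<le> Z" "int n' \<le> Z" "int c \<le> Z" "int a \<le> Z" "Z \<le> M"
    and Q: "\<And>\<tau>. (\<And>x. x \<notin> wr (exponent_vector off len code) \<Longrightarrow> \<tau> x = \<sigma> x) \<Longrightarrow>
      (\<And>x. x < nvars k (Suc n') \<Longrightarrow> \<tau> vQ (int x) = expvec k (Suc n') w (code_path n' (length w) c) x) \<Longrightarrow> Q \<tau>"
  shows "wp M Z (exponent_vector off len code) \<sigma> Q"
proof -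
  have M0: "0 \<le> M" "int a \<le> M" "int (length w) \<le> M" "int c \<le> M" using M by linarith+
  define \<sigma>' where "\<sigma>' = upd (upd (upd \<sigma> vO 0 (int a)) vL 0 (int (length w))) vCODE 0 (int c)"
  have fr0: "\<sigma>' x = \<sigma> x" if "x \<notin> {vO, vL, vCODE}" for x using that by (simp add: \<sigma>'_def)
  have s0: "\<sigma>' vO 0 = int a" "\<sigma>' vL 0 = int (length w)" "\<sigma>' vCODE 0 = int c" by (simp_all add: \<sigma>'_def)
  have "wp M Z (decode_digits ;; compute_path ;; count_transitions) \<sigma>' Q"
    unfolding wp_Sq
  proof (rule wp_decode_digits[where n' = n' and l = "length w" and c = c])
    fix \<sigma>1 assume p1: "\<And>x. x \<notin> wr decode_digits \<Longrightarrow> \<sigma>1 x = \<sigma>' x"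
      "\<And>m. m < n' \<Longrightarrow> \<sigma>1 vAL (int m) = int (digit (length w + 2) c m)"
    show "wp M Z compute_path \<sigma>1 (\<lambda>\<tau>. wp M Z count_transitions \<tau> Q)"
    proof (rule wp_compute_path[where n' = n' and l = "length w" and c = c])
      fix \<sigma>2 assume p2: "\<And>x. x \<notin> wr compute_path \<Longrightarrow> \<sigma>2 x = \<sigma>1 x"
        "\<And>t. t \<le> length w \<Longrightarrow> \<sigma>2 vPI (int t) = int (code_path n' (length w) c t)"
      show "wp M Z count_transitions \<sigma>2 Q"
      proof (rule wp_count_transitions[where n = "Suc n'" and k = k and w = w and a = a and \<pi> = "code_path n' (length w) c"])
        show "code_path n' (length w) c t < Suc n'" for t using code_path_le[of n' "length w" c t] by simp
        fix \<tau> assume p3: "\<And>x. x \<notin> wr count_transitions \<Longrightarrow> \<tau> x = \<sigma>2 x"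
          "\<And>x. x < nvars k (Suc n') \<Longrightarrow> \<tau> vQ (int x) = expvec k (Suc n') w (code_path n' (length w) c) x"
        show "Q \<tau>" by (rule Q) (use p3 p2(1) p1(1) fr0 in auto)
      next
        show "\<sigma>2 0 (int (a + t)) = int (w ! t)" if "t < length w" for t
        proof -
          have "\<sigma>2 0 = \<sigma> 0" using p2(1) p1(1) fr0 by simp
          then show ?thesis using word(1)[OF that] by simp
        qed
      qed (use p2 p1(1) fr0 s0 \<sigma> word M in auto)
    qed (use p1 fr0 s0 \<sigma> M in auto)
  qed (use fr0 s0 \<sigma> M in auto)
  then show ?thesis
    unfolding exponent_vector_def \<sigma>'_def using ids \<sigma> M0 by simp
qed

definition compute_power :: "nat \<Rightarrow> nat \<Rightarrow> stm" where
  "compute_power res len = Asg res (Num 0) (Num 1) ;; For iM vN1 (Asg res (Num 0) (Sc res \<^bold>* (Sc len \<^bold>+ Num 2)))"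

lemma wr_compute_power [simp]: "wr (compute_power res len) = {res, iM}"
  by (auto simp: compute_power_def)

lemma wp_compute_power:
  assumes ids: "res \<noteq> len" "res \<noteq> iM" "len \<noteq> iM" "res \<noteq> vN1"
    and \<sigma>: "\<sigma> vN1 0 = int n'" "\<sigma> len 0 = int l"
    and M: "int ((l + 2) ^ n') \<le> M" "int n' \<le> Z" "2 \<le> M"
    and Q: "\<And>\<tau>. (\<And>x. x \<notin> wr (compute_power res len) \<Longrightarrow> \<tau> x = \<sigma> x) \<Longrightarrow> \<tau> res 0 = int ((l + 2) ^ n') \<Longrightarrow> Q \<tau>"
  shows "wp M Z (compute_power res len) \<sigma> Q"
proof -
  have pow_le: "int ((l + 2) ^ i) \<le> M" if "i \<le> n'" for i
  proof -
    have "(l + 2) ^ i \<le> (l + 2) ^ n'" using that by (intro power_increasing) auto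
    then show ?thesis using M(1) by linarith
  qed
  show ?thesis
    unfolding compute_power_def wp_Sq
    apply (simp add: M)
    apply (intro conjI)
    subgoal using M by simp
    subgoal using M by simp
    apply (rule wp_For[where n = n' and I = "\<lambda>i \<tau>. \<tau> res 0 = int ((l + 2) ^ i)"])
    subgoal using ids by simp
    subgoal using \<sigma> ids by simp
    subgoal using M by simp
    subgoal using ids by simp
    subgoal premises p for i \<tau>
    proof -
      have "\<tau> len 0 = int l" using p(2) ids \<sigma> by simp
      moreover have "int ((l + 2) ^ i) * (int l + 2) = int ((l + 2) ^ Suc i)" by (simp add: algebra_simps)
      ultimately show ?thesis using p(4) pow_le[of "Suc i"] p(1) M ids by (simp del: power_Suc of_nat_power)
    qed
    subgoal using Q ids by simp
    done
qed

text \<open>\<open>vT\<close> and \<open>vR\<close> evaluate \<open>steps\<close> and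
  \<open>rounds\<close>; the closed forms of these make one assignment each sufficient. The exponent
  vector of the first word is saved in \<open>vP\<close>, because those of the second word reuse
  \<open>vQ\<close>.\<close>

definition test_pair :: stm where
  "test_pair =
    compute_power vNV vLV ;;
    compute_power vN vLW ;;
    Asg vLL (Num 0) (Sc vLV \<^bold>+ Sc vLW \<^bold>+ Num 2) ;;
    Asg vT (Num 0) (Num 4 \<^bold>* Sc vN \<^bold>* Sc vN \<^bold>* (Sc vDIM \<^bold>+ Sc vN) \<^bold>* (Num 1 \<^bold>+ Sc vDIM \<^bold>* Sc vLL \<^bold>* Sc vLL)) ;;
    Asg vR (Num 0) (Sc vN \<^bold>* (Sc vDIM \<^bold>* (Num 1 \<^bold>+ Sc vN \<^bold>* (Sc vLL \<^bold>* Sc vLL)) \<^bold>* (Sc vDIM \<^bold>+ Num 2)) \<^bold>+ Num 1) ;;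
    For iS vNV (
      exponent_vector vOV vLV iS ;;
      For iY vDIM (Asg vP (Sc iY) (Rd vQ (Sc iY))) ;;
      For iQ vN (
        exponent_vector vOW vLW iQ ;;
        For iY vDIM (Asg vA (Sc iQ \<^bold>* Sc vDIM \<^bold>+ Sc iY) (Rd vP (Sc iY) \<^bold>- Rd vQ (Sc iY)))) ;;
      decide_feasible ;;
      Cond (Sc vFE) (Asg vRES (Num 0) (Num 0)) (Asg vRES (Num 0) (Sc vRES)))"

lemma wr_test_pair [simp]: "wr test_pair = {vNV, iM, vN, vLL, vT, vR, iS, vP, iY, iQ, vA, vRES} \<union>
    {vO, vL, vCODE, vCD, vBASE, vAL, iM, vL1, iT, vPI, iX, vQ, vX} \<union>
    {iRR, jQ, vC, iTT, jX, vG, vETA, jY, vVI, vS, vFE, vBQ, vSS, vMU, vH, vD2, vB, vD}"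
  unfolding test_pair_def by (simp only: wr.simps wr_compute_power wr_exponent_vector wr_decide_feasible) blast

lemma expvec_bounds: "0 \<le> expvec k n w \<pi> x" "expvec k n w \<pi> x \<le> int (length w) + 2"
proof -
  define S where "S = (\<Sum>t<length w. if x = (w ! t * n + \<pi> t) * n + \<pi> (Suc t) then 1 else 0 :: int)"
  have eq: "expvec k n w \<pi> x = S + (if x = k * n * n + \<pi> 0 then 1 else 0) + (if x = k * n * n + n + \<pi> (length w) then 1 else 0)"
    by (simp only: expvec_def S_def)
  have "0 \<le> S" unfolding S_def by (intro sum_nonneg) auto
  moreover have "S \<le> (\<Sum>t<length w. 1)" unfolding S_def by (intro sum_mono) auto
  ultimately show "0 \<le> expvec k n w \<pi> x" "expvec k n w \<pi> x \<le> int (length w) + 2"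
    unfolding eq by simp_all
qed

text \<open>A code has \<open>n'\<close> digits in base \<open>l + 2\<close>; the number of codes is
  polynomial in \<open>l\<close> because \<open>n'\<close> is fixed.\<close>

definition codes :: "nat \<Rightarrow> nat \<Rightarrow> nat" where
  "codes n' l = (l + 2) ^ n'"

lemma codes_pos: "0 < codes n' l"
  by (simp add: codes_def)

definition difference_rows :: "nat \<Rightarrow> nat \<Rightarrow> nat list \<Rightarrow> nat list \<Rightarrow> nat \<Rightarrow> nat \<Rightarrow> nat \<Rightarrow> int" where
  "difference_rows k n' v w c c' x = expvec k (Suc n') v (code_path n' (length v) c) x - expvec k (Suc n') w (code_path n' (length w) c') x"

lemma separated_iff: "separated k n' v w \<longleftrightarrow>
    (\<exists>c<codes n' (length v). feasible (nvars k (Suc n')) (codes n' (length w)) (difference_rows k n' v w c))"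
  unfolding separated_def feasible_def difference_rows_def codes_def by auto

text \<open>No exponent is negative, and none exceeds the length of the word plus 2 for the end
  marks; this gives the coefficient bound \<open>L\<close> of the solver.\<close>

lemma abs_difference_rows_le: "\<bar>difference_rows k n' v w c c' x\<bar> \<le> int (length v + length w + 2)"
  unfolding difference_rows_def
  using expvec_bounds[of k "Suc n'" v "code_path n' (length v) c" x] expvec_bounds[of k "Suc n'" w "code_path n' (length w) c'" x]
  by (simp add: abs_le_iff)

text \<open>Not symmetric in the words, as the inequalities are indexed by the codes of the second
  one; the two passes use it in both orders.\<close>

definition loop_bound :: "nat \<Rightarrow> nat \<Rightarrow> nat list \<Rightarrow> nat list \<Rightarrow> nat" where
  "loop_bound n' k v w = k + length v + length w + 5 + n' + nvars k (Suc n') + codes n' (length v) + codes n' (length w) +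
     steps (nvars k (Suc n')) (codes n' (length w)) (length v + length w + 2) +
     rounds (nvars k (Suc n')) (codes n' (length w)) (length v + length w + 2)"

lemma wp_test_pair:
  fixes v w :: "nat list" and k n' :: nat
  defines "d \<equiv> nvars k (Suc n')" and "L \<equiv> length v + length w + 2"
  assumes \<sigma>: "\<sigma> vDIM 0 = int d" "\<sigma> vNN 0 = int (Suc n')" "\<sigma> vN1 0 = int n'" "\<sigma> vK 0 = int k"
      "\<sigma> vOV 0 = int a" "\<sigma> vOW 0 = int b" "\<sigma> vLV 0 = int (length v)" "\<sigma> vLW 0 = int (length w)" "\<sigma> vRES 0 \<in> {0, 1}"
    and words: "\<And>t. t < length v \<Longrightarrow> \<sigma> 0 (int (a + t)) = int (v ! t)" "set v \<subseteq> {..<k}"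
      "\<And>t. t < length w \<Longrightarrow> \<sigma> 0 (int (b + t)) = int (w ! t)" "set w \<subseteq> {..<k}"
    and ab: "a \<le> length v + length w + 3" "b \<le> length v + length w + 3"
    and M: "int (loop_bound n' k v w) \<le> Z" "Z \<le> M" "int (lp_bound d (codes n' (length w)) L) \<le> M"
    and Q: "\<And>\<tau>. (\<And>x. x \<notin> wr test_pair \<Longrightarrow> \<tau> x = \<sigma> x) \<Longrightarrow> \<tau> vRES 0 = (if separated k n' v w then 0 else \<sigma> vRES 0) \<Longrightarrow> Q \<tau>"
  shows "wp M Z test_pair \<sigma> Q"
proof -
  let ?W = "{iS, vP, iY, iQ, vA, vRES, vO, vL, vCODE, vCD, vBASE, vAL, iM, vL1, iT, vPI, iX, vQ, vX,
    iRR, jQ, vC, iTT, jX, vG, vETA, jY, vVI, vS, vFE, vBQ, vSS, vMU, vH, vD2, vB, vD}"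
  define N where "N = codes n' (length w)"
  define NV where "NV = codes n' (length v)"
  have Z: "int (length v) + 3 \<le> Z" "int (length w) + 3 \<le> Z" "int d \<le> Z" "int n' \<le> Z" "int N \<le> Z" "int NV \<le> Z"
      "int (steps d N L) \<le> Z" "int (rounds d N L) \<le> Z" "int a \<le> Z" "int b \<le> Z" "int L \<le> Z" "5 \<le> Z"
    using M(1) ab unfolding loop_bound_def N_def NV_def d_def L_def by linarith+
  have bZ: "int (length v) + 2 \<le> Z" "int (length w) + 2 \<le> Z" using Z by linarith+
  have M0: "0 \<le> M" "1 \<le> M" "2 \<le> M" "4 \<le> M" using Z M(2) by linarith+
  have NM: "int N \<le> M" "int NV \<le> M" "int L \<le> M" "int (steps d N L) \<le> M" "int (rounds d N L) \<le> M" using Z M(2) by linarith+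
  have pos: "0 < d" "0 < N" "0 < L" by (simp_all add: d_def nvars_def N_def codes_pos L_def)
  define rows where "rows c = difference_rows k n' v w c" for c
  have rows_le: "\<bar>rows c q x\<bar> \<le> int L" for c q x unfolding rows_def L_def by (rule abs_difference_rows_le)
  define PV where "PV c = expvec k (Suc n') v (code_path n' (length v) c)" for c
  define QV where "QV c = expvec k (Suc n') w (code_path n' (length w) c)" for c
  have rows: "rows c q x = PV c x - QV q x" for c q x by (simp add: rows_def difference_rows_def PV_def QV_def)
  have PV_le: "\<bar>PV c x\<bar> \<le> M" for c x
    using expvec_bounds[of k "Suc n'" v "code_path n' (length v) c" x] Z(1) M(2) unfolding PV_def by linarith
  have LL: "int (length v) + int (length w) + 2 = int L" by (simp add: L_def)
  have steps: "4 * int N * int N * (int d + int N) * (1 + int d * int L * int L) = int (steps d N L)"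
    by (simp only: steps_def of_nat_mult of_nat_add of_nat_1 of_nat_numeral)
  have rounds: "int N * (int d * (1 + int N * (int L * int L)) * (int d + 2)) + 1 = int (rounds d N L)"
    by (simp only: rounds_def width_def power2_eq_square of_nat_mult of_nat_add of_nat_1 of_nat_numeral)
  show ?thesis
    unfolding test_pair_def wp_Sq
    apply (rule wp_compute_power[where n' = n' and l = "length v"])
    subgoal by simp
    subgoal by simp
    subgoal by simp
    subgoal by simp
    subgoal by (rule \<sigma>)
    subgoal by (rule \<sigma>)
    subgoal using NM by (simp add: NV_def codes_def)
    subgoal by (rule Z)
    subgoal by (rule M0)
    subgoal premises p1 for \<sigma>1
      apply (rule wp_compute_power[where n' = n' and l = "length w"])
      subgoal by simp
      subgoal by simp
      subgoal by simp
      subgoal by simp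
      subgoal using p1(1) \<sigma> by simp
      subgoal using p1(1) \<sigma> by simp
      subgoal using NM by (simp add: N_def codes_def)
      subgoal by (rule Z)
      subgoal by (rule M0)
      subgoal premises p2 for \<sigma>2
      proof -
        have fr2: "\<sigma>2 x = \<sigma> x" if "x \<notin> {vNV, vN, iM}" for x using p1(1)[of x] p2(1)[of x] that by simp
        have s2: "\<sigma>2 vLV 0 = int (length v)" "\<sigma>2 vLW 0 = int (length w)" "\<sigma>2 vDIM 0 = int d" using fr2 \<sigma> by simp_all
        have n2: "\<sigma>2 vN 0 = int N" "\<sigma>2 vNV 0 = int NV" using p2 p1(2) by (simp_all add: N_def NV_def codes_def)
        define \<sigma>3 where "\<sigma>3 = upd (upd (upd \<sigma>2 vLL 0 (int L)) vT 0 (int (steps d N L))) vR 0 (int (rounds d N L))"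
        have fr3: "\<sigma>3 x = \<sigma> x" if "x \<notin> {vNV, vN, iM, vLL, vT, vR}" for x using fr2[of x] that by (simp add: \<sigma>3_def)
        have n3: "\<sigma>3 vN 0 = int N" "\<sigma>3 vNV 0 = int NV" "\<sigma>3 vT 0 = int (steps d N L)" "\<sigma>3 vR 0 = int (rounds d N L)"
          using n2 by (simp_all add: \<sigma>3_def)
        have "wp M Z (For iS vNV (
          exponent_vector vOV vLV iS ;;
          For iY vDIM (Asg vP (Sc iY) (Rd vQ (Sc iY))) ;;
          For iQ vN (
            exponent_vector vOW vLW iQ ;;
            For iY vDIM (Asg vA (Sc iQ \<^bold>* Sc vDIM \<^bold>+ Sc iY) (Rd vP (Sc iY) \<^bold>- Rd vQ (Sc iY)))) ;;
          decide_feasible ;;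
          Cond (Sc vFE) (Asg vRES (Num 0) (Num 0)) (Asg vRES (Num 0) (Sc vRES)))) \<sigma>3 Q"
          apply (rule wp_For[where n = NV and I = "\<lambda>i \<tau>. \<tau> vRES 0 = (if \<exists>c<i. feasible d N (rows c) then 0 else \<sigma> vRES 0)"])
          subgoal by simp
          subgoal by (rule n3)
          subgoal by (rule Z)
          subgoal using fr3 by simp
          subgoal premises p4 for i \<sigma>4
          proof -
            have fr4: "\<sigma>4 x = \<sigma>3 x" if "x \<notin> ?W" for x
              by (rule p4(2)) (use that in simp)
            have iZ: "int i \<le> Z" using p4(1) Z by linarith
            have s4: "\<sigma>4 vDIM 0 = int d" "\<sigma>4 vNN 0 = int (Suc n')" "\<sigma>4 vN1 0 = int n'" "\<sigma>4 vK 0 = int k"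
              "\<sigma>4 vOV 0 = int a" "\<sigma>4 vLV 0 = int (length v)" "\<sigma>4 0 = \<sigma> 0"
              using fr4 fr3 \<sigma> by simp_all
            show ?thesis
              unfolding wp_Sq
            proof (rule wp_exponent_vector[where k = k and n' = n' and a = a and w = v and c = i])
              fix \<sigma>5 assume p5: "\<And>x. x \<notin> wr (exponent_vector vOV vLV iS) \<Longrightarrow> \<sigma>5 x = \<sigma>4 x"
                "\<And>x. x < nvars k (Suc n') \<Longrightarrow> \<sigma>5 vQ (int x) = expvec k (Suc n') v (code_path n' (length v) i) x"
              show "wp M Z (For iY vDIM (Asg vP (Sc iY) (Rd vQ (Sc iY)))) \<sigma>5 (\<lambda>\<tau>. wp M Z (For iQ vN (
                  exponent_vector vOW vLW iQ ;;
                  For iY vDIM (Asg vA (Sc iQ \<^bold>* Sc vDIM \<^bold>+ Sc iY) (Rd vP (Sc iY) \<^bold>- Rd vQ (Sc iY))))) \<tau> (\<lambda>\<tau>.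
                wp M Z decide_feasible \<tau> (\<lambda>\<tau>. wp M Z (Cond (Sc vFE) (Asg vRES (Num 0) (Num 0)) (Asg vRES (Num 0) (Sc vRES))) \<tau> (\<lambda>\<tau>'.
                upd \<tau>' iS 0 (1 + int i) vRES 0 = (if \<exists>c<Suc i. feasible d N (rows c) then 0 else \<sigma> vRES 0)))))"
                apply (rule wp_For[where n = d and I = "\<lambda>j \<tau>. \<forall>x<j. \<tau> vP (int x) = PV i x"])
                subgoal by simp
                subgoal using p5(1) fr4 fr3 \<sigma> by simp
                subgoal by (rule Z)
                subgoal by simp
                subgoal premises p for j \<tau>
                proof -
                  have "\<tau> vQ (int j) = PV i j" using p(1,2) p5(2) by (simp add: PV_def d_def)
                  then show ?thesis using p(1,3,4) PV_le M0 by (auto simp: less_Suc_eq)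
                qed
                subgoal premises p6 for \<sigma>6
                  apply (rule wp_For[where n = N and I = "\<lambda>j \<tau>. \<forall>q<j. \<forall>x<d. \<tau> vA (int q * int d + int x) = rows i q x"])
                  subgoal by simp
                  subgoal using p6(1) p5(1) fr4 n3 by simp
                  subgoal by (rule Z)
                  subgoal by simp
                  subgoal premises p7 for j \<sigma>7
                  proof -
                    have fr7: "\<sigma>7 x = \<sigma>3 x" if "x \<notin> ?W" for x
                      using that p7(2)[of x] p6(1)[of x] p5(1)[of x] fr4[of x] by simp
                    have P7: "\<sigma>7 vP = \<sigma>6 vP" using p7(2) by simp
                    have jZ: "int j \<le> Z" using p7(1) Z by linarith
                    have s7: "\<sigma>7 vDIM 0 = int d" "\<sigma>7 vNN 0 = int (Suc n')" "\<sigma>7 vN1 0 = int n'" "\<sigma>7 vK 0 = int k"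
                      "\<sigma>7 vOW 0 = int b" "\<sigma>7 vLW 0 = int (length w)" "\<sigma>7 0 = \<sigma> 0"
                      using fr7 fr3 \<sigma> by simp_all
                    show ?thesis
                      unfolding wp_Sq
                    proof (rule wp_exponent_vector[where k = k and n' = n' and a = b and w = w and c = j])
                      fix \<sigma>8 assume p8: "\<And>x. x \<notin> wr (exponent_vector vOW vLW iQ) \<Longrightarrow> \<sigma>8 x = \<sigma>7 x"
                        "\<And>x. x < nvars k (Suc n') \<Longrightarrow> \<sigma>8 vQ (int x) = expvec k (Suc n') w (code_path n' (length w) j) x"
                      show "wp M Z (For iY vDIM (Asg vA (Sc iQ \<^bold>* Sc vDIM \<^bold>+ Sc iY) (Rd vP (Sc iY) \<^bold>- Rd vQ (Sc iY)))) \<sigma>8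
                        (\<lambda>\<tau>'. \<forall>q<Suc j. \<forall>x<d. upd \<tau>' iQ 0 (1 + int j) vA (int q * int d + int x) = rows i q x)"
                        apply (rule wp_For[where n = d and I = "\<lambda>l \<tau>. (\<forall>q<j. \<forall>x<d. \<tau> vA (int q * int d + int x) = rows i q x) \<and>
                           (\<forall>x<l. \<tau> vA (int j * int d + int x) = rows i j x)"])
                        subgoal by simp
                        subgoal using p8(1) fr7 fr3 \<sigma> by simp
                        subgoal by (rule Z)
                        subgoal using p8(1) p7(4) by simp
                        subgoal premises p for l \<tau>
                        proof -
                          have *: "\<tau> vQ (int l) = QV j l" "\<tau> vP (int l) = PV i l" "\<tau> vDIM 0 = int d" "\<tau> iQ 0 = int j"
                            using p(1,2) p8 P7 p6(3) p7(3) fr7 fr3 \<sigma>(1) by (simp_all add: QV_def d_def)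
                          have "\<bar>rows i j l\<bar> \<le> M" using rows_le[of i j l] NM(3) by linarith
                          then show ?thesis
                            using p(1,3,4) M0 * by (auto simp: rows[symmetric] index_eq_iff less_Suc_eq)
                        qed
                        subgoal for \<tau> by (auto simp: less_Suc_eq)
                        done
                    qed (simp_all only: s7 p7(3) words d_def[symmetric] Z bZ jZ M(2), simp_all)
                  qed
                  subgoal premises p7 for \<sigma>7
                  proof -
                    have fr7: "\<sigma>7 x = \<sigma>3 x" if "x \<notin> ?W" for x
                      using that p7(1)[of x] p6(1)[of x] p5(1)[of x] fr4[of x] by simp
                    have RES: "\<sigma>7 vRES 0 = (if \<exists>c<i. feasible d N (rows c) then 0 else \<sigma> vRES 0)"
                      using p7(1) p6(1) p5(1) p4(4) by simp
                    show ?thesis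
                    proof (rule wp_decide_feasible[where d = d and N = N and L = L and a = "rows i"])
                      fix \<tau> assume p: "\<And>x. x \<notin> wr decide_feasible \<Longrightarrow> \<tau> x = \<sigma>7 x" "\<tau> vFE 0 = (if feasible d N (rows i) then 1 else 0)"
                      have R: "\<tau> vRES 0 = (if \<exists>c<i. feasible d N (rows c) then 0 else \<sigma> vRES 0)" using p(1) RES by simp
                      have RM: "\<bar>\<tau> vRES 0\<bar> \<le> M" using R \<sigma>(9) M0 by auto
                      have ex: "(\<exists>c<Suc i. feasible d N (rows c)) \<longleftrightarrow> (\<exists>c<i. feasible d N (rows c)) \<or> feasible d N (rows i)"
                        by (auto simp: less_Suc_eq)
                      show "wp M Z (Cond (Sc vFE) (Asg vRES (Num 0) (Num 0)) (Asg vRES (Num 0) (Sc vRES))) \<tau> (\<lambda>\<tau>'.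
                          upd \<tau>' iS 0 (1 + int i) vRES 0 = (if \<exists>c<Suc i. feasible d N (rows c) then 0 else \<sigma> vRES 0))"
                        unfolding ex using p(2) R RM M0 by (cases "\<exists>c<i. feasible d N (rows c)") auto
                    qed (use fr7 fr3 n3 \<sigma>(1) p7(3) rows_le Z M(2,3)[folded N_def] pos in simp_all)
                  qed
                  done
                done
            qed (simp_all only: s4 p4(3) words d_def[symmetric] Z bZ iZ M(2), simp_all)
          qed
          subgoal premises p4 for \<tau>
          proof (rule Q)
            show "\<tau> x = \<sigma> x" if "x \<notin> wr test_pair" for x using that p4(1)[of x] fr3[of x] by simp
            show "\<tau> vRES 0 = (if separated k n' v w then 0 else \<sigma> vRES 0)"
              using p4(3) unfolding separated_iff by (simp add: NV_def N_def d_def rows_def)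
          qed
          done
        then show ?thesis
          unfolding \<sigma>3_def using M0 NM by (simp add: s2 n2 LL steps rounds)
      qed
      done
    done
qed

text \<open>\<open>n'\<close> enters as a literal, so there is one program for each
  \<open>n\<close>. The second pass exchanges the words by arithmetic on \<open>vPASS\<close>: the
  letters of \<open>v\<close> start at cell 3 and those of \<open>w\<close> at cell
  \<open>3 + length v\<close>. The input is overwritten only by the final assignment of the
  result.\<close>

definition decide_identity :: "nat \<Rightarrow> stm" where
  "decide_identity n' =
    Asg vK (Num 0) (Rd 0 (Num 0)) ;;
    Asg vNN (Num 0) (Num (int (Suc n'))) ;;
    Asg vN1 (Num 0) (Num (int n')) ;;
    Asg vDIM (Num 0) (Sc vK \<^bold>* Sc vNN \<^bold>* Sc vNN \<^bold>+ Sc vNN \<^bold>+ Sc vNN) ;;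
    Asg vRES (Num 0) (Num 1) ;;
    Asg vTWO (Num 0) (Num 2) ;;
    For vPASS vTWO (
      Asg vLV (Num 0) (Rd 0 (Num 1 \<^bold>+ Sc vPASS)) ;;
      Asg vLW (Num 0) (Rd 0 (Num 2 \<^bold>- Sc vPASS)) ;;
      Asg vOV (Num 0) (Num 3 \<^bold>+ Sc vPASS \<^bold>* Rd 0 (Num 1)) ;;
      Asg vOW (Num 0) (Num 3 \<^bold>+ (Num 1 \<^bold>- Sc vPASS) \<^bold>* Rd 0 (Num 1)) ;;
      test_pair) ;;
    Asg 0 (Num 0) (Sc vRES)"

lemma wf_decide_identity: "wf_stm (decide_identity n')"
  by (simp add: decide_identity_def test_pair_def exponent_vector_def compute_power_def decode_digits_def compute_path_def
    count_transitions_def decide_feasible_def init_lp_def perceptron_round_def find_step_def choose_row_def update_step_def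
    sum_into_def)

text \<open>All arrays are read off the machine memory, so \<open>models\<close> holds by
  definition. Apart from array 0, their cells of nonnegative index have negative addresses and
  contain 0.\<close>

definition input_store :: "nat \<times> nat list \<times> nat list \<Rightarrow> store" where
  "input_store x j i = input_memory x (loc j i)"

lemma input_memory_cell:
  "input_memory (k, v, w) 0 = int k" "input_memory (k, v, w) 1 = int (length v)" "input_memory (k, v, w) 2 = int (length w)"
  "t < length v \<Longrightarrow> input_memory (k, v, w) (int (3 + t)) = int (v ! t)"
  "t < length w \<Longrightarrow> input_memory (k, v, w) (int (3 + length v + t)) = int (w ! t)"
  by (auto simp: Let_def nth_append nth_Cons nat_add_distrib split: nat.split)

lemma input_memory_bounded:
  assumes "set v \<subseteq> {..<k}" "set w \<subseteq> {..<k}"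
  shows "\<bar>input_memory (k, v, w) i\<bar> \<le> int (k + length v + length w)"
proof -
  let ?xs = "map int ([k, length v, length w] @ v @ w)"
  have "\<bar>y\<bar> \<le> int (k + length v + length w)" if "y \<in> set ?xs" for y
    using that assms by (auto simp: less_imp_le)
  moreover have "input_memory (k, v, w) i = 0 \<or> input_memory (k, v, w) i \<in> set ?xs"
    unfolding input_memory.simps Let_def by (metis nat_less_iff nth_mem)
  ultimately show ?thesis by (metis abs_zero of_nat_0_le_iff)
qed

text \<open>Covers both passes, and includes the loop bounds because counters are stored numbers
  too.\<close>

definition number_bound :: "nat \<Rightarrow> nat \<times> nat list \<times> nat list \<Rightarrow> nat" where
  "number_bound n' = (\<lambda>(k, v, w). loop_bound n' k v w + loop_bound n' k w v +
     lp_bound (nvars k (Suc n')) (codes n' (length w)) (length v + length w + 2) +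
     lp_bound (nvars k (Suc n')) (codes n' (length v)) (length w + length v + 2))"

lemma wp_decide_identity:
  assumes words: "set v \<subseteq> {..<k}" "set w \<subseteq> {..<k}"
    and Z: "int (loop_bound n' k v w + loop_bound n' k w v) \<le> Z" "Z \<le> M" "int (number_bound n' (k, v, w)) \<le> M"
  shows "wp M Z (decide_identity n') (input_store (k, v, w))
    (\<lambda>\<tau>. \<tau> 0 0 = (if \<not> separated k n' v w \<and> \<not> separated k n' w v then 1 else 0))"
proof -
  let ?d = "nvars k (Suc n')"
  define s0 where "s0 = input_store (k, v, w)"
  have in0: "s0 0 i = input_memory (k, v, w) i" for i by (simp add: s0_def input_store_def loc_def)
  note cell = input_memory_cell[where k = k and v = v and w = w, folded in0]
  have le: "int k \<le> M" "int (Suc n') \<le> M" "int n' \<le> M" "int ?d \<le> M" "int (length v) \<le> M" "int (length w) \<le> M" "3 + int (length v) \<le> M"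
     "3 + int (length w) \<le> M" "0 \<le> M" "1 \<le> M" "2 \<le> M" "3 \<le> M" "2 \<le> Z"
    using Z(1,2) unfolding loop_bound_def by linarith+
  have Z': "int (loop_bound n' k v w) \<le> Z" "int (loop_bound n' k w v) \<le> Z" using Z(1) by linarith+
  have M': "int (lp_bound ?d (codes n' (length w)) (length v + length w + 2)) \<le> M"
    "int (lp_bound ?d (codes n' (length v)) (length w + length v + 2)) \<le> M"
    using Z(3) unfolding number_bound_def by simp_all
  have dim: "2 + 2 * int n' + int k * (1 + int n') * (1 + int n') = int ?d"
    by (simp add: nvars_def algebra_simps)
  define \<sigma> where "\<sigma> = upd (upd (upd (upd (upd (upd s0 vK 0 (int k)) vNN 0 (int (Suc n'))) vN1 0 (int n')) vDIM 0 (int ?d)) vRES 0 1) vTWO 0 2"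
  have \<sigma>: "\<sigma> 0 = s0 0" "\<sigma> vK 0 = int k" "\<sigma> vNN 0 = int (Suc n')" "\<sigma> vN1 0 = int n'" "\<sigma> vDIM 0 = int ?d" "\<sigma> vRES 0 = 1" "\<sigma> vTWO 0 = int 2"
    by (simp_all add: \<sigma>_def)
  have "wp M Z (For vPASS vTWO (
      Asg vLV (Num 0) (Rd 0 (Num 1 \<^bold>+ Sc vPASS)) ;;
      Asg vLW (Num 0) (Rd 0 (Num 2 \<^bold>- Sc vPASS)) ;;
      Asg vOV (Num 0) (Num 3 \<^bold>+ Sc vPASS \<^bold>* Rd 0 (Num 1)) ;;
      Asg vOW (Num 0) (Num 3 \<^bold>+ (Num 1 \<^bold>- Sc vPASS) \<^bold>* Rd 0 (Num 1)) ;;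
      test_pair)) \<sigma> (\<lambda>\<tau>. wp M Z (Asg 0 (Num 0) (Sc vRES)) \<tau>
        (\<lambda>\<tau>. \<tau> 0 0 = (if \<not> separated k n' v w \<and> \<not> separated k n' w v then 1 else 0)))"
    apply (rule wp_For[where n = 2 and I = "\<lambda>i \<tau>. \<tau> vRES 0 = (if (0 < i \<and> separated k n' v w) \<or> (1 < i \<and> separated k n' w v) then 0 else 1)"])
    subgoal by simp
    subgoal by (rule \<sigma>)
    subgoal using le by simp
    subgoal using \<sigma> by simp
    subgoal premises p for i \<tau>
    proof -
      have fr: "\<tau> 0 = s0 0" "\<tau> vK 0 = int k" "\<tau> vNN 0 = int (Suc n')" "\<tau> vN1 0 = int n'" "\<tau> vDIM 0 = int ?d"
        using p(2) \<sigma> by simp_all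
      from p(1) consider "i = 0" | "i = 1" by linarith
      then show ?thesis
      proof cases
        case 1
        define \<tau>' where "\<tau>' = upd (upd (upd (upd \<tau> vLV 0 (int (length v))) vLW 0 (int (length w))) vOV 0 3) vOW 0 (3 + int (length v))"
        have "wp M Z test_pair \<tau>' (\<lambda>\<tau>''. upd \<tau>'' vPASS 0 (1 + int i) vRES 0 =
            (if (0 < Suc i \<and> separated k n' v w) \<or> (1 < Suc i \<and> separated k n' w v) then 0 else 1))"
          by (rule wp_test_pair[where k = k and n' = n' and v = v and w = w and a = 3 and b = "3 + length v"])
            (use fr cell words Z' M' Z(2) p(4) 1 in \<open>auto simp: \<tau>'_def add.assoc\<close>)
        then show ?thesis using 1 p(3) fr cell le unfolding \<tau>'_def by simp
      next
        case 2
        define \<tau>' where "\<tau>' = upd (upd (upd (upd \<tau> vLV 0 (int (length w))) vLW 0 (int (length v))) vOV 0 (3 + int (length v))) vOW 0 3"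
        have "wp M Z test_pair \<tau>' (\<lambda>\<tau>''. upd \<tau>'' vPASS 0 (1 + int i) vRES 0 =
            (if (0 < Suc i \<and> separated k n' v w) \<or> (1 < Suc i \<and> separated k n' w v) then 0 else 1))"
          by (rule wp_test_pair[where k = k and n' = n' and v = w and w = v and a = "3 + length v" and b = 3])
            (use fr cell words Z' M' Z(2) p(4) 2 in \<open>auto simp: \<tau>'_def add.assoc\<close>)
        then show ?thesis using 2 p(3) fr cell le unfolding \<tau>'_def by simp
      qed
    qed
    subgoal using le by auto
    done
  then show ?thesis
    unfolding decide_identity_def s0_def[symmetric] \<sigma>_def using le cell by (simp add: dim)
qed

section \<open>Polynomial bounds\<close>

definition poly_bounded :: "(nat \<times> nat list \<times> nat list \<Rightarrow> nat) \<Rightarrow> bool" where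
  "poly_bounded f \<longleftrightarrow> (\<exists>C e. \<forall>k v w. f (k, v, w) \<le> C * (k + length v + length w + 1) ^ e)"

lemma poly_bounded_const: "poly_bounded (\<lambda>_. c)"
  unfolding poly_bounded_def by (intro exI[of _ c] exI[of _ 0]) simp

lemma poly_bounded_input:
  "poly_bounded (\<lambda>(k, v, w). k)" "poly_bounded (\<lambda>(k, v, w). length v)" "poly_bounded (\<lambda>(k, v, w). length w)"
  unfolding poly_bounded_def by (intro exI[of _ 1]; simp)+

lemma poly_bounded_add:
  assumes "poly_bounded f" "poly_bounded g"
  shows "poly_bounded (\<lambda>x. f x + g x)"
proof -
  from assms obtain C e C' e' where f: "\<And>k v w. f (k, v, w) \<le> C * (k + length v + length w + 1) ^ e"
    and g: "\<And>k v w. g (k, v, w) \<le> C' * (k + length v + length w + 1) ^ e'" unfolding poly_bounded_def by blast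
  have "f (k, v, w) + g (k, v, w) \<le> (C + C') * (k + length v + length w + 1) ^ (e + e')" for k v w
  proof -
    let ?b = "k + length v + length w + 1"
    have "C * ?b ^ e \<le> C * ?b ^ (e + e')" "C' * ?b ^ e' \<le> C' * ?b ^ (e + e')"
      by (intro mult_left_mono power_increasing; simp)+
    then show ?thesis using f[of k v w] g[of k v w] by (simp only: distrib_right)
  qed
  then show ?thesis unfolding poly_bounded_def by blast
qed

lemma poly_bounded_mult:
  assumes "poly_bounded f" "poly_bounded g"
  shows "poly_bounded (\<lambda>x. f x * g x)"
proof -
  from assms obtain C e C' e' where f: "\<And>k v w. f (k, v, w) \<le> C * (k + length v + length w + 1) ^ e"
    and g: "\<And>k v w. g (k, v, w) \<le> C' * (k + length v + length w + 1) ^ e'" unfolding poly_bounded_def by blast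
  have "f (k, v, w) * g (k, v, w) \<le> (C * C') * (k + length v + length w + 1) ^ (e + e')" for k v w
    using mult_le_mono[OF f[of k v w] g[of k v w]] by (simp add: power_add ac_simps)
  then show ?thesis unfolding poly_bounded_def by blast
qed

lemma poly_bounded_power: "poly_bounded f \<Longrightarrow> poly_bounded (\<lambda>x. f x ^ e)"
  by (induction e) (auto intro: poly_bounded_const poly_bounded_mult)

lemmas poly_bounded_intros = poly_bounded_const poly_bounded_input poly_bounded_add poly_bounded_mult poly_bounded_power

text \<open>Captures polynomial bit length; the powers with polynomial exponents in
  \<open>lp_bound\<close> call for this class.\<close>

definition exp_bounded :: "(nat \<times> nat list \<times> nat list \<Rightarrow> nat) \<Rightarrow> bool" where
  "exp_bounded f \<longleftrightarrow> (\<exists>g. poly_bounded g \<and> (\<forall>x. f x \<le> 2 ^ g x))"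

lemma exp_bounded_poly: "poly_bounded f \<Longrightarrow> exp_bounded f"
  unfolding exp_bounded_def by (intro exI[of _ f]) (auto intro: less_imp_le)

lemma exp_bounded_mult:
  assumes "exp_bounded f" "exp_bounded g"
  shows "exp_bounded (\<lambda>x. f x * g x)"
proof -
  from assms obtain f' g' where *: "poly_bounded f'" "\<And>x. f x \<le> 2 ^ f' x" "poly_bounded g'" "\<And>x. g x \<le> 2 ^ g' x"
    unfolding exp_bounded_def by blast
  have "f x * g x \<le> 2 ^ (f' x + g' x)" for x
    using mult_le_mono[OF *(2,4)[of x]] by (simp add: power_add)
  then show ?thesis unfolding exp_bounded_def using poly_bounded_add[OF *(1,3)] by blast
qed

lemma exp_bounded_add:
  assumes "exp_bounded f" "exp_bounded g"
  shows "exp_bounded (\<lambda>x. f x + g x)"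
proof -
  from assms obtain f' g' where *: "poly_bounded f'" "\<And>x. f x \<le> 2 ^ f' x" "poly_bounded g'" "\<And>x. g x \<le> 2 ^ g' x"
    unfolding exp_bounded_def by blast
  have "f x + g x \<le> 2 ^ (f' x + g' x + 1)" for x
  proof -
    have "(2::nat) ^ f' x \<le> 2 ^ (f' x + g' x)" "(2::nat) ^ g' x \<le> 2 ^ (f' x + g' x)" by (intro power_increasing; simp)+
    then have "f x \<le> 2 ^ (f' x + g' x)" "g x \<le> 2 ^ (f' x + g' x)" using *(2,4)[of x] by linarith+
    then show ?thesis by simp
  qed
  moreover have "poly_bounded (\<lambda>x. f' x + g' x + 1)" by (intro poly_bounded_intros *)
  ultimately show ?thesis unfolding exp_bounded_def by blast
qed

text \<open>Since \<open>f x \<le> 2 ^ f x\<close>, the power is at most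
  \<open>2 ^ (f x * g x)\<close>.\<close>

lemma exp_bounded_power:
  assumes "poly_bounded f" "poly_bounded g"
  shows "exp_bounded (\<lambda>x. f x ^ g x)"
proof -
  have "f x ^ g x \<le> 2 ^ (f x * g x)" for x
  proof -
    have "f x ^ g x \<le> (2 ^ f x) ^ g x" by (intro power_mono) (auto intro: less_imp_le)
    then show ?thesis by (simp add: power_mult)
  qed
  then show ?thesis unfolding exp_bounded_def using poly_bounded_mult[OF assms] by blast
qed

section \<open>Bounds for the loops and the numbers of the program\<close>

lemma poly_bounded_codes: "poly_bounded (\<lambda>(k, v, w). codes n' (length v))" "poly_bounded (\<lambda>(k, v, w). codes n' (length w))"
proof -
  have "poly_bounded (\<lambda>x. ((\<lambda>(k, v, w). length v) x + 2) ^ n')" "poly_bounded (\<lambda>x. ((\<lambda>(k, v, w). length w) x + 2) ^ n')"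
    by (intro poly_bounded_intros)+
  then show "poly_bounded (\<lambda>(k, v, w). codes n' (length v))" "poly_bounded (\<lambda>(k, v, w). codes n' (length w))"
    by (simp_all add: codes_def case_prod_unfold)
qed

lemma poly_bounded_nvars: "poly_bounded (\<lambda>(k, v, w). nvars k n)"
proof -
  have "poly_bounded (\<lambda>x. (\<lambda>(k, v, w). k) x * n * n + n + n)" by (intro poly_bounded_intros)
  then show ?thesis by (simp add: nvars_def case_prod_unfold)
qed

lemma poly_bounded_steps:
  assumes "poly_bounded d" "poly_bounded N" "poly_bounded L"
  shows "poly_bounded (\<lambda>x. steps (d x) (N x) (L x))"
  unfolding steps_def by (intro poly_bounded_intros assms)

lemma poly_bounded_rounds:
  assumes "poly_bounded d" "poly_bounded N" "poly_bounded L"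
  shows "poly_bounded (\<lambda>x. rounds (d x) (N x) (L x))"
  unfolding rounds_def width_def by (intro poly_bounded_intros assms)

lemma exp_bounded_lp_bound:
  assumes "poly_bounded d" "poly_bounded N" "poly_bounded L"
  shows "exp_bounded (\<lambda>x. lp_bound (d x) (N x) (L x))"
  unfolding lp_bound_def determinant_bound_def direction_bound_def
  by (intro exp_bounded_add exp_bounded_mult exp_bounded_power poly_bounded_steps poly_bounded_rounds poly_bounded_intros assms
    | rule exp_bounded_poly)+

lemma poly_bounded_loop_bound: "poly_bounded (\<lambda>(k, v, w). loop_bound n' k v w + loop_bound n' k w v)"
proof -
  let ?k = "\<lambda>(k, v, w). k" and ?v = "\<lambda>(k, v, w). length v" and ?w = "\<lambda>(k, v, w). length w"
    and ?d = "\<lambda>(k, v, w). nvars k (Suc n')" and ?cv = "\<lambda>(k, v, w). codes n' (length v)" and ?cw = "\<lambda>(k, v, w). codes n' (length w)"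
  have "poly_bounded (\<lambda>x. (?k x + ?v x + ?w x + 5 + n' + ?d x + ?cv x + ?cw x + steps (?d x) (?cw x) (?v x + ?w x + 2)
        + rounds (?d x) (?cw x) (?v x + ?w x + 2)) +
      (?k x + ?w x + ?v x + 5 + n' + ?d x + ?cw x + ?cv x + steps (?d x) (?cv x) (?w x + ?v x + 2)
        + rounds (?d x) (?cv x) (?w x + ?v x + 2)))"
    by (intro poly_bounded_intros poly_bounded_steps poly_bounded_rounds poly_bounded_codes poly_bounded_nvars)
  then show ?thesis by (simp add: loop_bound_def case_prod_unfold)
qed

lemma exp_bounded_number_bound: "exp_bounded (number_bound n')"
proof -
  let ?k = "\<lambda>(k, v, w). k" and ?v = "\<lambda>(k, v, w). length v" and ?w = "\<lambda>(k, v, w). length w"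
    and ?d = "\<lambda>(k, v, w). nvars k (Suc n')" and ?cv = "\<lambda>(k, v, w). codes n' (length v)" and ?cw = "\<lambda>(k, v, w). codes n' (length w)"
  have "exp_bounded (\<lambda>x. (\<lambda>(k, v, w). loop_bound n' k v w + loop_bound n' k w v) x +
      lp_bound (?d x) (?cw x) (?v x + ?w x + 2) + lp_bound (?d x) (?cv x) (?w x + ?v x + 2))"
    by (intro exp_bounded_add exp_bounded_lp_bound exp_bounded_poly[OF poly_bounded_loop_bound]
      poly_bounded_intros poly_bounded_codes poly_bounded_nvars)
  then show ?thesis by (simp add: number_bound_def case_prod_unfold)
qed

theorem theorem8p3:
  fixes n :: nat
  assumes "n > 0"
  shows "\<exists>(p :: prog) (T :: nat poly poly).
    decides_in_time p input_memory identities
      (\<lambda>(k, v, w). identity_holds {..<k} (UT_trop n) (*) v w)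
      (\<lambda>(k, v, w). poly (poly T [:length v + length w:]) (card {..<k}))"
proof -
  obtain n' where n: "n = Suc n'" using assms gr0_implies_Suc by blast
  define s where "s = decide_identity n'"
  define Z where "Z = (\<lambda>(k, v, w). loop_bound n' k v w + loop_bound n' k w v)"
  obtain C e where run: "runs_in s C e" using exec_compile[OF wf_decide_identity[of n']] unfolding s_def by blast
  obtain X where X: "poly_bounded X" "\<And>x. number_bound n' x \<le> 2 ^ X x"
    using exp_bounded_number_bound unfolding exp_bounded_def by blast
  \<comment> \<open>Loop lengths are polynomial and the numbers have polynomially many bits, so the
    time bound of \<open>runs_in\<close> is polynomial. The second 1 added to \<open>X x\<close>
    accounts for the shift in \<open>X'\<close> below.\<close>
  have "poly_bounded (\<lambda>x. C * (Z x + 1) ^ e * (X x + 1 + 1))"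
    unfolding Z_def by (intro poly_bounded_intros X(1) poly_bounded_loop_bound)
  then obtain C' e' where time: "\<And>k v w. C * (Z (k, v, w) + 1) ^ e * (X (k, v, w) + 1 + 1) \<le> C' * (k + length v + length w + 1) ^ e'"
    unfolding poly_bounded_def by blast
  \<comment> \<open>The outer variable stands for the total length and the coefficients are
    polynomials in the alphabet size: the base of the power evaluates to
    \<open>1 + k + l\<close>.\<close>
  define T :: "nat poly poly" where "T = [:[:C':]:] * [:[:1, 1:], 1:] ^ e'"
  have T: "poly (poly T [:l:]) k = C' * (k + l + 1) ^ e'" for l k
    by (simp add: T_def poly_power poly_mult ac_simps)
  have "decides_in_time (compile s) input_memory identities
      (\<lambda>(k, v, w). identity_holds {..<k} (UT_trop n) (*) v w)
      (\<lambda>(k, v, w). poly (poly T [:length v + length w:]) (card {..<k}))"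
    unfolding decides_in_time_def
  proof
    fix x assume "x \<in> identities"
    then obtain k v w where x: "x = (k, v, w)" and vw: "v \<in> free_semigroup {..<k}" "w \<in> free_semigroup {..<k}"
      unfolding identities_def by blast
    have set: "set v \<subseteq> {..<k}" "set w \<subseteq> {..<k}" using vw by (auto simp: free_semigroup_def)
    \<comment> \<open>Shifted by one because \<open>runs_in\<close> asks for a positive bit
      length.\<close>
    define X' where "X' = X x + 1"
    have nb: "number_bound n' x \<le> 2 ^ X'" using X(2)[of x] by (simp add: X'_def)
    have Znb: "Z x \<le> number_bound n' x" by (simp add: Z_def number_bound_def x)
    have models: "models (input_memory x) (input_store x)"
      by (simp add: models_def input_store_def)
    have "k + length v + length w \<le> Z x" by (simp add: Z_def x loop_bound_def)
    then have "int (k + length v + length w) \<le> int (2 ^ X')" using Znb nb by linarith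
    then have bounded: "bounded_store (2 ^ X') (input_store x)"
      unfolding bounded_store_def input_store_def x using input_memory_bounded[OF set]
      by (metis of_nat_numeral of_nat_power order_trans)
    have "wp (2 ^ X') (int (Z x)) s (input_store x)
      (\<lambda>\<tau>. \<tau> 0 0 = (if \<not> separated k n' v w \<and> \<not> separated k n' w v then 1 else 0))"
      unfolding s_def x
    proof (rule wp_decide_identity[OF set])
      have "int (Z x) \<le> int (2 ^ X')" "int (number_bound n' x) \<le> int (2 ^ X')" using Znb nb by linarith+
      then show "int (Z (k, v, w)) \<le> 2 ^ X'" "int (number_bound n' (k, v, w)) \<le> 2 ^ X'" by (simp_all add: x)
    qed (simp add: Z_def)
    then have safe: "safe (2 ^ X') (int (Z x)) s (input_store x)"
      and res: "run s (input_store x) 0 0 = (if identity_holds {..<k} (UT_trop n) (*) v w then 1 else 0)"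
      unfolding wp_def n identity_holds_iff[OF vw] by auto
    have "Z x \<le> 2 ^ X'" using Znb nb by simp
    from runs_inD[OF run _ this models bounded safe] obtain t m where
      t: "exec (compile s) (input_memory x) t m" "models m (run s (input_store x))" "t \<le> C * (Z x + 1) ^ e * (X' + 1)"
      by (auto simp: X'_def)
    \<comment> \<open>Cell 0 of the machine is index 0 of array 0.\<close>
    have "m 0 = run s (input_store x) 0 0"
      using t(2) unfolding models_def loc_def by force
    moreover have "t \<le> poly (poly T [:length v + length w:]) (card {..<k})"
      using t(3) time[of k v w] unfolding T X'_def x by (simp add: add.assoc)
    ultimately show "\<exists>t m. exec (compile s) (input_memory x) t m \<and> t \<le> (case x of (k, v, w) \<Rightarrow>
        poly (poly T [:length v + length w:]) (card {..<k})) \<and>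
        m 0 = (if case x of (k, v, w) \<Rightarrow> identity_holds {..<k} (UT_trop n) (*) v w then 1 else 0)"
      using t(1) res unfolding x
      by (intro exI[of _ t] exI[of _ m] conjI) (simp_all del: input_memory.simps)
  qed
  then show ?thesis by blast
qed

end
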